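(* Let $n$ be a positive integer. Then the mixed cycle $C^{1}_{2n+1}$ is determined by its Hermitian spectrum (DHS) if and only if $n\notin\{3,4,7\}$.
   Context: A mixed graph has undirected edges and directed edges (ordered pairs $(x,y)$). For vertices $v_1,\dots,v_n$, its Hermitian adjacency matrix $H(X)$ has $(j,k)$ entry $1$ if $v_jv_k$ is an undirected edge, $i$ if $(v_j,v_k)$ is a directed edge, $-i$ if $(v_k,v_j)$ is a directed edge, $0$ otherwise; $\mathrm{Spec}_H(X)$ is its multiset of eigenvalues. Mixed graphs $X,Y$ on the same vertex set are switching equivalent if $H(X)=D^{-1}H(Y)D$ for a diagonal $D$ with diagonal entries in $\{\pm1,\pm i\}$. A mixed graph $X$ is DHS if every mixed graph $Y$ with $\mathrm{Spec}_H(Y)=\mathrm{Spec}_H(X)$ is switching equivalent to a mixed graph isomorphic to $X$. $C^1_m$ is the mixed cycle of order $m$ with exactly one directed edge and all other edges undirected. *)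

theory Defs
  imports
    "Jordan_Normal_Form.Char_Poly"
    "HOL-Computational_Algebra.Polynomial"
begin

record 'a mixed_graph =
  mverts :: "'a set"
  medges :: "'a set set"
  marcs :: "('a \<times> 'a) set"

text \<open>Finite and simple: no loops, and two vertices are joined either by nothing, by one
  undirected edge, or by one directed edge in one of the two directions. This makes the cases
  in the definition of the Hermitian adjacency matrix mutually exclusive.\<close>

definition mixed_graph :: "('a, 'b) mixed_graph_scheme \<Rightarrow> bool" where
  "mixed_graph X \<longleftrightarrow>
     finite (mverts X) \<and>
     (\<forall>e \<in> medges X. e \<subseteq> mverts X \<and> card e = 2) \<and>
     marcs X \<subseteq> mverts X \<times> mverts X \<and>
     (\<forall>x y. (x, y) \<in> marcs X \<longrightarrow> x \<noteq> y \<and> (y, x) \<notin> marcs X \<and> {x, y} \<notin> medges X)"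

text \<open>The entry of the Hermitian adjacency matrix indexed by the vertices \<open>u\<close> and \<open>v\<close>.\<close>

definition herm_entry :: "('a, 'b) mixed_graph_scheme \<Rightarrow> 'a \<Rightarrow> 'a \<Rightarrow> complex" where
  "herm_entry X u v =
     (if {u, v} \<in> medges X then 1
      else if (u, v) \<in> marcs X then \<i>
      else if (v, u) \<in> marcs X then - \<i>
      else 0)"

text \<open>The vertices are listed as \<open>v\<^sub>1, \<dots>, v\<^sub>n\<close> in increasing order; a different enumeration
  conjugates the matrix by a permutation matrix and so affects neither the spectrum nor
  switching equivalence. Matrix indices start at 0.\<close>

definition herm_adj :: "('a :: linorder, 'b) mixed_graph_scheme \<Rightarrow> complex mat" where
  "herm_adj X =
     (let vs = sorted_list_of_set (mverts X); n = length vs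
      in mat n n (\<lambda>(j, k). herm_entry X (vs ! j) (vs ! k)))"

text \<open>Eigenvalues counted with their (algebraic) multiplicities; these agree with the
  geometric ones because the matrix is Hermitian.\<close>

definition herm_spec :: "('a :: linorder, 'b) mixed_graph_scheme \<Rightarrow> complex multiset" where
  "herm_spec X = proots (char_poly (herm_adj X))"

text \<open>In the following, \<open>E\<close> is the inverse of \<open>D\<close>.\<close>

definition switching_equivalent ::
    "('a :: linorder, 'b) mixed_graph_scheme \<Rightarrow> ('a, 'c) mixed_graph_scheme \<Rightarrow> bool" where
  "switching_equivalent X Y \<longleftrightarrow>
     mverts X = mverts Y \<and>
     (\<exists>D E. D \<in> carrier_mat (card (mverts X)) (card (mverts X)) \<and>
            E \<in> carrier_mat (card (mverts X)) (card (mverts X)) \<and>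
            diagonal_mat D \<and>
            (\<forall>j < card (mverts X). D $$ (j, j) \<in> {1, - 1, \<i>, - \<i>}) \<and>
            inverts_mat D E \<and> inverts_mat E D \<and>
            herm_adj X = E * herm_adj Y * D)"

definition mixed_graph_iso ::
    "('a, 'c) mixed_graph_scheme \<Rightarrow> ('b, 'd) mixed_graph_scheme \<Rightarrow> bool" where
  "mixed_graph_iso X Y \<longleftrightarrow>
     (\<exists>f. bij_betw f (mverts X) (mverts Y) \<and>
          (\<forall>u \<in> mverts X. \<forall>v \<in> mverts X.
             ({u, v} \<in> medges X \<longleftrightarrow> {f u, f v} \<in> medges Y) \<and>
             ((u, v) \<in> marcs X \<longleftrightarrow> (f u, f v) \<in> marcs Y)))"

text \<open>The competing graph \<open>Y\<close> has vertices in \<^typ>\<open>nat\<close>, which covers every finite mixed graph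
  up to isomorphism. (A type variable for its vertices could be instantiated by a type too small
  to hold any competitor.)\<close>

definition DHS :: "('a :: linorder, 'b) mixed_graph_scheme \<Rightarrow> bool" where
  "DHS X \<longleftrightarrow>
     (\<forall>Y :: nat mixed_graph. mixed_graph Y \<and> herm_spec Y = herm_spec X \<longrightarrow>
        (\<exists>Z :: nat mixed_graph.
           mixed_graph Z \<and> switching_equivalent Y Z \<and> mixed_graph_iso Z X))"

text \<open>The mixed cycle \<open>C\<^sup>1\<^sub>m\<close>, meaningful for \<open>m \<ge> 3\<close>: the path
  \<open>0, 1, \<dots>, m - 1\<close> of undirected edges closed by the directed edge from \<open>m - 1\<close> to \<open>0\<close>.\<close>

definition mixed_cycle1 :: "nat \<Rightarrow> nat mixed_graph" where
  "mixed_cycle1 m =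
     \<lparr>mverts = {0..<m},
      medges = {{k, Suc k} | k. Suc k < m},
      marcs = {(m - 1, 0)}\<rparr>"

lemma mixed_graph_mixed_cycle1:
  assumes "m \<ge> 3"
  shows "mixed_graph (mixed_cycle1 m)"
  using assms
  by (auto simp: mixed_graph_def mixed_cycle1_def card_insert_if doubleton_eq_iff)

end

theory Submission
  imports Defs "HOL-Number_Theory.Totient"
begin

text \<open>For odd \<open>m\<close> the spectrum of \<open>C\<^sup>1\<^sub>m\<close> consists of the simple eigenvalues
  \<open>2 sin (2\<pi>t/m)\<close>, \<open>t \<in> \<int>/m\<close>, and \<open>det (2I - H) = 2\<close>. Let \<open>Y\<close> be cospectral. Each
  connected component takes a subset of the indices \<open>t\<close>, and this subset is closed under
  multiplication by units: the power sums of the corresponding roots of unity are bounded integers,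
  congruent modulo \<open>p\<close> to their \<open>p\<close>-th conjugates, hence invariant under all large primes. Invariance
  under \<open>t \<mapsto> 2t\<close> gives \<open>tr H\<^sup>4 = 3 tr H\<^sup>2\<close> on every component, so a component without
  4-cycles of weight \<open>-1\<close> is a vertex, a cycle, or a tree with three leaves.

  Since \<open>4 - H\<^sup>2\<close> is positive definite and \<open>det (2I - H)\<close> is not divisible by 4, in the other
  components a 4-cycle of weight \<open>-1\<close>, and likewise the branch vertex of a tree, extends to six
  vertices whose Gram matrix \<open>2I - H\<close> spans the root lattice \<open>E\<^sub>6\<close>. Projecting the remaining
  vertices to the orthogonal complement of that lattice leaves room for at most two of them, and 3
  does not divide the determinant, so such components have 7 or 8 vertices. Exactly one component has
  odd order (the one with eigenvalue 0), the others have 8 vertices, and the sizes \<open>\<phi>(d)\<close> of the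
  unit orbits allow at most two of these. Counting vertices gives \<open>m \<in> {7, 9, 15}\<close>, or \<open>Y\<close> is a
  single cycle, whose weight must be \<open>\<plusminus>\<i>\<close>. For the three exceptional orders explicit
  cospectral mates have a vertex of degree 3.\<close>

section \<open>The spectrum of \<open>C\<^sup>1\<^sub>m\<close>\<close>

text \<open>Oddness of \<open>m\<close> enters through one fact: no \<open>omega m s\<close> is the
  inverse of an \<open>omega m t\<close>. This makes the eigenvalues distinct, so that each
  eigenvector lives on a single component and the spectrum of a component is a set of indices
  instead of a multiset. It also keeps them strictly between -2 and 2, so that a forbidden
  configuration can be refuted by one vector on which \<open>2 - H\<close> or \<open>4 - H^2\<close>
  fails to be positive. Positivity alone would still admit configurations such as twin leaves; these
  are removed by arithmetic. The determinant is the value of a Dickson polynomial at 2, and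
  \<open>E_6\<close> has discriminant 3, coprime to it, so six such vertices are never a full
  component. The gains lie in the Gaussian integers, while \<open>E_6\<close> is a lattice over the
  integers. Norms reconcile the two: the real and the imaginary part of a vector of the dual lattice
  each cost at least 4/3 if nonzero, and a projection has norm below 2, so one part vanishes and a
  unit makes the vector integral.\<close>

fun dickson :: "nat \<Rightarrow> complex poly" where
  "dickson 0 = [:2:]"
| "dickson (Suc 0) = [:0, 1:]"
| "dickson (Suc (Suc n)) = [:0, 1:] * dickson (Suc n) - dickson n"

text \<open>\<open>dickson n\<close> is the Dickson polynomial of the first kind with parameter 1,
  that is \<open>2 T_n(x/2)\<close> for the Chebyshev polynomial \<open>T_n\<close>.\<close>

lemma poly_dickson:
  assumes "w \<noteq> 0"
  shows "poly (dickson n) (w + inverse w) = w ^ n + inverse w ^ n"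
  using assms by (induction n rule: dickson.induct) (auto simp: field_simps)

text \<open>Read as a characteristic polynomial at 2, this is the source of
  \<open>det (2 I - H) = 2\<close>.\<close>

lemma poly_dickson_2: "poly (dickson n) 2 = 2"
  by (induction n rule: dickson.induct) auto

lemma degree_dickson: "degree (dickson (Suc n)) = Suc n \<and> coeff (dickson (Suc n)) (Suc n) = 1"
proof (induction n rule: less_induct)
  case (less n)
  show ?case
  proof (cases n)
    case 0 then show ?thesis by simp
  next
    case (Suc k)
    have IH: "degree (dickson (Suc k)) = Suc k" "coeff (dickson (Suc k)) (Suc k) = 1"
      using less[of k] Suc by auto
    have dk: "degree (dickson k) \<le> k"
    proof (cases k)
      case 0 then show ?thesis by simp
    next
      case (Suc j)
      then show ?thesis using less[of j] \<open>n = Suc k\<close> by auto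
    qed
    have eq: "dickson (Suc n) = pCons 0 (dickson (Suc k)) - dickson k"
      using Suc by simp
    have c: "coeff (dickson (Suc n)) (Suc n) = 1"
      using IH dk Suc by (simp add: eq coeff_eq_0)
    have "degree (dickson (Suc n)) \<le> Suc n"
      unfolding eq using IH dk Suc by (intro degree_diff_le) (auto simp: degree_pCons_eq_if)
    moreover have "degree (dickson (Suc n)) \<ge> Suc n"
      using c by (intro le_degree) auto
    ultimately show ?thesis using c by simp
  qed
qed

text \<open>The factor \<open>- \<i>\<close> places the eigenvalue 0 at index 0, so that
  multiplication of indices modulo \<open>m\<close> acts on the spectrum without a shift.\<close>

definition omega :: "nat \<Rightarrow> nat \<Rightarrow> complex" where
  "omega m t = - \<i> * cis (2 * pi * real t / real m)"

definition lam :: "nat \<Rightarrow> nat \<Rightarrow> real" where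
  "lam m t = 2 * sin (2 * pi * real t / real m)"

lemma omega_nonzero [simp]: "omega m t \<noteq> 0"
  by (simp add: omega_def)

lemma norm_omega [simp]: "norm (omega m t) = 1"
  by (simp add: omega_def norm_mult)

lemma inverse_omega: "inverse (omega m t) = cnj (omega m t)"
  by (simp add: omega_def flip: cis_cnj)

lemma lam_omega: "complex_of_real (lam m t) = omega m t + inverse (omega m t)"
  by (simp add: inverse_omega omega_def lam_def complex_eq_iff)

lemma cis_power_period:
  assumes "m > 0"
  shows "cis (2 * pi * real t / real m) ^ m = 1"
proof -
  have "cis (2 * pi * real t / real m) ^ m = cis (2 * pi * real t)"
    using assms by (simp add: Complex.DeMoivre)
  also have "\<dots> = 1"
    using cis_multiple_2pi[of "real t"] by simp
  finally show ?thesis .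
qed

lemma omega_power:
  assumes "m > 0"
  shows "omega m t ^ m = (- \<i>) ^ m"
  using cis_power_period[OF assms, of t] by (simp add: omega_def power_mult_distrib del: mult_minus_left)

lemma ii_odd_power_add:
  assumes "odd m"
  shows "(- \<i>) ^ m + \<i> ^ m = 0"
  using assms by (simp add: power_minus_odd)

lemma dickson_lam:
  assumes "odd m"
  shows "poly (dickson m) (of_real (lam m t)) = 0"
proof -
  have m: "m > 0" using assms by (cases m) auto
  have "inverse (- \<i>) = \<i>" by (simp add: field_simps)
  then have "inverse (omega m t) ^ m = \<i> ^ m"
    by (metis omega_power[OF m] power_inverse)
  then show ?thesis
    using omega_power[OF m] ii_odd_power_add[OF assms] by (simp add: lam_omega poly_dickson)
qed

lemma cis_inj:
  assumes "s < m" "t < m" "cis (2 * pi * real s / real m) = cis (2 * pi * real t / real m)"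
  shows "s = t"
  using bij_betw_roots_unity[of m] assms by (auto simp: bij_betw_def inj_on_def)

lemma omega_eq_iff:
  assumes "s < m" "t < m"
  shows "omega m s = omega m t \<longleftrightarrow> s = t"
  using cis_inj[OF assms] by (auto simp: omega_def)

text \<open>The \<open>m\<close>-th powers of the two sides are \<open>(-i)^m\<close> and
  \<open>i^m\<close>, which differ by a sign for odd \<open>m\<close>. Both the simplicity of the
  spectrum and the strict bound 2 come from this.\<close>

lemma inverse_omega_neq:
  assumes "odd m"
  shows "omega m s \<noteq> inverse (omega m t)"
proof
  assume *: "omega m s = inverse (omega m t)"
  have m: "m > 0" using assms by (cases m) auto
  have "inverse (- \<i>) = \<i>" by (simp add: field_simps)
  then have "(- \<i>) ^ m = \<i> ^ m"
    using arg_cong[OF *, of "\<lambda>z. z ^ m"] by (metis omega_power[OF m] power_inverse)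
  then have "2 * \<i> ^ m = 0"
    using ii_odd_power_add[OF assms] by simp
  then show False by simp
qed

lemma sum_inverse_eq_iff:
  fixes w z :: "'a :: field"
  assumes "w \<noteq> 0" "z \<noteq> 0"
  shows "w + inverse w = z + inverse z \<longleftrightarrow> w = z \<or> w = inverse z"
proof -
  have "(w + inverse w) - (z + inverse z) = (w - z) * (w - inverse z) * inverse w"
    using assms by (simp add: field_simps)
  then show ?thesis
    using assms by (metis eq_iff_diff_eq_0 inverse_nonzero_iff_nonzero mult_eq_0_iff)
qed

lemma lam_eq_iff:
  assumes "odd m" "s < m" "t < m"
  shows "lam m s = lam m t \<longleftrightarrow> s = t"
proof
  assume "lam m s = lam m t"
  then have "omega m s + inverse (omega m s) = omega m t + inverse (omega m t)"
    by (metis lam_omega)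
  then show "s = t"
    using inverse_omega_neq[OF assms(1)] omega_eq_iff[OF assms(2,3)]
    by (auto simp: sum_inverse_eq_iff)
qed simp

lemma lam_bound:
  assumes "odd m"
  shows "\<bar>lam m t\<bar> < 2"
proof -
  have m: "m > 0" using assms by (cases m) auto
  have "omega m t \<noteq> inverse (omega m t)"
    using inverse_omega_neq[OF assms] .
  then have "Im (omega m t) \<noteq> 0"
    by (auto simp: inverse_omega complex_eq_iff)
  then have "cos (2 * pi * real t / real m) \<noteq> 0"
    by (simp add: omega_def)
  then have "(sin (2 * pi * real t / real m))\<^sup>2 < 1"
    using sin_cos_squared_add[of "2 * pi * real t / real m"] by (smt (verit) zero_less_power2)
  then show ?thesis
    by (simp add: lam_def abs_mult abs_square_less_1)
qed

lemma monic_eq_of_roots: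
  fixes p q :: "'a :: field poly"
  assumes "degree p = m" "coeff p m = 1" "degree q = m" "coeff q m = 1"
    and "finite S" "card S = m" "\<And>x. x \<in> S \<Longrightarrow> poly p x = 0" "\<And>x. x \<in> S \<Longrightarrow> poly q x = 0"
  shows "p = q"
proof (rule ccontr)
  assume "p \<noteq> q"
  then have nz: "p - q \<noteq> 0" by simp
  have "m \<noteq> 0"
  proof
    assume "m = 0"
    then have "p = [:1:]" "q = [:1:]"
      using assms(1-4) degree_0_id[of p] degree_0_id[of q] by auto
    then show False using \<open>p \<noteq> q\<close> by simp
  qed
  have "degree (p - q) < m"
    using assms(1-4) \<open>m \<noteq> 0\<close> nz
    by (metis coeff_diff degree_diff_le diff_self leading_coeff_0_iff le_neq_implies_less order_refl)
  moreover have "card S \<le> card {x. poly (p - q) x = 0}"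
    using assms poly_roots_finite[OF nz] by (intro card_mono) auto
  ultimately show False
    using card_poly_roots_bound[OF nz] assms(6) by simp
qed

text \<open>The \<open>m\<close> values \<open>lam m t\<close> are distinct, so they exhaust the
  roots and no multiplicity has to be computed. This is what lets a mate be verified by eigenvectors
  written in terms of the eigenvalue.\<close>

lemma char_poly_dickson:
  assumes "odd m" "A \<in> carrier_mat m m" "\<And>t. t < m \<Longrightarrow> eigenvalue A (of_real (lam m t))"
  shows "char_poly A = dickson m"
proof (rule monic_eq_of_roots)
  let ?S = "(\<lambda>t. complex_of_real (lam m t)) ` {..<m}"
  show "finite ?S" by simp
  show "card ?S = m"
    using lam_eq_iff[OF assms(1)] by (subst card_image) (auto simp: inj_on_def)
  show "degree (char_poly A) = m" "coeff (char_poly A) m = 1"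
    using degree_monic_char_poly[OF assms(2)] by auto
  show "degree (dickson m) = m" "coeff (dickson m) m = 1"
    using degree_dickson[of "m - 1"] assms(1) by (cases m; auto)+
  show "poly (char_poly A) x = 0" if "x \<in> ?S" for x
    using that assms(3) eigenvalue_root_char_poly[OF assms(2)] by auto
  show "poly (dickson m) x = 0" if "x \<in> ?S" for x
    using that dickson_lam[OF assms(1)] by auto
qed

section \<open>Galois closure of spectra\<close>

lemma prime_dvd_power_add:
  fixes a b :: "'a :: comm_ring_1"
  assumes "prime p"
  shows "of_nat p dvd (a + b) ^ p - a ^ p - b ^ p"
proof -
  let ?f = "\<lambda>k. of_nat (p choose k) * a ^ k * b ^ (p - k)"
  have p: "p > 0" using assms by (simp add: prime_gt_0_nat)
  have "(a + b) ^ p = (\<Sum>k\<le>p. ?f k)" by (rule binomial_ring)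
  also have "{..p} = insert 0 (insert p {1..<p})" using p by auto
  also have "(\<Sum>k\<in>insert 0 (insert p {1..<p}). ?f k) = ?f 0 + (?f p + (\<Sum>k\<in>{1..<p}. ?f k))"
    using p by simp
  finally have "(a + b) ^ p - a ^ p - b ^ p = (\<Sum>k\<in>{1..<p}. ?f k)" by simp
  moreover have "of_nat p dvd ?f k" if k: "k \<in> {1..<p}" for k
  proof -
    have "p dvd (p choose k)"
      using k assms by (intro dvd_choose_prime) auto
    then have "(of_nat p :: 'a) dvd of_nat (p choose k)"
      by (elim dvdE) simp
    then show ?thesis by (simp add: mult.assoc dvd_mult2)
  qed
  ultimately show ?thesis
    by (metis (no_types, lifting) dvd_sum)
qed

lemma prime_dvd_power_sum:
  fixes f :: "'b \<Rightarrow> 'a :: comm_ring_1"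
  assumes "prime p"
  shows "of_nat p dvd (\<Sum>x\<in>A. f x) ^ p - (\<Sum>x\<in>A. f x ^ p)"
proof (induction A rule: infinite_finite_induct)
  case (insert x A)
  have "(\<Sum>y\<in>insert x A. f y) ^ p - (\<Sum>y\<in>insert x A. f y ^ p)
      = ((f x + (\<Sum>y\<in>A. f y)) ^ p - f x ^ p - (\<Sum>y\<in>A. f y) ^ p)
        + ((\<Sum>y\<in>A. f y) ^ p - (\<Sum>y\<in>A. f y ^ p))"
    using insert by (simp add: algebra_simps)
  then show ?case
    using prime_dvd_power_add[OF assms] insert.IH by (metis dvd_add)
qed (use assms in \<open>auto simp: power_0_left\<close>)

lemma fermat_int:
  fixes a :: int
  assumes "prime p"
  shows "int p dvd a ^ p - a"
proof -
  have p: "int p > 0" using assms by (simp add: prime_gt_0_nat)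
  define n where "n = nat (a mod int p)"
  have n: "int n = a mod int p" using p by (simp add: n_def)
  \<comment> \<open>For a natural number this is the Frobenius congruence for a sum of
    \<open>n\<close> ones.\<close>
  have "int p dvd int n ^ p - int n"
    using prime_dvd_power_sum[OF assms, of "\<lambda>_. 1 :: int" "{..<n}"] by simp
  then have "(int n ^ p) mod int p = int n mod int p"
    by (simp add: mod_eq_dvd_iff)
  then have "a ^ p mod int p = a mod int p"
    by (simp add: n power_mod)
  then show ?thesis by (simp add: mod_eq_dvd_iff)
qed

text \<open>Multiplication by an element of \<open>\<int>[w]\<close>, where \<open>w\<close> is a root of unity, is an integer matrix.\<close>

lemma algebraic_int_poly_root_unity:
  fixes w :: complex and P :: "int poly"
  assumes "n > 0" "w ^ n = 1"
  shows "algebraic_int (poly (map_poly of_int P) w)"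
proof -
  define R where "R = poly (map_poly of_int P) w"
  define A :: "int mat" where
    "A = mat n n (\<lambda>(k, l). \<Sum>i\<le>degree P. if (i + k) mod n = l then coeff P i else 0)"
  define B :: "complex mat" where "B = map_mat of_int A"
  define v where "v = vec n (\<lambda>l. w ^ l)"
  have carr: "A \<in> carrier_mat n n" "B \<in> carrier_mat n n" "v \<in> carrier_vec n"
    by (auto simp: A_def B_def v_def)
  have wmod: "w ^ (j mod n) = w ^ j" for j
  proof -
    have "w ^ j = w ^ (n * (j div n) + j mod n)" by simp
    also have "\<dots> = w ^ (j mod n)" by (simp only: power_add power_mult assms power_one mult_1_left)
    finally show ?thesis ..
  qed
  have R: "R = (\<Sum>i\<le>degree P. of_int (coeff P i) * w ^ i)"
    by (simp add: R_def poly_altdef coeff_map_poly degree_map_poly)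
  have "B *\<^sub>v v = R \<cdot>\<^sub>v v"
  proof (rule eq_vecI)
    fix k assume "k < dim_vec (R \<cdot>\<^sub>v v)"
    then have k: "k < n" by (simp add: v_def)
    have "(B *\<^sub>v v) $ k = (\<Sum>l<n. (\<Sum>i\<le>degree P. (if (i + k) mod n = l then of_int (coeff P i) else 0)) * w ^ l)"
      using k by (simp add: B_def A_def v_def scalar_prod_def lessThan_atLeast0 of_int_sum if_distrib cong: if_cong)
    also have "\<dots> = (\<Sum>i\<le>degree P. \<Sum>l<n. (if (i + k) mod n = l then of_int (coeff P i) else 0) * w ^ l)"
      by (simp add: sum_distrib_right) (rule sum.swap)
    also have "\<dots> = (\<Sum>i\<le>degree P. of_int (coeff P i) * w ^ ((i + k) mod n))"
    proof (rule sum.cong[OF refl])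
      fix i
      have "(\<Sum>l<n. (if (i + k) mod n = l then of_int (coeff P i) else 0) * w ^ l)
          = (\<Sum>l<n. if l = (i + k) mod n then of_int (coeff P i) * w ^ l else 0)"
        by (intro sum.cong) auto
      then show "(\<Sum>l<n. (if (i + k) mod n = l then of_int (coeff P i) else 0) * w ^ l)
          = of_int (coeff P i) * w ^ ((i + k) mod n)"
        using assms(1) by simp
    qed
    also have "\<dots> = R * w ^ k"
      by (simp add: wmod R power_add sum_distrib_right mult.assoc)
    finally show "(B *\<^sub>v v) $ k = (R \<cdot>\<^sub>v v) $ k" using k by (simp add: v_def)
  qed (simp add: B_def A_def v_def)
  moreover have "v \<noteq> 0\<^sub>v n"
    using assms(1) by (metis index_vec index_zero_vec(1) one_neq_zero power_0 v_def)
  ultimately have "eigenvalue B R"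
    using carr by (auto simp: eigenvalue_def eigenvector_def)
  then have "poly (char_poly B) R = 0"
    using eigenvalue_root_char_poly[OF carr(2)] by simp
  moreover have "char_poly B = map_poly of_int (char_poly A)"
    unfolding B_def by (rule of_int_hom.char_poly_hom[OF carr(1)])
  moreover have "lead_coeff (char_poly B) = 1"
    using degree_monic_char_poly[OF carr(2)] by simp
  ultimately show ?thesis
    unfolding R_def[symmetric] algebraic_int.simps
    by (intro exI[of _ "char_poly B"]) (auto simp: coeff_map_poly)
qed

text \<open>The \<open>p\<close>-th power of the first sum is the second sum modulo
  \<open>p\<close>. The quotient is an algebraic integer and rational, hence an integer, and Fermat
  replaces \<open>a^p\<close> by \<open>a\<close>.\<close>

lemma power_sum_prime_cong:
  fixes A :: "complex set"
  assumes "finite A" "N > 0" "\<And>x. x \<in> A \<Longrightarrow> x ^ N = 1" "prime p"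
    and "(\<Sum>x\<in>A. x ^ j) = of_int a" "(\<Sum>x\<in>A. x ^ (j * p)) = of_int b"
  shows "int p dvd b - a"
proof -
  define w where "w = cis (2 * pi / real N)"
  have wN: "w ^ N = 1"
    using cis_power_period[OF assms(2), of 1] by (simp add: w_def)
  have "\<exists>e. x = w ^ e" if x: "x \<in> A" for x
  proof -
    have "x \<in> {z. z ^ N = 1}" using assms(3) x by simp
    then have "x \<in> (\<lambda>k. cis (2 * pi * real k / real N)) ` {..<N}"
      using bij_betw_roots_unity[OF assms(2)] by (simp add: bij_betw_def)
    then obtain e where "x = cis (2 * pi * real e / real N)" by auto
    then have "x = w ^ e" by (simp add: w_def Complex.DeMoivre mult_ac)
    then show ?thesis ..
  qed
  then obtain e where e: "\<And>x. x \<in> A \<Longrightarrow> x = w ^ e x" by metis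
  \<comment> \<open>Lifting the roots of unity to monomials keeps the Frobenius quotient in
    \<open>Z[x]\<close>, so that its value at \<open>w\<close> is an algebraic integer.\<close>
  let ?f = "\<lambda>x. monom (1::int) (e x * j)"
  obtain Q where Q: "(\<Sum>x\<in>A. ?f x) ^ p - (\<Sum>x\<in>A. ?f x ^ p) = of_nat p * Q"
    using prime_dvd_power_sum[OF assms(4)] by (metis dvdE)
  define R where "R = poly (map_poly of_int Q) w"
  interpret h: comm_ring_hom "\<lambda>q. poly (map_poly (of_int :: int \<Rightarrow> complex) q) w"
    by unfold_locales (auto simp: of_int_poly_hom.hom_add of_int_poly_hom.hom_mult)
  have fx: "poly (monom 1 (e x * j)) w = x ^ j" if "x \<in> A" for x
  proof -
    have "poly (monom 1 (e x * j)) w = (w ^ e x) ^ j"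
      by (simp add: poly_monom power_mult)
    also have "w ^ e x = x" using e[OF that] by (rule sym)
    finally show ?thesis .
  qed
  have "(\<Sum>x\<in>A. x ^ j) ^ p - (\<Sum>x\<in>A. x ^ (j * p)) = of_nat p * R"
    using arg_cong[OF Q, of "\<lambda>q. poly (map_poly of_int q) w"]
    by (simp add: h.hom_minus h.hom_mult h.hom_sum h.hom_power h.hom_of_nat fx R_def power_mult del: of_nat_poly)
  then have eq: "of_int (a ^ p - b) = of_nat p * R"
    using assms(5,6) by simp
  have p: "p > 0" using assms(4) by (simp add: prime_gt_0_nat)
  have "R = of_int (a ^ p - b) / of_nat p"
    using eq p by (simp add: field_simps)
  then have "R \<in> \<rat>" by simp
  moreover have "algebraic_int R"
    unfolding R_def by (rule algebraic_int_poly_root_unity[OF assms(2) wN])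
  ultimately obtain r where "R = of_int r"
    using rational_algebraic_int_is_int by (auto simp: Ints_def)
  with eq have "(of_int (a ^ p - b) :: complex) = of_int (int p * r)" by simp
  then have "a ^ p - b = int p * r" by (rule of_int_eq_iff[THEN iffD1])
  then have "int p dvd a ^ p - b" by simp
  with fermat_int[OF assms(4), of a] have "int p dvd (a ^ p - a) - (a ^ p - b)"
    by (rule dvd_diff)
  then show ?thesis by simp
qed

text \<open>Equal power sums give equal sums of every polynomial, and the polynomial vanishing on
  all points but one detects whether that point belongs to both sets.\<close>

lemma power_sums_eq_imp_eq:
  fixes A B :: "'a :: field set"
  assumes "finite A" "finite B" "\<And>j. (\<Sum>x\<in>A. x ^ j) = (\<Sum>x\<in>B. x ^ j)"
  shows "A = B"
proof -
  have P: "(\<Sum>x\<in>A. poly q x) = (\<Sum>x\<in>B. poly q x)" for q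
  proof -
    have "(\<Sum>x\<in>C. poly q x) = (\<Sum>i\<le>degree q. coeff q i * (\<Sum>x\<in>C. x ^ i))" for C
      unfolding poly_altdef sum_distrib_left by (rule sum.swap)
    then show ?thesis using assms(3) by simp
  qed
  have sub: "C \<subseteq> D" if fin: "finite C" "finite D"
    and eq: "\<And>q. (\<Sum>x\<in>C. poly q x) = (\<Sum>x\<in>D. poly q x)" for C D :: "'a set"
  proof
    fix x assume x: "x \<in> C"
    show "x \<in> D"
    proof (rule ccontr)
      assume "x \<notin> D"
      define q where "q = (\<Prod>y\<in>C \<union> D - {x}. [:- y, 1:])"
      have q: "poly q y = 0 \<longleftrightarrow> y \<in> C \<union> D - {x}" for y
        using fin by (auto simp: q_def poly_prod)
      have "(\<Sum>y\<in>D. poly q y) = 0"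
        using q \<open>x \<notin> D\<close> by (intro sum.neutral) auto
      moreover have "(\<Sum>y\<in>C. poly q y) = poly q x + (\<Sum>y\<in>C - {x}. poly q y)"
        using fin x by (simp add: sum.remove)
      moreover have "(\<Sum>y\<in>C - {x}. poly q y) = 0"
        using q by (intro sum.neutral) auto
      ultimately have "poly q x = 0" using eq[of q] by simp
      then show False using q by auto
    qed
  qed
  show ?thesis using sub[of A B] sub[of B A] assms(1,2) P by auto
qed

text \<open>A multiplier with only large prime factors serves as well as a large prime, and its
  existence does not require Dirichlet's theorem: with \<open>t\<close> the product of the small
  primes not dividing \<open>b\<close>, each small prime divides exactly one of \<open>b\<close> and
  \<open>d * t\<close>.\<close>

lemma exists_cong_large_prime_factors:
  fixes b d L :: nat
  assumes "coprime b d" "d > 0"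
  shows "\<exists>a. [a = b] (mod d) \<and> a > 0 \<and> (\<forall>q. prime q \<and> q dvd a \<longrightarrow> q > L)"
proof -
  define P where "P = {q. prime q \<and> q \<le> L \<and> \<not> q dvd b}"
  have fin: "finite P" unfolding P_def by (rule finite_subset[of _ "{..L}"]) auto
  define t where "t = \<Prod>P"
  have t: "t > 0" using fin by (auto simp: t_def P_def prime_gt_0_nat intro!: prod_pos)
  have "q > L" if q: "prime q" "q dvd b + d * t" for q
  proof (rule ccontr)
    assume "\<not> q > L"
    show False
    proof (cases "q dvd b")
      case False
      then have "q \<in> P" using q \<open>\<not> q > L\<close> by (auto simp: P_def)
      then have "q dvd t" using fin by (auto simp: t_def)
      then show False using q False by (metis dvd_add_left_iff dvd_mult)
    next
      case True
      then have "q dvd d * t" using q by (metis dvd_add_right_iff)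
      moreover have "\<not> q dvd d"
        using True q assms(1) by (meson coprime_common_divisor_nat not_prime_unit coprime_common_divisor)
      ultimately have "q dvd t" using q prime_dvd_mult_iff by blast
      then obtain r where "r \<in> P" "q dvd r"
        using q fin by (auto simp: t_def prime_dvd_prod_iff)
      then show False using q True by (auto simp: P_def dest: primes_dvd_imp_eq)
    qed
  qed
  then show ?thesis
    using t assms by (intro exI[of _ "b + d * t"]) (auto simp: cong_def)
qed

text \<open>Prime factors of \<open>a\<close> are removed one at a time. The two sums compared in a
  step are integers of absolute value at most \<open>card A\<close> that agree modulo a prime above
  \<open>2 * card A\<close>.\<close>

lemma power_sum_invariant:
  fixes A :: "complex set"
  assumes "finite A" "N > 0" "\<And>x. x \<in> A \<Longrightarrow> x ^ N = 1" "\<And>j. (\<Sum>x\<in>A. x ^ j) \<in> \<int>"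
    and "a > 0" "\<And>q. prime q \<Longrightarrow> q dvd a \<Longrightarrow> q > 2 * card A"
  shows "(\<Sum>x\<in>A. x ^ (j * a)) = (\<Sum>x\<in>A. x ^ j)"
  using assms(5,6)
proof (induction a arbitrary: j rule: less_induct)
  case (less a)
  show ?case
  proof (cases "a = 1")
    case False
    then obtain p where p: "prime p" "p dvd a" using prime_factor_nat by blast
    then obtain c where c: "a = p * c" by auto
    have c0: "c > 0" "c < a"
      using less.prems(1) c prime_gt_1_nat[OF p(1)] by auto
    have IH: "(\<Sum>x\<in>A. x ^ ((j * p) * c)) = (\<Sum>x\<in>A. x ^ (j * p))"
      using c0 less.prems(2) c by (intro less.IH) auto
    obtain u v where u: "(\<Sum>x\<in>A. x ^ j) = of_int u" and v: "(\<Sum>x\<in>A. x ^ (j * p)) = of_int v"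
      using assms(4) by (metis Ints_cases)
    have bound: "norm (\<Sum>x\<in>A. x ^ i) \<le> real (card A)" for i
    proof -
      have "norm (x ^ i) = 1" if "x \<in> A" for x
      proof -
        have "norm x ^ N = 1" using assms(3)[OF that] by (metis norm_one norm_power)
        then have "norm x = 1" using assms(2) power_eq_imp_eq_base[of "norm x" N 1] by simp
        then show ?thesis by (simp add: norm_power)
      qed
      then show ?thesis using norm_sum[of "\<lambda>x. x ^ i" A] by simp
    qed
    have "\<bar>u\<bar> \<le> int (card A)" "\<bar>v\<bar> \<le> int (card A)"
      using bound[of j] bound[of "j * p"] unfolding u v by (simp_all add: norm_of_int flip: of_int_abs)
    then have "\<bar>v - u\<bar> < int p"
      using less.prems(2)[OF p] by linarith
    moreover have "int p dvd v - u"
      by (rule power_sum_prime_cong[OF assms(1-3) p(1) u v])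
    ultimately have "v - u = 0" using zdvd_not_zless[of "\<bar>v - u\<bar>" "int p"] by fastforce
    then show ?thesis using IH u v by (simp add: c mult.assoc)
  qed simp
qed

text \<open>Only the order of the root of unity matters: \<open>d\<close> annihilates
  \<open>t\<close> modulo \<open>m\<close>, so \<open>b\<close> need only be coprime to
  \<open>d\<close>, and all indices of the same order are reached. The inverses join the set
  \<open>A\<close> because only the symmetric sums are known to be integers.\<close>

lemma galois_closed:
  assumes "odd m" "T \<subseteq> {..<m}"
    and int: "\<And>j. (\<Sum>t\<in>T. omega m t ^ j + inverse (omega m t) ^ j) \<in> \<int>"
    and t: "t \<in> T" "m dvd d * t" "coprime b d" "odd d"
  shows "t * b mod m \<in> T"
proof -
  have m: "m > 0" using assms(1) by (cases m) auto
  have d: "d > 0" using t(4) by (cases d) auto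
  have finT: "finite T" using assms(2) finite_subset by blast
  define A1 A2 where "A1 = omega m ` T" and "A2 = (\<lambda>t. inverse (omega m t)) ` T"
  define A where "A = A1 \<union> A2"
  have finA: "finite A" using finT by (simp add: A_def A1_def A2_def)
  have disj: "A1 \<inter> A2 = {}"
    using inverse_omega_neq[OF assms(1)] by (auto simp: A1_def A2_def)
  have inj1: "inj_on (omega m) T" "inj_on (\<lambda>t. inverse (omega m t)) T"
    using omega_eq_iff assms(2) by (auto simp: inj_on_def subset_iff)
  have sumA: "(\<Sum>x\<in>A. x ^ j) = (\<Sum>t\<in>T. omega m t ^ j + inverse (omega m t) ^ j)" for j
    unfolding A_def using finT disj inj1
    by (subst sum.union_disjoint) (auto simp: A1_def A2_def sum.reindex sum.distrib)
  have "card A \<le> card A1 + card A2" unfolding A_def by (rule card_Un_le)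
  also have "\<dots> = 2 * card T" using inj1 by (simp add: A1_def A2_def card_image)
  also have "\<dots> \<le> 2 * m" using card_mono[OF _ assms(2)] by simp
  finally have cardA: "card A \<le> 2 * m" .
  have om4: "omega m s ^ (4 * m) = 1" for s
  proof -
    have "omega m s ^ (4 * m) = ((- \<i>) ^ m) ^ 4"
      by (metis omega_power[OF m] mult.commute power_mult)
    also have "\<dots> = ((- \<i>) ^ 4) ^ m" by (simp only: power_mult[symmetric] mult.commute)
    also have "\<dots> = 1" by simp
    finally show ?thesis .
  qed
  have rootA: "x ^ (4 * m) = 1" if "x \<in> A" for x
    using that om4 by (auto simp: A_def A1_def A2_def power_inverse)
  \<comment> \<open>As \<open>d * d\<close> is 1 modulo 4, this is \<open>4 b + 1\<close> modulo 4,
    and it is \<open>b\<close> modulo \<open>d\<close>. The residue 1 modulo 4 is there to fix the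
    factor \<open>- \<i>\<close> of \<open>omega\<close>.\<close>
  define b' where "b' = b + d * d * (3 * b + 1)"
  have b'4: "[b' = 1] (mod 4)"
  proof -
    obtain k where k: "d = 2 * k + 1" using t(4) by (elim oddE)
    have "b' = 1 + 4 * (b + (k * k + k) * (3 * b + 1))"
      by (simp add: b'_def k algebra_simps)
    then show ?thesis by (simp only: cong_def mod_mult_self2)
  qed
  have b'd: "[b' = b] (mod d)"
    unfolding b'_def cong_def mult.assoc by (rule mod_mult_self2)
  then have "coprime b' d"
    using t(3) by (metis cong_imp_coprime cong_sym)
  moreover have "coprime b' 4"
    using b'4 by (metis cong_imp_coprime cong_sym coprime_1_left)
  ultimately have "coprime b' (4 * d)" by simp
  then obtain a where a: "[a = b'] (mod (4 * d))" "a > 0" "\<And>q. prime q \<Longrightarrow> q dvd a \<Longrightarrow> q > 4 * m"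
    using exists_cong_large_prime_factors[of b' "4 * d" "4 * m"] d by auto
  have a4: "[a = 1] (mod 4)"
    using a(1) b'4 cong_dvd_modulus_nat cong_trans by (meson dvd_triv_left)
  have ad: "[a = b] (mod d)"
  proof -
    have "[a = b'] (mod d)" using a(1) cong_dvd_modulus_nat by (meson dvd_triv_right)
    then show ?thesis using b'd by (rule cong_trans)
  qed
  have "coprime a (4 * m)"
  proof (rule ccontr)
    assume "\<not> coprime a (4 * m)"
    then have "gcd a (4 * m) \<noteq> 1" by (simp add: coprime_iff_gcd_eq_1)
    then obtain q where "prime q" "q dvd gcd a (4 * m)" using prime_factor_nat by blast
    then have q: "prime q" "q dvd a" "q dvd 4 * m" by auto
    then have "q \<le> 4 * m" using m by (auto dest: dvd_imp_le)
    then show False using a(3)[OF q(1,2)] by simp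
  qed
  then obtain u where u: "[a * u = 1] (mod (4 * m))"
    using coprime_iff_invertible_nat by auto
  have pw: "x ^ (a * u) = x" if "x \<in> A" for x
  proof -
    have "x ^ (4 * m * k + r) = x ^ r" for k r using rootA[OF that] by (simp add: power_add power_mult)
    then have red: "x ^ k = x ^ (k mod (4 * m))" for k by (metis mult_div_mod_eq)
    have "x ^ (a * u) = x ^ (1 mod (4 * m))" using u by (subst red) (simp add: cong_def)
    also have "\<dots> = x" using m by simp
    finally show ?thesis .
  qed
  have injA: "inj_on (\<lambda>x. x ^ a) A"
    by (rule inj_onI) (metis pw power_mult)
  have "(\<lambda>x. x ^ a) ` A = A"
  proof (rule power_sums_eq_imp_eq)
    fix j
    have "(\<Sum>x\<in>(\<lambda>x. x ^ a) ` A. x ^ j) = (\<Sum>x\<in>A. x ^ (j * a))"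
      by (subst sum.reindex[OF injA]) (simp add: mult.commute flip: power_mult)
    also have "\<dots> = (\<Sum>x\<in>A. x ^ j)"
    proof (rule power_sum_invariant[OF finA _ rootA _ a(2)])
      show "4 * m > 0" using m by simp
      show "(\<Sum>x\<in>A. x ^ j) \<in> \<int>" for j using int by (simp add: sumA)
      show "q > 2 * card A" if "prime q" "q dvd a" for q
        using a(3)[OF that] cardA by linarith
    qed
    finally show "(\<Sum>x\<in>(\<lambda>x. x ^ a) ` A. x ^ j) = (\<Sum>x\<in>A. x ^ j)" .
  qed (use finA in auto)
  moreover have "omega m t \<in> A" using t(1) by (auto simp: A_def A1_def)
  ultimately have "omega m t ^ a \<in> A" by blast
  moreover have "omega m t ^ a = omega m (t * b mod m)"
  proof -
    let ?z = "cis (2 * pi * real t / real m)"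
    have zs: "?z ^ k = cis (2 * pi * real (t * k mod m) / real m)" for k
    proof -
      have "?z ^ k = cis (2 * pi * real (t * k) / real m)"
        by (simp add: Complex.DeMoivre mult_ac)
      also have "\<dots> = cis (2 * pi * real (t * k mod m) / real m + 2 * pi * real (t * k div m))"
      proof (rule arg_cong[of _ _ cis])
        have "real (t * k) = real (t * k mod m) + real m * real (t * k div m)"
          by (metis mod_mult_div_eq of_nat_add of_nat_mult)
        then show "2 * pi * real (t * k) / real m = 2 * pi * real (t * k mod m) / real m + 2 * pi * real (t * k div m)"
          using m by (simp add: field_simps)
      qed
      also have "\<dots> = cis (2 * pi * real (t * k mod m) / real m)"
        using cis_multiple_2pi[of "real (t * k div m)"] by (simp flip: cis_mult)
      finally show ?thesis .
    qed
    have zd: "?z ^ d = 1"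
    proof -
      have "t * d mod m = 0" using t(2) by (simp add: mult.commute)
      then show ?thesis unfolding zs by simp
    qed
    have "?z ^ (d * k + r) = ?z ^ r" for k r by (simp only: power_add power_mult zd power_one mult_1_left)
    then have "?z ^ k = ?z ^ (k mod d)" for k by (metis mult_div_mod_eq)
    then have "?z ^ a = ?z ^ b" using ad by (metis cong_def)
    moreover have "(- \<i>) ^ a = - \<i>"
    proof -
      have "(- \<i>) ^ (4 * k + r) = (- \<i>) ^ r" for k r by (simp add: power_add power_mult)
      then have "(- \<i>) ^ a = (- \<i>) ^ (a mod 4)" by (metis mult_div_mod_eq)
      also have "a mod 4 = 1" using a4 by (simp add: cong_def)
      finally show ?thesis by simp
    qed
    ultimately show ?thesis
      by (simp add: omega_def power_mult_distrib zs del: mult_minus_left)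
  qed
  \<comment> \<open>The other half of \<open>A\<close> consists of inverses, and for odd
    \<open>m\<close> no \<open>omega\<close> is among them.\<close>
  ultimately have "omega m (t * b mod m) \<in> A1"
    using inverse_omega_neq[OF assms(1)] by (auto simp: A_def A2_def)
  then obtain s where "s \<in> T" "omega m (t * b mod m) = omega m s" by (auto simp: A1_def)
  then show ?thesis using omega_eq_iff[of "t * b mod m" m s] m assms(2) by auto
qed

section \<open>Spectral theory of gain graphs\<close>

definition gauss_ints :: "complex set" where
  "gauss_ints = {z. Re z \<in> \<int> \<and> Im z \<in> \<int>}"

lemma gauss_ints_0 [simp]: "0 \<in> gauss_ints"
  and gauss_ints_1 [simp]: "1 \<in> gauss_ints"
  and gauss_ints_i [simp]: "\<i> \<in> gauss_ints"
  and gauss_ints_of_int [simp]: "of_int k \<in> gauss_ints"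
  and gauss_ints_numeral [simp]: "numeral n \<in> gauss_ints"
  by (simp_all add: gauss_ints_def)

lemma gauss_ints_add [intro]: "a \<in> gauss_ints \<Longrightarrow> b \<in> gauss_ints \<Longrightarrow> a + b \<in> gauss_ints"
  and gauss_ints_diff [intro]: "a \<in> gauss_ints \<Longrightarrow> b \<in> gauss_ints \<Longrightarrow> a - b \<in> gauss_ints"
  and gauss_ints_mult [intro]: "a \<in> gauss_ints \<Longrightarrow> b \<in> gauss_ints \<Longrightarrow> a * b \<in> gauss_ints"
  and gauss_ints_minus [intro]: "a \<in> gauss_ints \<Longrightarrow> - a \<in> gauss_ints"
  and gauss_ints_cnj [intro]: "a \<in> gauss_ints \<Longrightarrow> cnj a \<in> gauss_ints"
  by (auto simp: gauss_ints_def)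

lemma gauss_ints_sum [intro]: "(\<And>x. x \<in> A \<Longrightarrow> f x \<in> gauss_ints) \<Longrightarrow> sum f A \<in> gauss_ints"
  by (induction A rule: infinite_finite_induct) auto

lemma gauss_ints_prod [intro]: "(\<And>x. x \<in> A \<Longrightarrow> f x \<in> gauss_ints) \<Longrightarrow> prod f A \<in> gauss_ints"
  by (induction A rule: infinite_finite_induct) auto

lemma gauss_ints_real:
  assumes "z \<in> gauss_ints" "Im z = 0"
  shows "z \<in> \<int>"
proof -
  obtain k where "Re z = of_int k" using assms by (auto simp: gauss_ints_def elim: Ints_cases)
  then have "z = of_int k" using assms by (simp add: complex_eq_iff)
  then show ?thesis by simp
qed

definition unit4 :: "complex set" where
  "unit4 = {1, - 1, \<i>, - \<i>}"

lemma unit4_gauss_ints: "z \<in> unit4 \<Longrightarrow> z \<in> gauss_ints"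
  by (auto simp: unit4_def)

lemma unit4_mult: "z \<in> unit4 \<Longrightarrow> w \<in> unit4 \<Longrightarrow> z * w \<in> unit4"
  by (auto simp: unit4_def)

lemma unit4_cnj: "z \<in> unit4 \<Longrightarrow> cnj z \<in> unit4"
  by (auto simp: unit4_def)

lemma unit4_nonzero: "z \<in> unit4 \<Longrightarrow> z \<noteq> 0"
  by (auto simp: unit4_def)

lemma unit4_norm: "z \<in> unit4 \<Longrightarrow> norm z = 1"
  by (auto simp: unit4_def)

lemma unit4_cnj_mult: "z \<in> unit4 \<Longrightarrow> cnj z * z = 1" "z \<in> unit4 \<Longrightarrow> z * cnj z = 1"
  by (auto simp: unit4_def)

lemma cnj_mult_norm: "cnj z * z = (of_real (norm z))\<^sup>2" "z * cnj z = (of_real (norm z))\<^sup>2"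
  by (simp_all add: complex_norm_square mult.commute flip: of_real_power)

text \<open>A mixed graph seen through its Hermitian entries alone. These vanish off
  \<open>V\<close>, so a sum over \<open>V\<close> can be exchanged for one over a
  neighbourhood.\<close>

locale gain_graph =
  fixes V :: "nat set" and h :: "nat \<Rightarrow> nat \<Rightarrow> complex"
  assumes finV: "finite V"
    and h_values: "h x y \<in> insert 0 unit4"
    and h_sym: "cnj (h x y) = h y x"
    and h_irrefl: "h x x = 0"
    and h_V: "h x y \<noteq> 0 \<Longrightarrow> x \<in> V"
begin

definition H :: "(nat \<Rightarrow> complex) \<Rightarrow> nat \<Rightarrow> complex" where
  "H f x = (\<Sum>y\<in>V. h x y * f y)"

definition ip :: "(nat \<Rightarrow> complex) \<Rightarrow> (nat \<Rightarrow> complex) \<Rightarrow> complex" where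
  "ip f g = (\<Sum>x\<in>V. cnj (f x) * g x)"

definition H2 :: "nat \<Rightarrow> nat \<Rightarrow> complex" where
  "H2 x y = (\<Sum>z\<in>V. h x z * h z y)"

definition nbrs :: "nat \<Rightarrow> nat set" where
  "nbrs x = {y. h x y \<noteq> 0}"

definition deg :: "nat \<Rightarrow> nat" where
  "deg x = card (nbrs x)"

text \<open>These are the unions of connected components.\<close>

definition adj_closed :: "nat set \<Rightarrow> bool" where
  "adj_closed R \<longleftrightarrow> R \<subseteq> V \<and> (\<forall>x\<in>R. nbrs x \<subseteq> R)"

lemma h_gauss_ints: "h x y \<in> gauss_ints"
  using h_values[of x y] unit4_gauss_ints by auto

lemma h_unit: "h x y \<noteq> 0 \<Longrightarrow> h x y \<in> unit4"
  using h_values[of x y] by auto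

lemma h_zero_sym: "h x y = 0 \<longleftrightarrow> h y x = 0"
  by (metis complex_cnj_zero_iff h_sym)

lemma h_V': "h x y \<noteq> 0 \<Longrightarrow> y \<in> V"
  using h_V h_zero_sym by blast

lemma nbrs_sub: "nbrs x \<subseteq> V"
  using h_V' by (auto simp: nbrs_def)

lemma fin_nbrs: "finite (nbrs x)"
  using nbrs_sub finV finite_subset by blast

lemma nbrs_sym: "y \<in> nbrs x \<longleftrightarrow> x \<in> nbrs y"
  using h_zero_sym by (auto simp: nbrs_def)

lemma nbrs_irrefl: "x \<notin> nbrs x"
  by (simp add: nbrs_def h_irrefl)

lemma h_cnj_mult: "y \<in> nbrs x \<Longrightarrow> h x y * h y x = 1"
  using unit4_cnj_mult[OF h_unit[of x y]] by (simp add: nbrs_def h_sym)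

lemma h_times: "h x y * h y x = of_bool (y \<in> nbrs x)"
  using h_cnj_mult[of y x] by (auto simp: nbrs_def)

lemma sum_h: "(\<Sum>y\<in>V. h x y * f y) = (\<Sum>y\<in>nbrs x. h x y * f y)"
  by (rule sum.mono_neutral_right) (use finV nbrs_sub in \<open>auto simp: nbrs_def\<close>)

lemma H_nbrs: "H f x = (\<Sum>y\<in>nbrs x. h x y * f y)"
  by (simp add: H_def sum_h)

lemma H2_nbrs: "H2 x y = (\<Sum>z\<in>nbrs x. h x z * h z y)"
  by (simp add: H2_def sum_h)

lemma H2_common: "H2 x y = (\<Sum>z\<in>nbrs x \<inter> nbrs y. h x z * h z y)"
  unfolding H2_nbrs
proof (rule sum.mono_neutral_right)
  show "\<forall>z\<in>nbrs x - nbrs x \<inter> nbrs y. h x z * h z y = 0"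
    using h_zero_sym by (auto simp: nbrs_def)
qed (use fin_nbrs in auto)

lemma H2_sym: "cnj (H2 x y) = H2 y x"
  by (simp add: H2_def h_sym mult.commute)

lemma H2_self: "H2 x x = of_nat (deg x)"
  by (simp add: H2_nbrs h_times deg_def)

lemma H2_gauss_ints: "H2 x y \<in> gauss_ints"
  unfolding H2_def by (intro gauss_ints_sum gauss_ints_mult h_gauss_ints)

lemma nbrs_empty_outside: "x \<notin> V \<Longrightarrow> nbrs x = {}"
  using h_V by (auto simp: nbrs_def)

lemma H_adjoint: "ip f (H g) = ip (H f) g"
proof -
  have "ip f (H g) = (\<Sum>x\<in>V. \<Sum>y\<in>V. cnj (f x) * h x y * g y)"
    by (simp add: ip_def H_def sum_distrib_left mult_ac)
  also have "\<dots> = (\<Sum>y\<in>V. \<Sum>x\<in>V. cnj (f x) * h x y * g y)"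
    by (rule sum.swap)
  also have "\<dots> = ip (H f) g"
    by (simp add: ip_def H_def h_sym sum_distrib_left sum_distrib_right mult_ac)
  finally show ?thesis .
qed

end

text \<open>The last two assumptions express what is needed of \<open>det (2 I - H) = 2\<close>
  without a determinant. The first is invertibility modulo 3. In the second, a unit coordinate of
  \<open>v\<close> would make 4 divide the determinant: \<open>v\<close> is in the kernel modulo 2,
  and the evenness of \<open>ip v w\<close> supplies the second factor 2.\<close>

locale spectral_graph = gain_graph +
  fixes m :: nat and phi :: "nat \<Rightarrow> nat \<Rightarrow> complex"
  assumes odd_m: "odd m"
    and card_V: "card V = m"
    and eig: "t < m \<Longrightarrow> x \<in> V \<Longrightarrow> H (phi t) x = of_real (lam m t) * phi t x"
    and orth: "s < m \<Longrightarrow> t < m \<Longrightarrow> ip (phi s) (phi t) = of_bool (s = t)"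
    and compl: "x \<in> V \<Longrightarrow> y \<in> V \<Longrightarrow> (\<Sum>t<m. phi t x * cnj (phi t y)) = of_bool (x = y)"
    and no_det3: "(\<And>x. v x \<in> gauss_ints) \<Longrightarrow> (\<And>x. w x \<in> gauss_ints) \<Longrightarrow>
        (\<And>x. x \<in> V \<Longrightarrow> 2 * v x - H v x = 3 * w x) \<Longrightarrow> x \<in> V \<Longrightarrow> v x / 3 \<in> gauss_ints"
    and no_det4: "(\<And>x. v x \<in> gauss_ints) \<Longrightarrow> (\<And>x. w x \<in> gauss_ints) \<Longrightarrow>
        (\<And>x. x \<in> V \<Longrightarrow> 2 * v x - H v x = 2 * w x) \<Longrightarrow> ip v w / 2 \<in> gauss_ints \<Longrightarrow>
        x \<in> V \<Longrightarrow> v x \<notin> unit4"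
begin

lemma m_pos: "m > 0"
  using odd_m by (cases m) auto

definition coef :: "nat \<Rightarrow> (nat \<Rightarrow> complex) \<Rightarrow> complex" where
  "coef t f = ip (phi t) f"

lemma expand:
  assumes "x \<in> V"
  shows "f x = (\<Sum>t<m. coef t f * phi t x)"
proof -
  have "(\<Sum>t<m. coef t f * phi t x) = (\<Sum>t<m. \<Sum>y\<in>V. f y * (phi t x * cnj (phi t y)))"
    by (simp add: coef_def ip_def sum_distrib_left sum_distrib_right mult_ac)
  also have "\<dots> = (\<Sum>y\<in>V. f y * (\<Sum>t<m. phi t x * cnj (phi t y)))"
    by (subst sum.swap) (simp add: sum_distrib_left)
  also have "\<dots> = (\<Sum>y\<in>V. if y = x then f y else 0)"
    using assms by (intro sum.cong refl) (auto simp: compl)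
  also have "\<dots> = f x"
    using assms finV by simp
  finally show ?thesis by simp
qed

lemma ip_coef: "ip f g = (\<Sum>t<m. cnj (coef t f) * coef t g)"
proof -
  have "ip f g = (\<Sum>x\<in>V. cnj (f x) * (\<Sum>t<m. coef t g * phi t x))"
    unfolding ip_def using expand[of _ g] by (intro sum.cong) auto
  also have "\<dots> = (\<Sum>t<m. coef t g * (\<Sum>x\<in>V. cnj (f x) * phi t x))"
    by (simp add: sum_distrib_left mult_ac) (rule sum.swap)
  also have "\<dots> = (\<Sum>t<m. cnj (coef t f) * coef t g)"
    by (simp add: coef_def ip_def mult_ac)
  finally show ?thesis .
qed

lemma coef_H:
  assumes "t < m"
  shows "coef t (H f) = of_real (lam m t) * coef t f"
proof -
  have "coef t (H f) = ip (H (phi t)) f" by (simp add: coef_def H_adjoint)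
  also have "\<dots> = of_real (lam m t) * coef t f"
    using eig[OF assms] by (simp add: ip_def coef_def sum_distrib_left mult_ac)
  finally show ?thesis .
qed

lemma coef_nonzero:
  assumes "x \<in> V" "f x \<noteq> 0"
  shows "\<exists>t<m. coef t f \<noteq> 0"
  using expand[OF assms(1), of f] assms(2) by (metis (no_types, lifting) lessThan_iff mult_eq_0_iff sum.neutral)

lemma square_sum_less:
  fixes a b :: "nat \<Rightarrow> real"
  assumes "s < m" "coef s f \<noteq> 0" "\<And>t. t < m \<Longrightarrow> a t < b t"
  shows "(\<Sum>t<m. a t * (norm (coef t f))\<^sup>2) < (\<Sum>t<m. b t * (norm (coef t f))\<^sup>2)"
proof (rule sum_strict_mono_ex1)
  show "\<forall>t\<in>{..<m}. a t * (norm (coef t f))\<^sup>2 \<le> b t * (norm (coef t f))\<^sup>2"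
    using assms(3) by (auto intro!: mult_right_mono simp: less_imp_le)
  show "\<exists>t\<in>{..<m}. a t * (norm (coef t f))\<^sup>2 < b t * (norm (coef t f))\<^sup>2"
    using assms by (intro bexI[of _ s] mult_strict_right_mono) auto
qed auto

lemma norm_sq_coef: "(\<Sum>x\<in>V. (norm (f x))\<^sup>2) = (\<Sum>t<m. (norm (coef t f))\<^sup>2)"
proof -
  have "of_real (\<Sum>x\<in>V. (norm (f x))\<^sup>2) = ip f f"
    by (simp add: ip_def cnj_mult_norm)
  also have "\<dots> = of_real (\<Sum>t<m. (norm (coef t f))\<^sup>2)"
    unfolding ip_coef by (simp add: cnj_mult_norm)
  finally show ?thesis by (simp only: of_real_eq_iff)
qed

text \<open>No eigenvalue reaches 2 in absolute value, so \<open>4 - H^2\<close> is positive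
  definite. The bounds on degrees and common neighbours come from test vectors for this
  form.\<close>

lemma H_norm_less:
  assumes "x \<in> V" "f x \<noteq> 0"
  shows "(\<Sum>x\<in>V. (norm (H f x))\<^sup>2) < 4 * (\<Sum>x\<in>V. (norm (f x))\<^sup>2)"
proof -
  obtain s where s: "s < m" "coef s f \<noteq> 0" using coef_nonzero[of x f] assms by blast
  have "(\<Sum>x\<in>V. (norm (H f x))\<^sup>2) = (\<Sum>t<m. (lam m t)\<^sup>2 * (norm (coef t f))\<^sup>2)"
    unfolding norm_sq_coef by (intro sum.cong) (auto simp: coef_H norm_mult power_mult_distrib)
  also have "\<dots> < (\<Sum>t<m. 4 * (norm (coef t f))\<^sup>2)"
  proof (rule square_sum_less[OF s])
    fix t
    have "\<bar>lam m t\<bar> < 2" by (rule lam_bound[OF odd_m])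
    then have "\<bar>lam m t\<bar>\<^sup>2 < 2\<^sup>2" by (intro power_strict_mono) auto
    then show "(lam m t)\<^sup>2 < 4" by simp
  qed
  finally show ?thesis
    by (simp add: norm_sq_coef sum_distrib_left)
qed

text \<open>The same strictness for \<open>2 - H\<close>, the Gram form of the lattice
  argument.\<close>

lemma form_pos:
  assumes "x \<in> V" "f x \<noteq> 0"
  shows "Re (ip f (\<lambda>x. 2 * f x - H f x)) > 0"
proof -
  obtain s where s: "s < m" "coef s f \<noteq> 0" using coef_nonzero[of x f] assms by blast
  have "coef t (\<lambda>x. 2 * f x - H f x) = of_real (2 - lam m t) * coef t f" if "t < m" for t
  proof -
    have "coef t (\<lambda>x. 2 * f x - H f x) = 2 * coef t f - coef t (H f)"
      by (simp add: coef_def ip_def algebra_simps sum_subtractf sum_distrib_left)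
    then show ?thesis using that by (simp add: coef_H algebra_simps)
  qed
  then have "ip f (\<lambda>x. 2 * f x - H f x) = (\<Sum>t<m. of_real ((2 - lam m t) * (norm (coef t f))\<^sup>2))"
    unfolding ip_coef by (intro sum.cong) (simp_all add: cnj_mult_norm)
  then have "Re (ip f (\<lambda>x. 2 * f x - H f x)) = (\<Sum>t<m. (2 - lam m t) * (norm (coef t f))\<^sup>2)"
    by simp
  also have "\<dots> > (\<Sum>t<m. 0 * (norm (coef t f))\<^sup>2)"
  proof (rule square_sum_less[OF s])
    show "0 < 2 - lam m t" for t using lam_bound[OF odd_m, of t] by linarith
  qed
  finally show ?thesis by simp
qed

text \<open>Distinct eigenvalues force all coefficients but one to vanish.\<close>

lemma eigenfunction:
  assumes "\<And>x. x \<in> V \<Longrightarrow> H f x = mu * f x" "x0 \<in> V" "f x0 \<noteq> 0"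
  shows "\<exists>t<m. mu = of_real (lam m t) \<and> (\<forall>x\<in>V. f x = coef t f * phi t x)"
proof -
  have c: "of_real (lam m s) * coef s f = mu * coef s f" if "s < m" for s
  proof -
    have "coef s (H f) = mu * coef s f"
      using assms(1) by (simp add: coef_def ip_def sum_distrib_left mult_ac)
    then show ?thesis using that by (simp add: coef_H)
  qed
  obtain t where t: "t < m" "coef t f \<noteq> 0" using coef_nonzero[of x0 f] assms by blast
  then have mu: "mu = of_real (lam m t)" using c[of t] by auto
  have "coef s f = 0" if "s < m" "s \<noteq> t" for s
    using c[OF that(1)] that t(1) by (auto simp: mu lam_eq_iff[OF odd_m])
  then have "f x = coef t f * phi t x" if "x \<in> V" for x
    using expand[OF that, of f] t(1)
    by (simp add: sum.remove[of _ t])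
  then show ?thesis using t mu by blast
qed

section \<open>Spectra and traces of unions of components\<close>

definition spec :: "nat set \<Rightarrow> nat set" where
  "spec R = {t. t < m \<and> (\<exists>x\<in>R. phi t x \<noteq> 0)}"

lemma spec_sub: "spec R \<subseteq> {..<m}"
  by (auto simp: spec_def)

lemma fin_spec: "finite (spec R)"
  using spec_sub finite_subset by blast

text \<open>No edge leaves \<open>R\<close>, so cutting \<open>phi t\<close> off outside
  \<open>R\<close> gives an eigenvector again. By simplicity it is a multiple of
  \<open>phi t\<close>, and the two agree at a point of \<open>R\<close> where \<open>phi t\<close>
  is nonzero; hence nothing was cut off.\<close>

lemma eigenvector_support:
  assumes "adj_closed R" "t \<in> spec R" "x \<in> V - R"
  shows "phi t x = 0"
proof -
  define f where "f = (\<lambda>x. if x \<in> R then phi t x else 0)"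
  have t: "t < m" using assms(2) by (simp add: spec_def)
  have "H f y = of_real (lam m t) * f y" if y: "y \<in> V" for y
  proof (cases "y \<in> R")
    case True
    then have "nbrs y \<subseteq> R" using assms(1) by (auto simp: adj_closed_def)
    then have "H f y = H (phi t) y"
      unfolding H_nbrs by (intro sum.cong) (auto simp: f_def)
    then show ?thesis using True eig[OF t y] by (simp add: f_def)
  next
    case False
    then have "f z = 0" if "z \<in> nbrs y" for z
      using assms(1) that nbrs_sym[of z y] by (auto simp: adj_closed_def f_def)
    then have "H f y = 0" unfolding H_nbrs by (intro sum.neutral) auto
    then show ?thesis using False by (simp add: f_def)
  qed
  moreover obtain x0 where x0: "x0 \<in> R" "phi t x0 \<noteq> 0" using assms(2) by (auto simp: spec_def)
  moreover have "x0 \<in> V" "f x0 \<noteq> 0" using x0 assms(1) by (auto simp: f_def adj_closed_def)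
  ultimately obtain s where s: "s < m" "complex_of_real (lam m t) = of_real (lam m s)"
      "\<And>x. x \<in> V \<Longrightarrow> f x = coef s f * phi s x"
    using eigenfunction[of f "of_real (lam m t)" x0] by blast
  then have "s = t" using t by (simp add: lam_eq_iff[OF odd_m])
  have "f x0 = coef t f * phi t x0" "f x = coef t f * phi t x"
    using s(3) \<open>s = t\<close> x0 assms by (auto simp: adj_closed_def)
  then show ?thesis
    using x0 assms(3) by (auto simp: f_def)
qed

lemma sum_support:
  assumes "adj_closed R" "t < m"
  shows "(\<Sum>x\<in>R. phi t x * cnj (phi t x)) = of_bool (t \<in> spec R)"
proof (cases "t \<in> spec R")
  case True
  have "(\<Sum>x\<in>R. phi t x * cnj (phi t x)) = (\<Sum>x\<in>V. phi t x * cnj (phi t x))"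
    using eigenvector_support[OF assms(1) True] assms(1) finV
    by (intro sum.mono_neutral_left) (auto simp: adj_closed_def)
  also have "\<dots> = 1"
    using orth[OF assms(2,2)] by (simp add: ip_def mult.commute)
  finally show ?thesis using True by simp
next
  case False
  then show ?thesis using assms(2) by (auto simp: spec_def intro!: sum.neutral)
qed

text \<open>The \<open>(x, y)\<close> entry of the operator with eigenvectors \<open>phi t\<close>
  and eigenvalues \<open>c t\<close>, that is of a function of \<open>H\<close>.\<close>

definition spectral :: "(nat \<Rightarrow> complex) \<Rightarrow> nat \<Rightarrow> nat \<Rightarrow> complex" where
  "spectral c x y = (\<Sum>t<m. c t * phi t x * cnj (phi t y))"

lemma spectral_trace:
  assumes "adj_closed R"
  shows "(\<Sum>x\<in>R. spectral c x x) = (\<Sum>t\<in>spec R. c t)"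
proof -
  have "(\<Sum>x\<in>R. spectral c x x) = (\<Sum>t<m. c t * (\<Sum>x\<in>R. phi t x * cnj (phi t x)))"
    unfolding spectral_def by (subst sum.swap) (simp add: sum_distrib_left mult.assoc)
  also have "\<dots> = (\<Sum>t<m. if t \<in> spec R then c t else 0)"
    by (intro sum.cong) (auto simp: sum_support[OF assms])
  also have "\<dots> = (\<Sum>t\<in>spec R. c t)"
    using spec_sub[of R] by (subst sum.inter_restrict[symmetric]) (auto simp: Int_absorb1)
  finally show ?thesis .
qed

lemma spectral_1:
  assumes "x \<in> V" "y \<in> V"
  shows "spectral (\<lambda>t. 1) x y = of_bool (x = y)"
  using compl[OF assms] by (simp add: spectral_def)

lemma spectral_step:
  assumes "x \<in> V"
  shows "spectral (\<lambda>t. of_real (lam m t) * c t) x y = (\<Sum>z\<in>V. h x z * spectral c z y)"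
proof -
  have "spectral (\<lambda>t. of_real (lam m t) * c t) x y
      = (\<Sum>t<m. c t * H (phi t) x * cnj (phi t y))"
    unfolding spectral_def using assms by (intro sum.cong) (auto simp: eig mult_ac)
  also have "\<dots> = (\<Sum>t<m. \<Sum>z\<in>V. h x z * (c t * phi t z * cnj (phi t y)))"
    by (simp add: H_def sum_distrib_left sum_distrib_right mult_ac)
  also have "\<dots> = (\<Sum>z\<in>V. h x z * spectral c z y)"
    by (subst sum.swap) (simp add: spectral_def sum_distrib_left)
  finally show ?thesis .
qed

lemma spectral_lam:
  assumes "x \<in> V" "y \<in> V"
  shows "spectral (\<lambda>t. of_real (lam m t)) x y = h x y"
proof -
  have "spectral (\<lambda>t. of_real (lam m t)) x y = (\<Sum>z\<in>V. h x z * spectral (\<lambda>t. 1) z y)"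
    using spectral_step[OF assms(1), of "\<lambda>t. 1" y] by simp
  also have "\<dots> = (\<Sum>z\<in>V. if z = y then h x y else 0)"
    using assms(2) by (intro sum.cong) (auto simp: spectral_1)
  finally show ?thesis using assms(2) finV by simp
qed

lemma spectral_lam2:
  assumes "x \<in> V" "y \<in> V"
  shows "spectral (\<lambda>t. of_real (lam m t) ^ 2) x y = H2 x y"
  unfolding power2_eq_square spectral_step[OF assms(1)] H2_def
  using assms by (intro sum.cong) (auto simp: spectral_lam)

lemma spectral_lam4:
  assumes "x \<in> V"
  shows "spectral (\<lambda>t. of_real (lam m t) ^ 4) x x = of_real (\<Sum>y\<in>V. (norm (H2 x y))\<^sup>2)"
proof -
  have "spectral (\<lambda>t. of_real (lam m t) ^ 4) x x
      = spectral (\<lambda>t. of_real (lam m t) * (of_real (lam m t) * of_real (lam m t) ^ 2)) x x"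
    by (simp add: power2_eq_square power4_eq_xxxx mult.assoc)
  also have "\<dots> = (\<Sum>z\<in>V. h x z * (\<Sum>y\<in>V. h z y * H2 y x))"
    unfolding spectral_step[OF assms]
    using assms by (intro sum.cong) (auto simp: spectral_step spectral_lam2)
  also have "\<dots> = (\<Sum>z\<in>V. \<Sum>y\<in>V. h x z * h z y * H2 y x)"
    by (simp add: sum_distrib_left mult.assoc)
  also have "\<dots> = (\<Sum>y\<in>V. \<Sum>z\<in>V. h x z * h z y * H2 y x)"
    by (rule sum.swap)
  also have "\<dots> = (\<Sum>y\<in>V. H2 x y * H2 y x)"
    by (simp add: H2_def sum_distrib_right)
  also have "\<dots> = of_real (\<Sum>y\<in>V. (norm (H2 x y))\<^sup>2)"
    unfolding of_real_sum by (intro sum.cong refl) (metis H2_sym complex_norm_square)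
  finally show ?thesis .
qed

lemma card_spec:
  assumes "adj_closed R"
  shows "card (spec R) = card R"
proof -
  have "complex_of_nat (card (spec R)) = (\<Sum>x\<in>R. spectral (\<lambda>t. 1) x x)"
    by (simp add: spectral_trace[OF assms])
  also have "\<dots> = (\<Sum>x\<in>R. 1)"
    using assms by (intro sum.cong) (auto simp: spectral_1 adj_closed_def)
  finally show ?thesis by simp
qed

text \<open>These are the entries of the Dickson polynomials of \<open>H\<close>, and the recurrence
  stays in the Gaussian integers.\<close>

lemma spectral_gauss_ints:
  assumes "x \<in> V" "y \<in> V"
  shows "spectral (\<lambda>t. omega m t ^ j + inverse (omega m t) ^ j) x y \<in> gauss_ints"
  using assms
proof (induction j arbitrary: x y rule: less_induct)
  case (less j)
  consider "j = 0" | "j = 1" | k where "j = Suc (Suc k)"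
    by (metis One_nat_def not0_implies_Suc)
  then show ?case
  proof cases
    case 1
    have "spectral (\<lambda>t. 2) x y = 2 * spectral (\<lambda>t. 1) x y"
      by (simp add: spectral_def sum_distrib_left mult_ac)
    then show ?thesis using 1 spectral_1[OF less.prems] by auto
  next
    case 2
    then show ?thesis
      using spectral_lam[OF less.prems] h_gauss_ints by (simp add: lam_omega)
  next
    case 3
    let ?c = "\<lambda>j t. omega m t ^ j + inverse (omega m t) ^ j"
    have "?c j t = of_real (lam m t) * ?c (Suc k) t - ?c k t" for t
      using 3 by (simp add: lam_omega field_simps)
    then have "spectral (?c j) x y
        = spectral (\<lambda>t. of_real (lam m t) * ?c (Suc k) t) x y - spectral (?c k) x y"
      by (simp add: spectral_def left_diff_distrib sum_subtractf)
    also have "\<dots> = (\<Sum>z\<in>V. h x z * spectral (?c (Suc k)) z y) - spectral (?c k) x y"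
      by (simp only: spectral_step[OF less.prems(1)])
    also have "\<dots> \<in> gauss_ints"
    proof (intro gauss_ints_diff gauss_ints_sum gauss_ints_mult h_gauss_ints)
      show "spectral (?c (Suc k)) z y \<in> gauss_ints" if "z \<in> V" for z
        by (rule less.IH) (use 3 that less.prems(2) in auto)
      show "spectral (?c k) x y \<in> gauss_ints"
        by (rule less.IH) (use 3 less.prems in auto)
    qed
    finally show ?thesis .
  qed
qed

text \<open>The power sums are partial traces of Dickson polynomials of \<open>H\<close>, hence
  Gaussian integers; they are real because every root of unity is accompanied by its
  conjugate.\<close>

lemma spec_galois:
  assumes "adj_closed R" "t \<in> spec R" "m dvd d * t" "coprime b d" "odd d"
  shows "t * b mod m \<in> spec R"
proof (rule galois_closed[OF odd_m spec_sub _ assms(2-)])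
  fix j
  let ?S = "\<Sum>t\<in>spec R. omega m t ^ j + inverse (omega m t) ^ j"
  have "?S = (\<Sum>x\<in>R. spectral (\<lambda>t. omega m t ^ j + inverse (omega m t) ^ j) x x)"
    by (simp add: spectral_trace[OF assms(1)])
  also have "\<dots> \<in> gauss_ints"
    using assms(1) by (intro gauss_ints_sum spectral_gauss_ints) (auto simp: adj_closed_def)
  finally have "?S \<in> gauss_ints" .
  moreover have "Im ?S = 0"
  proof -
    have "cnj ?S = ?S"
      by (simp add: inverse_omega add.commute)
    moreover have "cnj z = z \<Longrightarrow> Im z = 0" for z by (simp add: complex_eq_iff)
    ultimately show ?thesis by blast
  qed
  ultimately show "?S \<in> \<int>"
    by (rule gauss_ints_real)
qed

lemma spec_mult:
  assumes "adj_closed R" "t \<in> spec R" "coprime b m"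
  shows "t * b mod m \<in> spec R"
  by (rule spec_galois[OF assms(1,2) _ assms(3) odd_m]) simp

text \<open>Doubling permutes the index set of the spectrum, which turns \<open>cos 4\<theta>\<close> into \<open>cos 2\<theta>\<close>
  in the fourth moment.\<close>

lemma fourth_moment:
  assumes "adj_closed R"
  shows "(\<Sum>t\<in>spec R. lam m t ^ 4) = 3 * (\<Sum>t\<in>spec R. (lam m t)\<^sup>2)"
proof -
  let ?d = "\<lambda>t. t * 2 mod m"
  define c where "c = (\<lambda>t. cos (4 * pi * real t / real m))"
  have cop: "coprime 2 m" using odd_m by simp
  have "inj_on ?d {..<m}"
  proof (rule inj_onI)
    fix s t assume "s \<in> {..<m}" "t \<in> {..<m}" "?d s = ?d t"
    then show "s = t"
      using cop cong_mult_rcancel_nat[of 2 m s t] by (simp add: cong_def)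
  qed
  then have inj: "inj_on ?d (spec R)" using spec_sub inj_on_subset by blast
  have "?d ` spec R \<subseteq> spec R"
    using spec_mult[OF assms _ cop] by auto
  then have im: "?d ` spec R = spec R"
    using endo_inj_surj[OF fin_spec _ inj] by simp
  have c2: "c (?d t) = 2 * (c t)\<^sup>2 - 1" for t
  proof -
    have "real (t * 2) = real (?d t) + real m * real (t * 2 div m)"
      by (metis mod_mult_div_eq of_nat_add of_nat_mult)
    then have "4 * pi * real (t * 2) / real m = 4 * pi * real (?d t) / real m + 2 * pi * (2 * real (t * 2 div m))"
      using m_pos by (simp add: field_simps)
    moreover have "cos (2 * pi * (2 * real (t * 2 div m))) = 1" "sin (2 * pi * (2 * real (t * 2 div m))) = 0"
      using cos_2npi[of "2 * (t * 2 div m)"] sin_2npi[of "2 * (t * 2 div m)"] by (simp_all add: mult_ac)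
    then have "cos (4 * pi * real (?d t) / real m + 2 * pi * (2 * real (t * 2 div m))) = c (?d t)"
      by (simp add: c_def cos_add)
    ultimately have "c (?d t) = cos (2 * (4 * pi * real t / real m))"
      by (simp add: field_simps)
    also have "\<dots> = 2 * (c t)\<^sup>2 - 1"
      unfolding c_def by (rule cos_double_cos)
    finally show ?thesis .
  qed
  have l2: "(lam m t)\<^sup>2 = 2 - 2 * c t" for t
    using cos_double_sin[of "2 * pi * real t / real m"]
    by (simp add: lam_def c_def power_mult_distrib mult.assoc)
  have l4: "lam m t ^ 4 = 6 - 8 * c t + 2 * c (?d t)" for t
  proof -
    have "lam m t ^ 4 = ((lam m t)\<^sup>2)\<^sup>2" by simp
    also have "\<dots> = 6 - 8 * c t + 2 * c (?d t)"
      unfolding l2 c2 by (simp add: power2_eq_square algebra_simps)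
    finally show ?thesis .
  qed
  have "(\<Sum>t\<in>spec R. c (?d t)) = (\<Sum>t\<in>spec R. c t)"
    using sum.reindex[OF inj, of c] im by simp
  then show ?thesis
    by (simp add: l2 l4 sum.distrib sum_subtractf flip: sum_distrib_left)
qed

lemma fourth_moment_graph:
  assumes "adj_closed R"
  shows "(\<Sum>x\<in>R. \<Sum>y\<in>V. (norm (H2 x y))\<^sup>2) = 3 * (\<Sum>x\<in>R. real (deg x))"
proof -
  have RV: "R \<subseteq> V" using assms by (simp add: adj_closed_def)
  have "of_real (\<Sum>x\<in>R. \<Sum>y\<in>V. (norm (H2 x y))\<^sup>2) = (\<Sum>x\<in>R. spectral (\<lambda>t. of_real (lam m t) ^ 4) x x)"
    using RV by (simp add: spectral_lam4 subset_iff del: of_real_sum) (simp add: of_real_sum)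
  also have "\<dots> = of_real (\<Sum>t\<in>spec R. lam m t ^ 4)"
    by (simp add: spectral_trace[OF assms])
  also have "\<dots> = 3 * (\<Sum>t\<in>spec R. of_real (lam m t) ^ 2)"
    by (simp add: fourth_moment[OF assms])
  also have "\<dots> = 3 * (\<Sum>x\<in>R. spectral (\<lambda>t. of_real (lam m t) ^ 2) x x)"
    by (simp add: spectral_trace[OF assms])
  also have "(\<Sum>x\<in>R. spectral (\<lambda>t. of_real (lam m t) ^ 2) x x) = of_real (\<Sum>x\<in>R. real (deg x))"
    using RV by (simp add: spectral_lam2 H2_self subset_iff)
  finally have "complex_of_real (\<Sum>x\<in>R. \<Sum>y\<in>V. (norm (H2 x y))\<^sup>2)
      = of_real (3 * (\<Sum>x\<in>R. real (deg x)))" by simp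
  then show ?thesis by (simp only: of_real_eq_iff)
qed

text \<open>Multiplication by the unit \<open>m - 1\<close> pairs \<open>t\<close> with
  \<open>m - t\<close>, and modulo an odd number only 0 is its own partner.\<close>

lemma even_card_of_zero_notin_spec:
  assumes "adj_closed R" "0 \<notin> spec R"
  shows "even (card R)"
proof -
  let ?A = "{t \<in> spec R. 2 * t < m}" and ?B = "{t \<in> spec R. 2 * t > m}"
  have neg: "m - t \<in> spec R" if "t \<in> spec R" "t > 0" for t
  proof -
    have t: "t < m" using that spec_sub by auto
    have "coprime (m - 1) m" using m_pos coprime_diff_one_left_nat by auto
    then have "t * (m - 1) mod m \<in> spec R" by (rule spec_mult[OF assms(1) that(1)])
    moreover have "t * (m - 1) mod m = m - t"
    proof -
      have "t * (m - 1) + m = t * m + (m - t)"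
        using t m_pos by (simp add: algebra_simps diff_mult_distrib2)
      then have "(t * (m - 1) + m) mod m = (m - t) mod m" by (metis mod_mult_self3)
      then show ?thesis using t that by simp
    qed
    ultimately show ?thesis by simp
  qed
  have pos: "t > 0" if "t \<in> spec R" for t using assms(2) that by (cases t) auto
  have "bij_betw (\<lambda>t. m - t) ?A ?B"
  proof (rule bij_betw_byWitness[where f' = "\<lambda>t. m - t"])
    have less: "t < m" if "t \<in> spec R" for t using that spec_sub by auto
    show "\<forall>t\<in>?A. m - (m - t) = t" "\<forall>t\<in>?B. m - (m - t) = t" using less by force+
    show "(\<lambda>t. m - t) ` ?A \<subseteq> ?B" "(\<lambda>t. m - t) ` ?B \<subseteq> ?A"
      using neg pos less by fastforce+
  qed
  then have "card ?A = card ?B" by (rule bij_betw_same_card)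
  moreover have "spec R = ?A \<union> ?B"
    using odd_m by auto (metis dvd_triv_left nat_neq_iff)
  then have "card (spec R) = card ?A + card ?B"
    using fin_spec[of R] by (subst \<open>spec R = ?A \<union> ?B\<close>, intro card_Un_disjoint) auto
  ultimately show ?thesis using card_spec[OF assms(1)] by simp
qed

lemma spec_disjoint:
  assumes "adj_closed R" "adj_closed S" "R \<inter> S = {}"
  shows "spec R \<inter> spec S = {}"
  using eigenvector_support[OF assms(1)] assms(2,3)
  by (fastforce simp: spec_def[of S] adj_closed_def)

end

section \<open>Local structure\<close>

lemma gauss_ints_norm:
  assumes "z \<in> gauss_ints" "(norm z)\<^sup>2 < 1"
  shows "z = 0"
proof -
  obtain a b where ab: "Re z = of_int a" "Im z = of_int b"
    using assms(1) by (auto simp: gauss_ints_def elim!: Ints_cases)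
  have "real_of_int (a\<^sup>2 + b\<^sup>2) < 1"
    using assms(2) by (simp add: cmod_power2 ab)
  then have "a\<^sup>2 + b\<^sup>2 < 1" by linarith
  then have "a = 0 \<and> b = 0"
    by (smt (verit) zero_less_power2 sum_power2_gt_zero_iff)
  then show ?thesis by (simp add: complex_eq_iff ab)
qed

text \<open>Real plus imaginary part of a unit is odd, hence so is that of a sum of three
  units.\<close>

lemma unit4_sum3_nonzero:
  "a \<in> unit4 \<Longrightarrow> b \<in> unit4 \<Longrightarrow> c \<in> unit4 \<Longrightarrow> a + b + c \<noteq> 0"
  by (auto simp: unit4_def complex_eq_iff)

lemma unit4_sum2_cases:
  assumes "a \<in> unit4" "b \<in> unit4"
  shows "a + b = 0 \<or> a = b \<or> (norm (a + b))\<^sup>2 = 2"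
  using assms by (auto simp: unit4_def cmod_power2)

context gain_graph
begin

text \<open>A 4-cycle whose gains multiply to -1, phrased as cancellation of the two paths from
  \<open>a\<close> to \<open>c\<close>, which is the form in which it shows up in
  \<open>H^2\<close>.\<close>

definition neg_quad :: "nat \<Rightarrow> nat \<Rightarrow> nat \<Rightarrow> nat \<Rightarrow> bool" where
  "neg_quad a b c d \<longleftrightarrow> a \<noteq> c \<and> b \<noteq> d \<and> {b, d} \<subseteq> nbrs a \<inter> nbrs c \<and>
     h a b * h b c + h a d * h d c = 0"

lemma neg_quad_reflect: "neg_quad a b c d \<Longrightarrow> neg_quad a d c b"
  by (auto simp: neg_quad_def add.commute)

lemma neg_quad_rotate:
  assumes "neg_quad a b c d"
  shows "neg_quad b c d a"
proof -
  have n: "b \<in> nbrs a" "d \<in> nbrs a" "b \<in> nbrs c" "d \<in> nbrs c"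
    and eq: "h a b * h b c + h a d * h d c = 0" using assms by (auto simp: neg_quad_def)
  have "h b c * h c d + h b a * h a d
      = h b a * (h a b * h b c + h a d * h d c) * h c d"
    using h_cnj_mult[of a b] h_cnj_mult[of d c] n(1,4) nbrs_sym[of b a]
    by (simp add: algebra_simps)
  then have "h b c * h c d + h b a * h a d = 0" using eq by simp
  then show ?thesis
    using assms nbrs_sym by (auto simp: neg_quad_def)
qed

lemma neg_quad_distinct:
  assumes "neg_quad a b c d"
  shows "distinct [a, b, c, d]"
  using assms nbrs_irrefl by (auto simp: neg_quad_def)

lemma neg_quad_V:
  assumes "neg_quad a b c d"
  shows "{a, b, c, d} \<subseteq> V"
proof -
  have "b \<in> nbrs a" "d \<in> nbrs a" "a \<in> nbrs b" "c \<in> nbrs b"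
    using assms nbrs_sym by (auto simp: neg_quad_def)
  then show ?thesis using nbrs_sub by blast
qed

lemma deg_in_V: "deg x > 0 \<Longrightarrow> x \<in> V"
  by (rule ccontr) (simp add: deg_def nbrs_empty_outside)

lemma nbrs_eqI:
  assumes "A \<subseteq> nbrs x" "card A = deg x"
  shows "nbrs x = A"
  using assms fin_nbrs card_subset_eq unfolding deg_def by metis

lemma H2_singleton:
  assumes "nbrs x \<inter> nbrs y = {z}"
  shows "H2 x y \<in> unit4"
proof -
  have "z \<in> nbrs x" "z \<in> nbrs y" using assms by auto
  then have "h x z \<in> unit4" "h z y \<in> unit4"
    using h_unit h_zero_sym by (auto simp: nbrs_def)
  then show ?thesis using assms by (simp add: H2_common unit4_mult)
qed

lemma H2_doubleton:
  assumes "nbrs x \<inter> nbrs y = {z, w}" "z \<noteq> w"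
  shows "H2 x y = h x z * h z y + h x w * h w y"
  using assms by (simp add: H2_common)

end

section \<open>Bounds from principal minors of \<open>4 - H^2\<close>\<close>

context spectral_graph
begin

lemma ip_H2: "ip (H f) (H f) = (\<Sum>x\<in>V. \<Sum>y\<in>V. cnj (f x) * H2 x y * f y)"
proof -
  have "ip (H f) (H f) = ip f (H (H f))" by (simp add: H_adjoint)
  also have "\<dots> = (\<Sum>x\<in>V. cnj (f x) * (\<Sum>y\<in>V. H2 x y * f y))"
  proof -
    have "H (H f) x = (\<Sum>y\<in>V. H2 x y * f y)" for x
    proof -
      have "H (H f) x = (\<Sum>z\<in>V. \<Sum>y\<in>V. h x z * h z y * f y)"
        by (simp add: H_def sum_distrib_left mult.assoc)
      also have "\<dots> = (\<Sum>y\<in>V. H2 x y * f y)"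
        by (subst sum.swap) (simp add: H2_def sum_distrib_right)
      finally show ?thesis .
    qed
    then show ?thesis by (simp add: ip_def)
  qed
  finally show ?thesis by (simp add: sum_distrib_left mult.assoc)
qed

lemma H2_form_less:
  assumes "X \<subseteq> V" "x0 \<in> X" "f x0 \<noteq> 0"
  shows "Re (\<Sum>x\<in>X. \<Sum>y\<in>X. cnj (f x) * H2 x y * f y) < 4 * (\<Sum>x\<in>X. (norm (f x))\<^sup>2)"
proof -
  define g where "g = (\<lambda>x. if x \<in> X then f x else 0)"
  have res: "(\<Sum>x\<in>V. F x) = (\<Sum>x\<in>X. F x)" if "\<And>x. x \<notin> X \<Longrightarrow> F x = 0" for F :: "nat \<Rightarrow> 'a :: comm_monoid_add"
    by (rule sum.mono_neutral_right) (use finV assms(1) that in auto)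
  have "(\<Sum>x\<in>X. \<Sum>y\<in>X. cnj (f x) * H2 x y * f y) = (\<Sum>x\<in>V. \<Sum>y\<in>V. cnj (g x) * H2 x y * g y)"
    by (subst res, simp add: g_def, rule sum.cong[OF refl], subst res) (simp_all add: g_def)
  also have "\<dots> = ip (H g) (H g)" by (simp add: ip_H2)
  also have "\<dots> = of_real (\<Sum>x\<in>V. (norm (H g x))\<^sup>2)" by (simp add: ip_def cnj_mult_norm)
  finally have "Re (\<Sum>x\<in>X. \<Sum>y\<in>X. cnj (f x) * H2 x y * f y) = (\<Sum>x\<in>V. (norm (H g x))\<^sup>2)"
    by (simp only: Re_complex_of_real)
  also have "\<dots> < 4 * (\<Sum>x\<in>V. (norm (g x))\<^sup>2)"
    using assms by (intro H_norm_less[of x0]) (auto simp: g_def)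
  also have "(\<Sum>x\<in>V. (norm (g x))\<^sup>2) = (\<Sum>x\<in>X. (norm (f x))\<^sup>2)"
    by (subst res) (simp_all add: g_def)
  finally show ?thesis .
qed

lemma deg_le_3: "deg x \<le> 3"
proof (cases "x \<in> V")
  case True
  then have "real (deg x) < 4"
    using H2_form_less[of "{x}" x "\<lambda>_. 1"] by (simp add: H2_self)
  then show ?thesis by linarith
next
  case False
  then show ?thesis by (simp add: deg_def nbrs_empty_outside)
qed

lemma H2_pair_less:
  assumes "x \<in> V" "y \<in> V" "x \<noteq> y"
  shows "(norm (H2 x y))\<^sup>2 < (4 - real (deg x)) * (4 - real (deg y))"
proof -
  define z where "z = H2 x y"
  define a where "a = 4 - real (deg x)"
  have a: "a > 0" using deg_le_3[of x] by (simp add: a_def)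
  have z': "H2 y x = cnj z" using H2_sym[of x y] by (simp add: z_def)
  \<comment> \<open>This vector annihilates the row of \<open>x\<close> in \<open>4 - H^2\<close>,
    so the form evaluates to \<open>a\<close> times the 2 by 2 minor.\<close>
  define f where "f = (\<lambda>w. if w = x then z else of_real a)"
  have "Re (\<Sum>u\<in>{x, y}. \<Sum>v\<in>{x, y}. cnj (f u) * H2 u v * f v) < 4 * (\<Sum>u\<in>{x, y}. (norm (f u))\<^sup>2)"
    by (rule H2_form_less[of _ y]) (use assms a in \<open>auto simp: f_def\<close>)
  also have "(\<Sum>u\<in>{x, y}. \<Sum>v\<in>{x, y}. cnj (f u) * H2 u v * f v)
      = of_real (real (deg x)) * (cnj z * z) + 2 * of_real a * (cnj z * z) + of_real (real (deg y) * a\<^sup>2)"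
    using assms(3) by (simp add: f_def H2_self z' flip: z_def) (simp add: algebra_simps power2_eq_square)
  also have "\<dots> = of_real (real (deg x) * (norm z)\<^sup>2 + 2 * a * (norm z)\<^sup>2 + real (deg y) * a\<^sup>2)"
    by (simp add: cnj_mult_norm)
  also have "(\<Sum>u\<in>{x, y}. (norm (f u))\<^sup>2) = (norm z)\<^sup>2 + a\<^sup>2"
    using assms(3) by (simp add: f_def)
  finally have "real (deg x) * (norm z)\<^sup>2 + 2 * a * (norm z)\<^sup>2 + real (deg y) * a\<^sup>2 < 4 * ((norm z)\<^sup>2 + a\<^sup>2)"
    by (simp only: Re_complex_of_real)
  then have "a * (norm z)\<^sup>2 < a * (a * (4 - real (deg y)))"
    by (simp add: a_def power2_eq_square algebra_simps)
  then show ?thesis using a by (simp add: z_def a_def)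
qed

lemma H2_triple_less:
  assumes "x \<in> V" "y \<in> V" "z \<in> V" "distinct [x, y, z]" "deg x = 3" "deg y = 3" "H2 x y = 0"
  shows "(norm (H2 x z))\<^sup>2 + (norm (H2 y z))\<^sup>2 < 4 - real (deg z)"
proof -
  define p q where "p = H2 x z" and "q = H2 y z"
  have s: "H2 z x = cnj p" "H2 z y = cnj q" "H2 y x = 0"
    using H2_sym[of x z] H2_sym[of y z] H2_sym[of x y] assms(7) by (simp_all add: p_def q_def)
  \<comment> \<open>The diagonal entries of \<open>4 - H^2\<close> at \<open>x\<close> and
    \<open>y\<close> are 1, so this vector annihilates both rows and leaves the Schur complement at
    \<open>z\<close>.\<close>
  define f where "f = (\<lambda>w. if w = x then p else if w = y then q else 1)"
  have "Re (\<Sum>u\<in>{x, y, z}. \<Sum>v\<in>{x, y, z}. cnj (f u) * H2 u v * f v) < 4 * (\<Sum>u\<in>{x, y, z}. (norm (f u))\<^sup>2)"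
    by (rule H2_form_less[of _ z]) (use assms in \<open>auto simp: f_def\<close>)
  also have "(\<Sum>u\<in>{x, y, z}. \<Sum>v\<in>{x, y, z}. cnj (f u) * H2 u v * f v)
      = 5 * (cnj p * p) + 5 * (cnj q * q) + of_nat (deg z)"
    using assms by (simp add: f_def H2_self s flip: p_def q_def)
  also have "\<dots> = of_real (5 * (norm p)\<^sup>2 + 5 * (norm q)\<^sup>2 + real (deg z))"
    by (simp add: cnj_mult_norm)
  also have "(\<Sum>u\<in>{x, y, z}. (norm (f u))\<^sup>2) = (norm p)\<^sup>2 + (norm q)\<^sup>2 + 1"
    using assms(4) by (simp add: f_def)
  finally show ?thesis
    by (simp add: p_def q_def Re_complex_of_real del: of_real_add of_real_mult)
qed

lemma deg3_H2_zero:
  assumes "x \<noteq> y" "deg x = 3" "deg y = 3"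
  shows "H2 x y = 0"
  using H2_pair_less[OF deg_in_V deg_in_V assms(1)] assms
  by (intro gauss_ints_norm H2_gauss_ints) auto

text \<open>Three common neighbours give both vertices degree 3, where \<open>H2 x y\<close> must
  vanish; but three units never sum to 0.\<close>

lemma card_common_le_2:
  assumes "x \<noteq> y"
  shows "card (nbrs x \<inter> nbrs y) \<le> 2"
proof (rule ccontr)
  assume *: "\<not> card (nbrs x \<inter> nbrs y) \<le> 2"
  have "card (nbrs x \<inter> nbrs y) \<le> deg x" "card (nbrs x \<inter> nbrs y) \<le> deg y"
    unfolding deg_def by (auto intro!: card_mono fin_nbrs)
  then have 3: "deg x = 3" "deg y = 3" "card (nbrs x \<inter> nbrs y) = 3"
    using * deg_le_3[of x] deg_le_3[of y] by auto
  then obtain a b c where abc: "nbrs x \<inter> nbrs y = {a, b, c}" "a \<noteq> b" "a \<noteq> c" "b \<noteq> c"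
    by (auto simp: card_3_iff)
  have u: "h x w * h w y \<in> unit4" if "w \<in> {a, b, c}" for w
  proof -
    have "w \<in> nbrs x \<inter> nbrs y" using abc that by blast
    then show ?thesis using h_unit h_zero_sym by (auto simp: nbrs_def unit4_mult)
  qed
  have "H2 x y = h x a * h a y + h x b * h b y + h x c * h c y"
    using abc by (simp add: H2_common)
  then show False
    using unit4_sum3_nonzero u deg3_H2_zero[OF assms 3(1,2)] by (metis insertCI)
qed

lemma neg_quad_common:
  assumes "neg_quad a b c d"
  shows "nbrs a \<inter> nbrs c = {b, d}" "H2 a c = 0"
proof -
  have q: "a \<noteq> c" "b \<noteq> d" "{b, d} \<subseteq> nbrs a \<inter> nbrs c" "h a b * h b c + h a d * h d c = 0"
    using assms by (auto simp: neg_quad_def)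
  have "card {b, d} = 2" using q by simp
  then show eq: "nbrs a \<inter> nbrs c = {b, d}"
    using card_common_le_2[OF q(1)] q(3) fin_nbrs by (metis card_seteq finite_Int)
  show "H2 a c = 0" using H2_doubleton[OF eq q(2)] q(4) by simp
qed

text \<open>All degrees are 3, so \<open>H^2\<close> is 3 times the identity on this component,
  which leaves two possible eigenvalues for four distinct ones.\<close>

lemma no_K4:
  assumes "distinct [a, b, c, d]" "nbrs a = {b, c, d}" "nbrs b = {a, c, d}"
    "nbrs c = {a, b, d}" "nbrs d = {a, b, c}"
  shows False
proof -
  let ?R = "{a, b, c, d}"
  have deg: "deg x = 3" if "x \<in> ?R" for x using that assms by (auto simp: deg_def)
  have RV: "?R \<subseteq> V" using deg deg_in_V by fastforce
  have cl: "adj_closed ?R" using assms RV by (auto simp: adj_closed_def)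
  have "(lam m t)\<^sup>2 = 3" if t: "t \<in> spec ?R" for t
  proof -
    obtain x where x: "x \<in> ?R" "phi t x \<noteq> 0" using t by (auto simp: spec_def)
    have tm: "t < m" using t by (simp add: spec_def)
    have "H (H (phi t)) x = (\<Sum>y\<in>V. h x y * (of_real (lam m t) * phi t y))"
      unfolding H_def[of "H (phi t)"] using eig[OF tm] by (intro sum.cong) auto
    also have "\<dots> = of_real (lam m t) * H (phi t) x"
      by (simp add: H_def sum_distrib_left mult_ac)
    also have "\<dots> = of_real ((lam m t)\<^sup>2) * phi t x"
      using eig[OF tm, of x] x(1) RV by (auto simp: power2_eq_square)
    finally have 1: "H (H (phi t)) x = of_real ((lam m t)\<^sup>2) * phi t x" .
    have "H (H (phi t)) x = (\<Sum>z\<in>V. \<Sum>y\<in>V. h x z * h z y * phi t y)"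
      by (simp add: H_def sum_distrib_left mult.assoc)
    also have "\<dots> = (\<Sum>y\<in>V. H2 x y * phi t y)"
      by (subst sum.swap) (simp add: H2_def sum_distrib_right)
    also have "\<dots> = (\<Sum>y\<in>V. if y = x then 3 * phi t x else 0)"
    proof (rule sum.cong[OF refl])
      fix y assume "y \<in> V"
      show "H2 x y * phi t y = (if y = x then 3 * phi t x else 0)"
      proof (cases "y \<in> ?R")
        case True
        then show ?thesis using deg3_H2_zero[of x y] deg x(1) by (auto simp: H2_self)
      next
        case False
        then have "phi t y = 0" using eigenvector_support[OF cl t, of y] \<open>y \<in> V\<close> by blast
        then show ?thesis using False x(1) by auto
      qed
    qed
    also have "\<dots> = 3 * phi t x" using x(1) RV finV by auto
    finally have "of_real ((lam m t)\<^sup>2) * phi t x = 3 * phi t x" using 1 by simp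
    then have "complex_of_real ((lam m t)\<^sup>2) = of_real 3" using x(2) by simp
    then show ?thesis by (simp only: of_real_eq_iff)
  qed
  then have "lam m t = sqrt 3 \<or> lam m t = - sqrt 3" if "t \<in> spec ?R" for t
    using that power2_eq_iff[of "lam m t" "sqrt 3"] by simp
  then have "lam m ` spec ?R \<subseteq> {sqrt 3, - sqrt 3}" by blast
  then have "card (lam m ` spec ?R) \<le> card {sqrt 3, - sqrt 3}"
    by (intro card_mono) auto
  also have "\<dots> \<le> 2" by (simp add: card_insert_if)
  also have "card (lam m ` spec ?R) = card (spec ?R)"
    using lam_eq_iff[OF odd_m] spec_sub[of ?R] by (intro card_image inj_onI) (auto simp: subset_iff)
  also have "\<dots> = 4" using card_spec[OF cl] assms(1) by simp
  finally show False by simp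
qed

text \<open>A chord raises \<open>a\<close> and \<open>c\<close> to degree 3. If \<open>b\<close>
  and \<open>d\<close> are adjacent as well, the four vertices form a \<open>K_4\<close> component.
  Otherwise \<open>b\<close> has exactly one common neighbour with each of \<open>a\<close> and
  \<open>c\<close>, and these two unit entries use up the whole Schur complement at
  \<open>b\<close>.\<close>

lemma neg_quad_no_chord:
  assumes "neg_quad a b c d"
  shows "c \<notin> nbrs a"
proof
  assume c: "c \<in> nbrs a"
  have q: "b \<in> nbrs a" "d \<in> nbrs a" "b \<in> nbrs c" "d \<in> nbrs c"
    using assms by (auto simp: neg_quad_def)
  have dist: "distinct [a, b, c, d]" by (rule neg_quad_distinct[OF assms])
  have "card {b, c, d} \<le> deg a" "card {a, b, d} \<le> deg c"
    unfolding deg_def using q c nbrs_sym[of c a] by (auto intro!: card_mono fin_nbrs)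
  then have deg: "deg a = 3" "deg c = 3"
    using dist deg_le_3[of a] deg_le_3[of c] by auto
  have na: "nbrs a = {b, c, d}" "nbrs c = {a, b, d}"
    using q c dist deg nbrs_sym[of c a] by (auto intro!: nbrs_eqI)
  show False
  proof (cases "d \<in> nbrs b")
    case True
    have "card {a, c, d} \<le> deg b" "card {a, b, c} \<le> deg d"
      unfolding deg_def using q True nbrs_sym by (auto intro!: card_mono fin_nbrs)
    then have "deg b = 3" "deg d = 3"
      using dist deg_le_3[of b] deg_le_3[of d] by auto
    then have "nbrs b = {a, c, d}" "nbrs d = {a, b, c}"
      using q True dist nbrs_sym by (auto intro!: nbrs_eqI)
    then show False using no_K4[OF dist] na by blast
  next
    case False
    have nb: "a \<in> nbrs b" "c \<in> nbrs b" using q nbrs_sym by auto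
    have "nbrs a \<inter> nbrs b = {c}" "nbrs c \<inter> nbrs b = {a}"
      using na False nb nbrs_irrefl[of b] by auto
    then have "(norm (H2 a b))\<^sup>2 = 1" "(norm (H2 c b))\<^sup>2 = 1"
      using H2_singleton unit4_norm by auto
    moreover have "card {a, c} \<le> deg b"
      unfolding deg_def using nb by (intro card_mono fin_nbrs) auto
    ultimately show False
      using H2_triple_less[of a c b] neg_quad_V[OF assms] dist deg neg_quad_common(2)[OF assms]
      by auto
  qed
qed

text \<open>A triangle on the side \<open>a b\<close> would make both ends of degree 3 with a single
  common neighbour, hence a unit in \<open>H^2\<close> where 0 is forced. Adjacency to
  \<open>c\<close> would be a third common neighbour of \<open>a\<close> and
  \<open>c\<close>.\<close>

lemma neg_quad_outside:
  assumes "neg_quad a b c d" "y \<notin> {a, b, c, d}" "y \<in> nbrs a"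
  shows "y \<notin> nbrs b" "y \<notin> nbrs c" "y \<notin> nbrs d"
proof -
  have 1: "y \<notin> nbrs b" if "neg_quad a b c d" "y \<notin> {a, b, c, d}" for b d
  proof
    assume y: "y \<in> nbrs b"
    have q: "b \<in> nbrs a" "d \<in> nbrs a" "a \<in> nbrs b" "c \<in> nbrs b"
      using that nbrs_sym by (auto simp: neg_quad_def)
    have dist: "distinct [a, b, c, d]" by (rule neg_quad_distinct[OF that(1)])
    have "card {b, d, y} \<le> deg a" "card {a, c, y} \<le> deg b"
      unfolding deg_def using q y assms(3) by (auto intro!: card_mono fin_nbrs)
    then have deg: "deg a = 3" "deg b = 3"
      using dist that(2) deg_le_3[of a] deg_le_3[of b] by (auto simp: numeral_3_eq_3)
    have "nbrs a = {b, d, y}" "nbrs b = {a, c, y}"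
      using q y assms(3) dist deg that(2) by (auto intro!: nbrs_eqI)
    moreover have "d \<notin> nbrs b"
      using neg_quad_no_chord[OF neg_quad_rotate[OF that(1)]] .
    ultimately have "nbrs a \<inter> nbrs b = {y}"
      using dist by auto
    then have "H2 a b \<in> unit4" by (rule H2_singleton)
    then show False using deg3_H2_zero[of a b] deg dist by (auto simp: unit4_def)
  qed
  show "y \<notin> nbrs b" by (rule 1[OF assms(1,2)])
  show "y \<notin> nbrs d" using 1[OF neg_quad_reflect[OF assms(1)]] assms(2) by auto
  show "y \<notin> nbrs c" using neg_quad_common(1)[OF assms(1)] assms(2,3) by blast
qed

text \<open>Two common neighbours contribute two units. They do not cancel, as there is no negative
  4-cycle, and they do not agree, as 4 exceeds the bound of the 2 by 2 minor; so they are
  perpendicular.\<close>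

lemma norm_H2_common:
  assumes "x \<in> V" "y \<in> V" "x \<noteq> y" "\<And>b d. \<not> neg_quad x b y d"
  shows "(norm (H2 x y))\<^sup>2 = real (card (nbrs x \<inter> nbrs y))"
proof -
  consider "card (nbrs x \<inter> nbrs y) = 0" | "card (nbrs x \<inter> nbrs y) = 1" | "card (nbrs x \<inter> nbrs y) = 2"
    using card_common_le_2[OF assms(3)] by linarith
  then show ?thesis
  proof cases
    case 1
    then have "nbrs x \<inter> nbrs y = {}" using fin_nbrs by simp
    then show ?thesis by (simp add: H2_common)
  next
    case 2
    then obtain z where "nbrs x \<inter> nbrs y = {z}" by (auto simp: card_1_singleton_iff)
    then show ?thesis using H2_singleton unit4_norm by simp
  next
    case 3
    then obtain z w where zw: "nbrs x \<inter> nbrs y = {z, w}" "z \<noteq> w" by (auto simp: card_2_iff)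
    define p q where "p = h x z * h z y" and "q = h x w * h w y"
    have mem: "z \<in> nbrs x" "z \<in> nbrs y" "w \<in> nbrs x" "w \<in> nbrs y" using zw by auto
    have u: "p \<in> unit4" "q \<in> unit4"
      unfolding p_def q_def using mem h_unit h_zero_sym by (auto simp: nbrs_def intro!: unit4_mult)
    have H2: "H2 x y = p + q" using H2_doubleton[OF zw] by (simp add: p_def q_def)
    have "p + q \<noteq> 0"
      using assms(3) assms(4)[of z w] mem zw(2) by (auto simp: neg_quad_def p_def q_def)
    moreover have "p \<noteq> q"
    proof
      assume "p = q"
      then have "(norm (H2 x y))\<^sup>2 = 4"
        using unit4_norm[OF u(1)] by (simp add: H2 norm_mult power_mult_distrib flip: mult_2)
      moreover have "card {z, w} \<le> deg x" "card {z, w} \<le> deg y"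
        unfolding deg_def using mem by (auto intro!: card_mono fin_nbrs)
      then have "(4 - real (deg x)) * (4 - real (deg y)) \<le> 2 * 2"
        using zw(2) deg_le_3[of x] deg_le_3[of y] by (intro mult_mono) auto
      ultimately show False using H2_pair_less[OF assms(1-3)] by simp
    qed
    ultimately have "(norm (p + q))\<^sup>2 = 2" using unit4_sum2_cases[OF u] by blast
    then show ?thesis using 3 by (simp add: H2)
  qed
qed

text \<open>With \<open>H2\<close> counting common neighbours, both sides of the fourth moment
  identity are degree sums: twice the sum of the squares minus the sum equals three times the
  sum.\<close>

lemma sum_deg_sq:
  assumes "adj_closed R" "\<And>a b c d. a \<in> R \<Longrightarrow> \<not> neg_quad a b c d"
  shows "(\<Sum>x\<in>R. (deg x)\<^sup>2) = 2 * (\<Sum>x\<in>R. deg x)"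
proof -
  have RV: "R \<subseteq> V" and finR: "finite R"
    using assms(1) finV finite_subset by (auto simp: adj_closed_def)
  have row: "(\<Sum>y\<in>V. (norm (H2 x y))\<^sup>2) = (real (deg x))\<^sup>2 + (\<Sum>z\<in>nbrs x. real (deg z) - 1)" if x: "x \<in> R" for x
  proof -
    have xV: "x \<in> V" using x RV by blast
    have "(\<Sum>y\<in>V - {x}. (norm (H2 x y))\<^sup>2) = (\<Sum>y\<in>V - {x}. real (card (nbrs x \<inter> nbrs y)))"
      using xV assms(2)[OF x] by (intro sum.cong norm_H2_common refl) auto
    also have "\<dots> = (\<Sum>y\<in>V - {x}. \<Sum>z\<in>nbrs x. of_bool (z \<in> nbrs y))"
    proof (rule sum.cong[OF refl])
      fix y
      have "(\<Sum>z\<in>nbrs x. of_bool (z \<in> nbrs y)) = real (card (nbrs x \<inter> {z. z \<in> nbrs y}))"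
        by (simp add: fin_nbrs)
      then show "real (card (nbrs x \<inter> nbrs y)) = (\<Sum>z\<in>nbrs x. of_bool (z \<in> nbrs y))" by simp
    qed
    also have "\<dots> = (\<Sum>z\<in>nbrs x. \<Sum>y\<in>V - {x}. of_bool (z \<in> nbrs y))" by (rule sum.swap)
    also have "\<dots> = (\<Sum>z\<in>nbrs x. real (deg z) - 1)"
    proof (rule sum.cong[OF refl])
      fix z assume z: "z \<in> nbrs x"
      have "(\<Sum>y\<in>V - {x}. of_bool (z \<in> nbrs y)) = real (card ((V - {x}) \<inter> {y. z \<in> nbrs y}))"
        using finV by (intro sum_of_bool_eq) auto
      also have "(V - {x}) \<inter> {y. z \<in> nbrs y} = nbrs z - {x}"
        using nbrs_sym nbrs_sub by blast
      also have "real (card (nbrs z - {x})) = real (deg z) - 1"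
      proof -
        have "x \<in> nbrs z" using z nbrs_sym by blast
        then have "card (nbrs z - {x}) = deg z - 1" "deg z > 0"
          using fin_nbrs by (auto simp: deg_def card_gt_0_iff)
        then show ?thesis by (simp add: of_nat_diff)
      qed
      finally show "(\<Sum>y\<in>V - {x}. of_bool (z \<in> nbrs y)) = real (deg z) - 1" .
    qed
    finally show ?thesis
      using finV xV by (simp add: sum.remove[of V x] H2_self)
  qed
  have "(\<Sum>x\<in>R. \<Sum>z\<in>nbrs x. real (deg z) - 1) = (\<Sum>x\<in>R. \<Sum>z\<in>R. if z \<in> nbrs x then real (deg z) - 1 else 0)"
  proof (rule sum.cong[OF refl])
    fix x assume "x \<in> R"
    then have eq: "{z \<in> R. z \<in> nbrs x} = nbrs x" using assms(1) by (auto simp: adj_closed_def)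
    show "(\<Sum>z\<in>nbrs x. real (deg z) - 1) = (\<Sum>z\<in>R. if z \<in> nbrs x then real (deg z) - 1 else 0)"
      by (simp only: sum.inter_filter[OF finR, symmetric] eq)
  qed
  also have "\<dots> = (\<Sum>z\<in>R. \<Sum>x\<in>R. if z \<in> nbrs x then real (deg z) - 1 else 0)" by (rule sum.swap)
  also have "\<dots> = (\<Sum>z\<in>R. real (deg z) * (real (deg z) - 1))"
  proof (rule sum.cong[OF refl])
    fix z assume "z \<in> R"
    then have "{x \<in> R. z \<in> nbrs x} = nbrs z" using assms(1) nbrs_sym by (auto simp: adj_closed_def)
    then show "(\<Sum>x\<in>R. if z \<in> nbrs x then real (deg z) - 1 else 0) = real (deg z) * (real (deg z) - 1)"
      by (simp add: sum.inter_filter[OF finR, symmetric] deg_def)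
  qed
  finally have "(\<Sum>x\<in>R. \<Sum>y\<in>V. (norm (H2 x y))\<^sup>2) = (\<Sum>x\<in>R. (real (deg x))\<^sup>2 + real (deg x) * (real (deg x) - 1))"
    using row by (simp add: sum.distrib)
  also have "\<dots> = 2 * (\<Sum>x\<in>R. (real (deg x))\<^sup>2) - (\<Sum>x\<in>R. real (deg x))"
    by (simp add: sum_distrib_left sum_subtractf[symmetric] power2_eq_square algebra_simps)
  finally have "(\<Sum>x\<in>R. (real (deg x))\<^sup>2) = 2 * (\<Sum>x\<in>R. real (deg x))"
    using fourth_moment_graph[OF assms(1)] by simp
  then have "real (\<Sum>x\<in>R. (deg x)\<^sup>2) = real (2 * (\<Sum>x\<in>R. deg x))" by simp
  then show ?thesis by (simp only: of_nat_eq_iff)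
qed

end

section \<open>The root lattice \<open>E\<^sub>6\<close>\<close>

lemma unit4_minus: "- z \<in> unit4 \<longleftrightarrow> z \<in> unit4"
proof -
  have "w \<in> unit4 \<Longrightarrow> - w \<in> unit4" for w by (auto simp: unit4_def)
  from this[of z] this[of "- z"] show ?thesis by auto
qed

lemma even_symmetric_sum:
  fixes f :: "nat \<Rightarrow> nat \<Rightarrow> int"
  assumes "\<And>i j. i < n \<Longrightarrow> j < n \<Longrightarrow> f i j = f j i" "\<And>i. i < n \<Longrightarrow> even (f i i)"
  shows "even (\<Sum>i<n. \<Sum>j<n. f i j)"
  using assms
proof (induction n)
  case (Suc n)
  have "(\<Sum>i<Suc n. \<Sum>j<Suc n. f i j)
      = (\<Sum>i<n. \<Sum>j<n. f i j) + (\<Sum>i<n. f i n) + (\<Sum>j<n. f n j) + f n n"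
    by (simp add: sum.distrib)
  also have "(\<Sum>j<n. f n j) = (\<Sum>i<n. f i n)"
    using Suc.prems(1) by (intro sum.cong) auto
  finally show ?case
    using Suc.IH Suc.prems by (simp add: even_add)
qed simp

context gain_graph
begin

definition component :: "nat set \<Rightarrow> bool" where
  "component K \<longleftrightarrow> adj_closed K \<and> K \<noteq> {} \<and> (\<forall>A. A \<subseteq> K \<and> A \<noteq> {} \<and> adj_closed A \<longrightarrow> A = K)"

definition L :: "(nat \<Rightarrow> complex) \<Rightarrow> nat \<Rightarrow> complex" where
  "L f x = 2 * f x - H f x"

lemma H_diff: "H (\<lambda>x. f x - g x) y = H f y - H g y"
  by (simp add: H_def right_diff_distrib sum_subtractf)

lemma L_diff: "L (\<lambda>x. f x - g x) y = L f y - L g y"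
  by (simp add: L_def H_diff)

lemma ip_diff_left: "ip (\<lambda>x. f x - g x) k = ip f k - ip g k"
  by (simp add: ip_def left_diff_distrib sum_subtractf)

lemma ip_diff_right: "ip k (\<lambda>x. f x - g x) = ip k f - ip k g"
  by (simp add: ip_def right_diff_distrib sum_subtractf)

lemma ip_cnj: "cnj (ip f g) = ip g f"
  by (simp add: ip_def mult.commute)

end

text \<open>Six vertices whose switched Gram matrix \<open>2I - A\<close> is a Gram matrix of the root lattice
  \<open>E\<^sub>6\<close>: its inverse \<open>N / 3\<close> is \<open>(4/3) v v\<^sup>T\<close> plus an even integral form, as the
  discriminant group of \<open>E\<^sub>6\<close> is cyclic of order 3 with norms \<open>4/3\<close> modulo 2.\<close>

locale e6_graph = spectral_graph +
  fixes s :: "nat \<Rightarrow> nat" and sg :: "nat \<Rightarrow> complex" and A N N' :: "nat \<Rightarrow> nat \<Rightarrow> int" and v :: "nat \<Rightarrow> int"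
  assumes s_inj: "inj_on s {..<6}"
    and s_V: "i < 6 \<Longrightarrow> s i \<in> V"
    and sg_unit: "i < 6 \<Longrightarrow> sg i \<in> unit4"
    and gram: "i < 6 \<Longrightarrow> j < 6 \<Longrightarrow> cnj (sg i) * h (s i) (s j) * sg j = of_int (A i j)"
    and inv: "i < 6 \<Longrightarrow> j < 6 \<Longrightarrow> 2 * N i j - (\<Sum>k<6. A i k * N k j) = (if i = j then 3 else 0)"
    and N_sym: "i < 6 \<Longrightarrow> j < 6 \<Longrightarrow> N i j = N j i"
    and N_eq: "i < 6 \<Longrightarrow> j < 6 \<Longrightarrow> N i j = 4 * v i * v j + 3 * N' i j"
    and N'_even: "i < 6 \<Longrightarrow> even (N' i i)"
    and N_not3: "\<exists>i<6. \<exists>j<6. \<not> 3 dvd N i j"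
begin

section \<open>The dual form and the projection away from the six vertices\<close>

definition S :: "nat set" where "S = s ` {..<6}"

text \<open>Three times the form of the dual lattice, since \<open>N\<close> is three times the
  inverse Gram matrix.\<close>

definition q :: "(nat \<Rightarrow> int) \<Rightarrow> (nat \<Rightarrow> int) \<Rightarrow> int" where
  "q b c = (\<Sum>i<6. \<Sum>j<6. N i j * b i * c j)"

text \<open>Modulo 3, the class in the discriminant group of \<open>E_6\<close>.\<close>

definition wt :: "(nat \<Rightarrow> int) \<Rightarrow> int" where
  "wt b = (\<Sum>i<6. v i * b i)"

definition comb :: "(nat \<Rightarrow> complex) \<Rightarrow> nat \<Rightarrow> complex" where
  "comb c z = (\<Sum>i<6. if z = s i then c i * sg i else 0)"

text \<open>For \<open>x\<close> outside \<open>S\<close>, the inner products of its vector with the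
  six switched vectors of \<open>S\<close>.\<close>

definition bvec :: "nat \<Rightarrow> nat \<Rightarrow> complex" where
  "bvec x i = - cnj (sg i) * h (s i) x"

text \<open>The Schur complement of \<open>2 - H\<close> at \<open>S\<close>: outside
  \<open>S\<close>, the Gram matrix of the projections to the orthogonal complement of the
  lattice.\<close>

definition G :: "nat \<Rightarrow> nat \<Rightarrow> complex" where
  "G x y = 2 * of_bool (x = y) - h x y - (\<Sum>i<6. \<Sum>j<6. of_int (N i j) * cnj (bvec x i) * bvec y j) / 3"

lemma q_eq: "q b c = 4 * wt b * wt c + 3 * (\<Sum>i<6. \<Sum>j<6. N' i j * b i * c j)"
proof -
  have "q b c = (\<Sum>i<6. \<Sum>j<6. 4 * (v i * b i) * (v j * c j) + 3 * (N' i j * b i * c j))"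
    unfolding q_def by (intro sum.cong refl) (simp add: N_eq algebra_simps)
  also have "\<dots> = 4 * wt b * wt c + 3 * (\<Sum>i<6. \<Sum>j<6. N' i j * b i * c j)"
    by (simp add: sum.distrib wt_def sum_distrib_left[symmetric] sum_distrib_right[symmetric])
  finally show ?thesis .
qed

lemma N'_sym:
  assumes "i < 6" "j < 6"
  shows "N' i j = N' j i"
proof -
  have "3 * N' i j = 3 * N' j i"
    using N_eq[OF assms] N_eq[OF assms(2,1)] N_sym[OF assms] by (simp add: mult_ac)
  then show ?thesis by simp
qed

lemma q_self_cong: "6 dvd q b b - 4 * (wt b)\<^sup>2"
proof -
  have "even (\<Sum>i<6. \<Sum>j<6. N' i j * b i * b j)"
    using N'_sym N'_even by (intro even_symmetric_sum) auto
  then obtain k where "(\<Sum>i<6. \<Sum>j<6. N' i j * b i * b j) = 2 * k" by (elim evenE)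
  then have "q b b - 4 * (wt b)\<^sup>2 = 6 * k" by (simp add: q_eq power2_eq_square)
  then show ?thesis by simp
qed

lemma comb_s:
  assumes "i < 6"
  shows "comb c (s i) = c i * sg i"
proof -
  have "comb c (s i) = (\<Sum>j<6. if j = i then c j * sg j else 0)"
    unfolding comb_def using s_inj assms by (intro sum.cong) (auto simp: inj_on_def)
  then show ?thesis using assms by simp
qed

lemma comb_outside: "z \<notin> S \<Longrightarrow> comb c z = 0"
  unfolding comb_def S_def by (rule sum.neutral) auto

lemma S_V: "S \<subseteq> V"
  using s_V by (auto simp: S_def)

lemma card_S: "card S = 6"
  using s_inj by (simp add: S_def card_image)

lemma sum_V_comb: "(\<Sum>z\<in>V. F z * comb c z) = (\<Sum>i<6. F (s i) * (c i * sg i))"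
proof -
  have "(\<Sum>z\<in>V. F z * comb c z) = (\<Sum>z\<in>S. F z * comb c z)"
    using finV S_V comb_outside by (intro sum.mono_neutral_right) auto
  also have "\<dots> = (\<Sum>i<6. F (s i) * (c i * sg i))"
    unfolding S_def by (subst sum.reindex[OF s_inj]) (simp add: comb_s)
  finally show ?thesis .
qed

lemma ip_comb: "ip (comb c) g = (\<Sum>i<6. cnj (c i) * (cnj (sg i) * g (s i)))"
proof -
  have "cnj (ip (comb c) g) = (\<Sum>z\<in>V. cnj (g z) * comb c z)"
    by (simp add: ip_def mult.commute)
  also have "\<dots> = (\<Sum>i<6. cnj (g (s i)) * (c i * sg i))" by (rule sum_V_comb)
  also have "\<dots> = cnj (\<Sum>i<6. cnj (c i) * (cnj (sg i) * g (s i)))"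
    by (simp add: mult_ac)
  finally show ?thesis by (simp only: complex_cnj_cancel_iff)
qed

lemma L_comb:
  assumes "i < 6"
  shows "cnj (sg i) * L (comb c) (s i) = 2 * c i - (\<Sum>j<6. of_int (A i j) * c j)"
proof -
  have "cnj (sg i) * L (comb c) (s i)
      = 2 * (cnj (sg i) * sg i) * c i - (\<Sum>j<6. cnj (sg i) * h (s i) (s j) * sg j * c j)"
    using assms by (simp add: L_def H_def sum_V_comb comb_s right_diff_distrib sum_distrib_left mult_ac)
  also have "\<dots> = 2 * c i - (\<Sum>j<6. of_int (A i j) * c j)"
    using assms by (simp add: unit4_cnj_mult sg_unit gram)
  finally show ?thesis .
qed

lemma solve_gram:
  assumes "i < 6"
  shows "2 * (\<Sum>j<6. of_int (N i j) * b j) - (\<Sum>k<6. of_int (A i k) * (\<Sum>j<6. of_int (N k j) * b j))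
    = (3 * b i :: complex)"
proof -
  have "(\<Sum>k<6. of_int (A i k) * (\<Sum>j<6. of_int (N k j) * b j))
      = (\<Sum>k<6. \<Sum>j<6. of_int (A i k * N k j) * b j)"
    by (simp add: sum_distrib_left mult.assoc)
  also have "\<dots> = (\<Sum>j<6. of_int (\<Sum>k<6. A i k * N k j) * b j)"
    by (subst sum.swap) (simp add: sum_distrib_right)
  finally have "2 * (\<Sum>j<6. of_int (N i j) * b j) - (\<Sum>k<6. of_int (A i k) * (\<Sum>j<6. of_int (N k j) * b j))
      = (\<Sum>j<6. of_int (2 * N i j - (\<Sum>k<6. A i k * N k j)) * b j)"
    by (simp add: sum_distrib_left sum_subtractf[symmetric] left_diff_distrib mult.assoc)
  also have "\<dots> = (\<Sum>j<6. if j = i then 3 * b j else 0)"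
    using assms by (intro sum.cong refl) (simp add: inv)
  finally show ?thesis using assms by simp
qed

lemma L_comb_solve:
  assumes "i < 6"
  shows "cnj (sg i) * L (comb (\<lambda>i. (\<Sum>j<6. of_int (N i j) * b j) / 3)) (s i) = b i"
  using solve_gram[OF assms, of b]
  by (simp add: L_comb[OF assms] field_simps flip: sum_divide_distrib)

text \<open>The dual form is, up to the factor 3, the value of \<open>2 - H\<close> at the vector on
  \<open>S\<close> whose inner products with the six generators are \<open>b\<close>.\<close>

lemma q_pos:
  assumes "\<exists>i<6. b i \<noteq> 0"
  shows "q b b > 0"
proof -
  obtain i0 where i0: "i0 < 6" "b i0 \<noteq> 0" using assms by blast
  define c where "c = (\<lambda>i. (\<Sum>j<6. of_int (N i j) * complex_of_int (b j)) / 3)"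
  have Lc: "cnj (sg i) * L (comb c) (s i) = of_int (b i)" if "i < 6" for i
    unfolding c_def by (rule L_comb_solve[OF that])
  have "\<exists>x\<in>V. comb c x \<noteq> 0"
  proof (rule ccontr)
    assume "\<not> ?thesis"
    then have z: "\<And>x. x \<in> V \<Longrightarrow> comb c x = 0" by blast
    then have "L (comb c) (s i0) = 0"
      using s_V[OF i0(1)] by (simp add: L_def H_def)
    then show False using Lc[OF i0(1)] i0 by simp
  qed
  then obtain x where "x \<in> V" "comb c x \<noteq> 0" by blast
  then have "Re (ip (comb c) (L (comb c))) > 0"
    using form_pos[of x "comb c"] by (simp add: L_def[abs_def])
  also have "ip (comb c) (L (comb c)) = (\<Sum>i<6. cnj (c i) * of_int (b i))"
    unfolding ip_comb using Lc by (intro sum.cong) auto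
  also have "\<dots> = of_int (q b b) / 3"
    by (simp add: c_def q_def sum_distrib_left sum_distrib_right mult_ac flip: sum_divide_distrib)
  finally show ?thesis by simp
qed

text \<open>Subtracting from a vector supported outside \<open>S\<close> its projection to the span
  of \<open>S\<close> leaves a vector on which \<open>2 - H\<close> takes the value of the Schur
  complement.\<close>

lemma G_form:
  assumes "X \<subseteq> V - S" "x0 \<in> X" "xi x0 \<noteq> 0"
  shows "Re (\<Sum>x\<in>X. \<Sum>y\<in>X. cnj (xi x) * G x y * xi y) > 0"
proof -
  have finX: "finite X" using assms(1) finV finite_subset by blast
  define u where "u = (\<lambda>x. if x \<in> X then xi x else 0)"
  define b where "b = (\<lambda>i. \<Sum>x\<in>X. xi x * bvec x i)"
  define c where "c = (\<lambda>i. (\<Sum>j<6. of_int (N i j) * b j) / 3)"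
  define Q where "Q = (\<Sum>i<6. cnj (c i) * b i)"
  have res: "(\<Sum>x\<in>V. F x) = (\<Sum>x\<in>X. F x)" if "\<And>x. x \<notin> X \<Longrightarrow> F x = 0" for F :: "nat \<Rightarrow> complex"
    by (rule sum.mono_neutral_right) (use finV assms(1) that in auto)
  have Hu: "H u z = (\<Sum>x\<in>X. h z x * xi x)" for z
    unfolding H_def by (subst res) (auto simp: u_def)
  have "cnj (sg i) * L u (s i) = b i" if "i < 6" for i
  proof -
    have "s i \<notin> X" using assms(1) that by (auto simp: S_def)
    then have "u (s i) = 0" by (simp add: u_def)
    then show ?thesis
      by (simp add: L_def Hu b_def bvec_def sum_distrib_left mult_ac sum_negf)
  qed
  then have wu: "ip (comb c) (L u) = Q"
    unfolding ip_comb Q_def by (intro sum.cong) auto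
  have ww: "ip (comb c) (L (comb c)) = Q"
    unfolding ip_comb Q_def by (intro sum.cong refl) (simp add: c_def L_comb_solve)
  have uw: "ip u (L (comb c)) = cnj Q"
  proof -
    have "ip u (L (comb c)) = cnj (ip (L (comb c)) u)" by (simp add: ip_cnj)
    also have "ip (L (comb c)) u = ip (comb c) (L u)"
    proof -
      have "ip (L f) g = 2 * ip f g - ip (H f) g" for f g
        by (simp add: ip_def L_def left_diff_distrib sum_subtractf sum_distrib_left mult.assoc)
      moreover have "ip f (L g) = 2 * ip f g - ip f (H g)" for f g
        by (simp add: ip_def L_def right_diff_distrib sum_subtractf sum_distrib_left mult_ac)
      ultimately show ?thesis by (simp add: H_adjoint)
    qed
    finally show ?thesis by (simp add: wu)
  qed
  have uu: "ip u (L u) = (\<Sum>x\<in>X. \<Sum>y\<in>X. cnj (xi x) * (2 * of_bool (x = y) - h x y) * xi y)"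
  proof -
    have "ip u (L u) = (\<Sum>x\<in>X. cnj (xi x) * (2 * xi x - (\<Sum>y\<in>X. h x y * xi y)))"
      unfolding ip_def by (subst res) (auto simp: u_def L_def Hu[unfolded u_def])
    also have "\<dots> = (\<Sum>x\<in>X. \<Sum>y\<in>X. cnj (xi x) * (2 * of_bool (x = y) - h x y) * xi y)"
    proof (rule sum.cong[OF refl])
      fix x assume "x \<in> X"
      then have two: "(\<Sum>y\<in>X. 2 * of_bool (x = y) * xi y) = 2 * xi x"
        using finX by (simp add: of_bool_def if_distrib[of "\<lambda>r. r * _"] if_distrib[of "\<lambda>r. 2 * r"] cong: if_cong)
      have "(\<Sum>y\<in>X. cnj (xi x) * (2 * of_bool (x = y) - h x y) * xi y)
          = (\<Sum>y\<in>X. cnj (xi x) * (2 * of_bool (x = y) * xi y)) - (\<Sum>y\<in>X. cnj (xi x) * (h x y * xi y))"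
        by (simp add: sum_subtractf[symmetric] left_diff_distrib right_diff_distrib mult.assoc)
      also have "\<dots> = cnj (xi x) * (2 * xi x - (\<Sum>y\<in>X. h x y * xi y))"
        by (simp only: sum_distrib_left[symmetric] two right_diff_distrib)
      finally show "cnj (xi x) * (2 * xi x - (\<Sum>y\<in>X. h x y * xi y))
          = (\<Sum>y\<in>X. cnj (xi x) * (2 * of_bool (x = y) - h x y) * xi y)" ..
    qed
    finally show ?thesis .
  qed
  have Q: "Q = (\<Sum>x\<in>X. \<Sum>y\<in>X. cnj (xi x) * ((\<Sum>i<6. \<Sum>j<6. of_int (N i j) * cnj (bvec x i) * bvec y j) / 3) * xi y)"
  proof -
    have "Q = (\<Sum>i<6. \<Sum>j<6. of_int (N i j) * cnj (b j) * b i / 3)"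
      by (simp add: Q_def c_def sum_divide_distrib sum_distrib_right)
    also have "\<dots> = (\<Sum>i<6. \<Sum>j<6. of_int (N i j) * cnj (b i) * b j / 3)"
      by (subst sum.swap) (intro sum.cong refl, simp add: N_sym)
    also have "\<dots> = (\<Sum>i<6. \<Sum>j<6. \<Sum>x\<in>X. \<Sum>y\<in>X.
        of_int (N i j) * cnj (xi x * bvec x i) * (xi y * bvec y j) / 3)"
    proof (intro sum.cong refl)
      fix i j
      have "cnj (b i) * b j = (\<Sum>x\<in>X. \<Sum>y\<in>X. cnj (xi x * bvec x i) * (xi y * bvec y j))"
        by (simp add: b_def sum_product)
      then show "of_int (N i j) * cnj (b i) * b j / 3 = (\<Sum>x\<in>X. \<Sum>y\<in>X.
          of_int (N i j) * cnj (xi x * bvec x i) * (xi y * bvec y j) / 3)"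
        by (simp only: mult.assoc sum_distrib_left sum_divide_distrib)
    qed
    also have "\<dots> = (\<Sum>i<6. \<Sum>x\<in>X. \<Sum>y\<in>X. \<Sum>j<6.
        of_int (N i j) * cnj (xi x * bvec x i) * (xi y * bvec y j) / 3)"
      by (rule sum.cong[OF refl], rule trans[OF sum.swap], rule sum.cong[OF refl], rule sum.swap)
    also have "\<dots> = (\<Sum>x\<in>X. \<Sum>y\<in>X. \<Sum>i<6. \<Sum>j<6.
        of_int (N i j) * cnj (xi x * bvec x i) * (xi y * bvec y j) / 3)"
      by (rule trans[OF sum.swap], rule sum.cong[OF refl], rule sum.swap)
    also have "\<dots> = (\<Sum>x\<in>X. \<Sum>y\<in>X. cnj (xi x) * ((\<Sum>i<6. \<Sum>j<6. of_int (N i j) * cnj (bvec x i) * bvec y j) / 3) * xi y)"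
      by (intro sum.cong refl) (simp add: sum_distrib_left sum_distrib_right sum_divide_distrib mult_ac)
    finally show ?thesis .
  qed
  define f where "f = (\<lambda>x. u x - comb c x)"
  have x0: "x0 \<in> V" "x0 \<notin> S" using assms by auto
  then have "f x0 \<noteq> 0" using assms(2,3) by (simp add: f_def u_def comb_outside)
  then have "Re (ip f (L f)) > 0"
    using form_pos[OF x0(1), of f] by (simp add: L_def[abs_def])
  \<comment> \<open>Both cross terms and the norm of the projection equal \<open>Q\<close> up to
    conjugation, so the two subtractions and the one addition leave a single copy
    subtracted.\<close>
  also have "ip f (L f) = ip u (L u) - cnj Q"
    unfolding f_def L_diff ip_diff_left ip_diff_right by (simp add: wu ww uw)
  finally have "Re (ip u (L u) - Q) > 0" by simp
  also have "ip u (L u) - Q = (\<Sum>x\<in>X. \<Sum>y\<in>X. cnj (xi x) * G x y * xi y)"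
    unfolding uu Q G_def by (simp add: sum_subtractf[symmetric] left_diff_distrib right_diff_distrib)
  finally show ?thesis .
qed

lemma G_sym: "cnj (G x y) = G y x"
proof -
  have "cnj (\<Sum>i<6. \<Sum>j<6. of_int (N i j) * cnj (bvec x i) * bvec y j)
      = (\<Sum>i<6. \<Sum>j<6. of_int (N i j) * bvec x i * cnj (bvec y j))"
    by simp
  also have "\<dots> = (\<Sum>i<6. \<Sum>j<6. of_int (N i j) * cnj (bvec y i) * bvec x j)"
    by (subst sum.swap) (intro sum.cong refl, simp add: N_sym mult_ac)
  finally show ?thesis by (auto simp: G_def h_sym)
qed

lemma Re_G_sym: "Re (cnj b * G w w' * a) = Re (cnj a * G w' w * b)"
proof -
  have "cnj b * G w w' * a = cnj (cnj a * G w' w * b)" by (simp add: G_sym)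
  then show ?thesis by (simp only: cnj.sel)
qed

lemma G_pair:
  assumes "x \<in> V - S" "y \<in> V - S" "x \<noteq> y" "a \<noteq> 0" "cnj a * G x y * b = p"
  shows "0 < (norm a)\<^sup>2 * Re (G x x) + (norm b)\<^sup>2 * Re (G y y) + 2 * Re p"
proof -
  define xi where "xi = (\<lambda>w. if w = x then a else b)"
  have "0 < Re (\<Sum>u\<in>{x, y}. \<Sum>v\<in>{x, y}. cnj (xi u) * G u v * xi v)"
    by (rule G_form[of _ x]) (use assms in \<open>auto simp: xi_def\<close>)
  also have "(\<Sum>u\<in>{x, y}. \<Sum>v\<in>{x, y}. cnj (xi u) * G u v * xi v)
      = of_real ((norm a)\<^sup>2) * G x x + of_real ((norm b)\<^sup>2) * G y y + cnj a * G x y * b + cnj b * G y x * a"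
    unfolding complex_norm_square using assms(3) by (simp add: xi_def mult_ac)
  also have "Re \<dots> = (norm a)\<^sup>2 * Re (G x x) + (norm b)\<^sup>2 * Re (G y y) + 2 * Re p"
    unfolding plus_complex.sel Re_G_sym[of b y x a] assms(5) by simp
  finally show ?thesis .
qed

text \<open>Positivity at one concrete vector. The cross terms enter through equations, so that
  phases can be absorbed into the coefficients and only plain numbers remain in the
  conclusion.\<close>

lemma G_triple:
  assumes "x \<in> V - S" "y \<in> V - S" "z \<in> V - S" "distinct [x, y, z]" "a \<noteq> 0"
    and "cnj a * G x y * b = p" "cnj a * G x z * c = r" "cnj b * G y z * c = w"
  shows "0 < (norm a)\<^sup>2 * Re (G x x) + (norm b)\<^sup>2 * Re (G y y) + (norm c)\<^sup>2 * Re (G z z)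
    + 2 * Re p + 2 * Re r + 2 * Re w"
proof -
  define xi where "xi = (\<lambda>w. if w = x then a else if w = y then b else c)"
  have "0 < Re (\<Sum>u\<in>{x, y, z}. \<Sum>v\<in>{x, y, z}. cnj (xi u) * G u v * xi v)"
    by (rule G_form[of _ x]) (use assms in \<open>auto simp: xi_def\<close>)
  also have "(\<Sum>u\<in>{x, y, z}. \<Sum>v\<in>{x, y, z}. cnj (xi u) * G u v * xi v)
      = of_real ((norm a)\<^sup>2) * G x x + of_real ((norm b)\<^sup>2) * G y y + of_real ((norm c)\<^sup>2) * G z z
        + cnj a * G x y * b + cnj b * G y x * a + cnj a * G x z * c + cnj c * G z x * a
        + cnj b * G y z * c + cnj c * G z y * b"
    unfolding complex_norm_square using assms(4) by (simp add: xi_def mult_ac)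
  also have "Re \<dots> = (norm a)\<^sup>2 * Re (G x x) + (norm b)\<^sup>2 * Re (G y y) + (norm c)\<^sup>2 * Re (G z z)
    + 2 * Re p + 2 * Re r + 2 * Re w"
    unfolding plus_complex.sel Re_G_sym[of b y x a] Re_G_sym[of c z x a] Re_G_sym[of c z y b] assms(6-8)
    by simp
  finally show ?thesis .
qed

section \<open>Vertices attached to the lattice\<close>

definition attached :: "nat \<Rightarrow> bool" where
  "attached x \<longleftrightarrow> (\<exists>i<6. h (s i) x \<noteq> 0)"

lemma bvec_not_attached: "\<not> attached x \<Longrightarrow> i < 6 \<Longrightarrow> bvec x i = 0"
  by (auto simp: attached_def bvec_def)

lemma G_not_attached:
  assumes "\<not> attached y"
  shows "G x y = 2 * of_bool (x = y) - h x y" "G y x = 2 * of_bool (y = x) - h y x"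
  using assms by (simp_all add: G_def bvec_not_attached)

text \<open>A vertex attached to \<open>S\<close> projects onto a minimal vector of the dual lattice.\<close>

lemma attached_vector:
  assumes "x \<in> V - S" "attached x"
  obtains z b where "z \<in> unit4" "\<And>i. i < 6 \<Longrightarrow> bvec x i = z * of_int (b i)" "q b b = 4" "wt b mod 3 = 1"
proof -
  note out = that
  have "bvec x i \<in> gauss_ints" if "i < 6" for i
    unfolding bvec_def using that
    by (intro gauss_ints_mult gauss_ints_minus gauss_ints_cnj h_gauss_ints unit4_gauss_ints sg_unit)
  then have "\<forall>i<6. \<exists>r t. bvec x i = of_int r + \<i> * of_int t"
    by (fastforce simp: gauss_ints_def complex_eq_iff elim!: Ints_cases)
  then obtain r t where rt: "\<And>i. i < 6 \<Longrightarrow> bvec x i = of_int (r i) + \<i> * of_int (t i)" by metis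
  have nz: "(\<exists>i<6. r i \<noteq> 0) \<or> (\<exists>i<6. t i \<noteq> 0)"
  proof -
    obtain i where "i < 6" "h (s i) x \<noteq> 0" using assms(2) by (auto simp: attached_def)
    then have "bvec x i \<noteq> 0" using unit4_nonzero[OF sg_unit] by (simp add: bvec_def)
    then show ?thesis using rt \<open>i < 6\<close> by auto
  qed
  have "Re (\<Sum>i<6. \<Sum>j<6. of_int (N i j) * cnj (bvec x i) * bvec x j)
      = (\<Sum>i<6. \<Sum>j<6. real_of_int (N i j * r i * r j + N i j * t i * t j))"
    unfolding Re_sum by (intro sum.cong refl) (simp add: rt algebra_simps)
  also have "\<dots> = of_int (q r r + q t t)"
    by (simp add: q_def sum.distrib)
  finally have Re_G: "Re (G x x) = 2 - of_int (q r r + q t t) / 3"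
    by (simp add: G_def h_irrefl)
  have "0 < Re (\<Sum>u\<in>{x}. \<Sum>v\<in>{x}. cnj 1 * G u v * 1)"
    by (rule G_form[of "{x}" x "\<lambda>_. 1"]) (use assms(1) in auto)
  \<comment> \<open>The norm 2 of the vertex minus the norm of its projection must stay positive. A
    nonzero part contributes at least 4 to this sum, so only one of the two parts can be
    nonzero.\<close>
  then have less: "q r r + q t t < 6" by (simp add: Re_G)
  have zero: "q b b = 0 \<Longrightarrow> \<forall>i<6. b i = 0" for b using q_pos[of b] by auto
  have q0: "q b b \<ge> 0" for b
    using q_pos[of b] by (cases "\<exists>i<6. b i \<noteq> 0") (auto simp: q_def)
  \<comment> \<open>Modulo 6 the value is \<open>4 w^2\<close> with \<open>w\<close> the class
    modulo 3; between 0 and 6 only 4 is left, and not for the class 0.\<close>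
  have q4: "q b b = 4 \<and> (wt b mod 3 = 1 \<or> wt b mod 3 = 2)" if "\<exists>i<6. b i \<noteq> 0" "q b b < 6" for b
  proof -
    have pos: "q b b > 0" by (rule q_pos[OF that(1)])
    obtain k where k: "q b b - 4 * (wt b)\<^sup>2 = 6 * k" using q_self_cong[of b] by (elim dvdE)
    define w l where "w = wt b mod 3" and "l = wt b div 3"
    define j where "j = k + 6 * l\<^sup>2 + 4 * l * w"
    have "wt b = 3 * l + w" by (simp add: w_def l_def)
    then have e: "q b b = 4 * w\<^sup>2 + 6 * j"
      using k by (simp add: power2_eq_square algebra_simps j_def)
    have "w \<ge> 0" "w < 3" by (simp_all add: w_def)
    then consider "w = 0" | "w = 1" | "w = 2" by linarith
    then show ?thesis
    proof cases
      case 1 then show ?thesis using e pos that(2) by auto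
    next
      case 2 then show ?thesis using e pos that(2) by (auto simp: w_def)
    next
      case 3
      then have "q b b = 16 + 6 * j" using e by simp
      then have "q b b = 4" using pos that(2) by presburger
      then show ?thesis using 3 by (simp add: w_def)
    qed
  qed
  have neg: "q (\<lambda>i. - b i) (\<lambda>i. - b i) = q b b" "wt (\<lambda>i. - b i) = - wt b" for b
    by (simp_all add: q_def wt_def sum_negf)
  \<comment> \<open>Negating both the vector and its unit exchanges the classes 1 and 2.\<close>
  have choose: thesis if "\<exists>i<6. b i \<noteq> 0" "q b b < 6" "e \<in> unit4" "\<And>i. i < 6 \<Longrightarrow> bvec x i = e * of_int (b i)" for b e
  proof (cases "wt b mod 3 = 1")
    case True
    then show ?thesis using out[of e b] q4[of b] that by blast
  next
    case False
    then have "wt b mod 3 = 2" using q4[OF that(1,2)] by simp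
    then have "wt (\<lambda>i. - b i) mod 3 = 1" unfolding neg by presburger
    moreover have "- e \<in> unit4" using that(3) by (auto simp: unit4_def)
    ultimately show ?thesis
      using out[of "- e" "\<lambda>i. - b i"]
        q4[OF that(1,2)] that(4) neg(1)[of b] by simp
  qed
  show thesis
  proof (cases "\<exists>i<6. r i \<noteq> 0")
    case True
    then have "\<not> (\<exists>i<6. t i \<noteq> 0)"
      using q4[of r] q4[of t] less q0[of r] q0[of t] by force
    then have "bvec x i = 1 * of_int (r i)" if "i < 6" for i using rt that by simp
    moreover have "q r r < 6" using less q0[of t] by simp
    ultimately show thesis using choose[of r 1] True by (simp add: unit4_def)
  next
    case False
    then have "bvec x i = \<i> * of_int (t i)" if "i < 6" for i using rt that by simp
    moreover have "q t t < 6" using less q0[of r] by simp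
    moreover have "\<exists>i<6. t i \<noteq> 0" using False nz by blast
    ultimately show thesis using choose[of t \<i>] by (simp add: unit4_def)
  qed
qed

text \<open>The unit that makes the inner products of an attached vertex integral and its class 1;
  for other vertices any unit will do.\<close>

definition phase :: "nat \<Rightarrow> complex" where
  "phase x = (SOME z. z \<in> unit4 \<and> (attached x \<longrightarrow>
     (\<exists>b. (\<forall>i<6. bvec x i = z * of_int (b i)) \<and> q b b = 4 \<and> wt b mod 3 = 1)))"

lemma phase:
  assumes "x \<in> V - S"
  shows "phase x \<in> unit4"
    and "attached x \<Longrightarrow> \<exists>b. (\<forall>i<6. bvec x i = phase x * of_int (b i)) \<and> q b b = 4 \<and> wt b mod 3 = 1"
proof -
  have "\<exists>z. z \<in> unit4 \<and> (attached x \<longrightarrow>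
     (\<exists>b. (\<forall>i<6. bvec x i = z * of_int (b i)) \<and> q b b = 4 \<and> wt b mod 3 = 1))"
  proof (cases "attached x")
    case True
    show ?thesis by (rule attached_vector[OF assms True]) blast
  next
    case False then show ?thesis by (auto simp: unit4_def)
  qed
  from someI_ex[OF this] show "phase x \<in> unit4"
    and "attached x \<Longrightarrow> \<exists>b. (\<forall>i<6. bvec x i = phase x * of_int (b i)) \<and> q b b = 4 \<and> wt b mod 3 = 1"
    unfolding phase_def by blast+
qed

text \<open>Both classes are 1, so \<open>q b c\<close> is 4 modulo 3, and the contribution of the
  projection is determined up to an integer.\<close>

lemma G_attached:
  assumes "x \<in> V - S" "y \<in> V - S" "attached x" "attached y"
  obtains k :: int where "phase x * G x y * cnj (phase y)
    = (2 * of_bool (x = y) - phase x * h x y * cnj (phase y)) - 4 / 3 - of_int k"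
    "x = y \<Longrightarrow> k = 0"
proof -
  obtain b where b: "\<forall>i<6. bvec x i = phase x * of_int (b i)" "q b b = 4" "wt b mod 3 = 1"
    using phase(2)[OF assms(1,3)] by blast
  obtain c where c: "\<forall>i<6. bvec y i = phase y * of_int (c i)" "q c c = 4" "wt c mod 3 = 1"
    using phase(2)[OF assms(2,4)] by blast
  have u: "phase x * cnj (phase x) = 1" "phase y * cnj (phase y) = 1"
    using phase(1) assms unit4_cnj_mult by auto
  have "phase x * (\<Sum>i<6. \<Sum>j<6. of_int (N i j) * cnj (bvec x i) * bvec y j) * cnj (phase y)
      = (\<Sum>i<6. \<Sum>j<6. (phase x * cnj (phase x)) * (phase y * cnj (phase y)) * of_int (N i j * b i * c j))"
    by (simp add: b(1) c(1) sum_distrib_left sum_distrib_right mult_ac)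
  also have "\<dots> = of_int (q b c)"
    by (simp add: u q_def)
  finally have main: "phase x * G x y * cnj (phase y)
      = (2 * of_bool (x = y) - phase x * h x y * cnj (phase y)) - of_int (q b c) / 3"
    using u by (auto simp: G_def right_diff_distrib left_diff_distrib h_irrefl mult_ac)
  have "(wt b * wt c) mod 3 = ((wt b mod 3) * (wt c mod 3)) mod 3" by (simp add: mod_mult_eq)
  then have "(wt b * wt c) mod 3 = 1" by (simp add: b(3) c(3))
  moreover have "(4 * P + 3 * M - 4) mod 3 = 0" if "P mod 3 = 1" for P M :: int
    using that by presburger
  ultimately have "(q b c - 4) mod 3 = 0"
    unfolding q_eq mult.assoc by blast
  then obtain k where k: "q b c - 4 = 3 * k" by (auto simp: mod_eq_0_iff_dvd elim: dvdE)
  show thesis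
  proof (rule that[of "if x = y then 0 else k"])
    have "x = y \<Longrightarrow> q b c = 4"
    proof -
      assume "x = y"
      then have "\<forall>i<6. b i = c i"
        using b(1) c(1) unit4_nonzero[OF phase(1)[OF assms(1)]] by auto
      then have "q b c = q b b" unfolding q_def by (intro sum.cong refl) auto
      then show ?thesis by (simp add: b(2))
    qed
    moreover have "complex_of_int (q b c) = 4 + 3 * of_int k"
    proof -
      have "q b c = 4 + 3 * k" using k by simp
      then show ?thesis by simp
    qed
    ultimately show "phase x * G x y * cnj (phase y)
      = (2 * of_bool (x = y) - phase x * h x y * cnj (phase y)) - 4 / 3
        - of_int (if x = y then 0 else k)"
      unfolding main by (auto simp: field_simps)
  qed simp
qed

lemma G_attached_self:
  assumes "x \<in> V - S" "attached x"
  shows "G x x = 2 / 3"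
proof -
  have u: "phase x * cnj (phase x) = 1" using phase(1)[OF assms(1)] unit4_cnj_mult by auto
  have "phase x * G x x * cnj (phase x) = 2 - 4 / 3"
    by (rule G_attached[OF assms(1,1,2,2)]) (simp add: h_irrefl)
  moreover have "phase x * G x x * cnj (phase x) = (phase x * cnj (phase x)) * G x x" by (simp add: mult_ac)
  ultimately show ?thesis by (simp add: u)
qed

text \<open>The entry lies in -1/3 plus the Gaussian integers. Positivity against the norms 2/3
  keeps its real and imaginary parts below 2/3 in absolute value, which leaves one
  candidate.\<close>

lemma G_attached_pair:
  assumes "x \<in> V - S" "y \<in> V - S" "attached x" "attached y" "x \<noteq> y"
  shows "phase x * G x y * cnj (phase y) = - 1 / 3"
proof -
  define g where "g = phase x * G x y * cnj (phase y)"
  have ux: "phase x \<in> unit4" and uy: "phase y \<in> unit4" using phase(1) assms by auto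
  obtain k :: int where k: "g = - (phase x * h x y * cnj (phase y)) - 4 / 3 - of_int k"
    using G_attached[OF assms(1-4)] assms(5) unfolding g_def by force
  define e where "e = phase x * h x y * cnj (phase y)"
  have e: "e \<in> gauss_ints"
    unfolding e_def by (intro gauss_ints_mult gauss_ints_cnj h_gauss_ints unit4_gauss_ints ux uy)
  have pos: "2 / 3 > \<bar>Re (w * g)\<bar>" if w: "w \<in> unit4" for w
  proof -
    have pos1: "0 < 4 / 3 + 2 * Re (z * g)" if z: "z \<in> unit4" for z
    proof -
      have nz: "cnj (phase x) * cnj z \<noteq> 0" using unit4_nonzero ux z by simp
      have "cnj (cnj (phase x) * cnj z) * G x y * cnj (phase y) = z * g"
        by (simp add: g_def mult_ac)
      from G_pair[OF assms(1,2,5) nz this] show ?thesis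
        using unit4_norm[OF z] unit4_norm[OF ux] unit4_norm[OF uy]
        by (simp only: G_attached_self assms) (simp add: norm_mult)
    qed
    have "- w \<in> unit4" "Re (- w * g) = - Re (w * g)" using w by (simp_all add: unit4_minus)
    with pos1[OF w] pos1[of "- w"] show ?thesis by linarith
  qed
  have Re_g: "\<bar>Re g\<bar> < 2 / 3" using pos[of 1] by (simp add: unit4_def)
  have Im_g: "\<bar>Im g\<bar> < 2 / 3" using pos[of \<i>] by (simp add: unit4_def)
  obtain a b where ab: "Re e = of_int a" "Im e = of_int b"
    using e by (auto simp: gauss_ints_def elim!: Ints_cases)
  have Re: "Re g = - of_int (a + k + 1) - 1 / 3" and Im: "Im g = - of_int b"
    using k ab by (simp_all flip: e_def)
  have "a + k + 1 = 0" using Re_g unfolding Re by linarith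
  moreover have "b = 0" using Im_g unfolding Im by linarith
  ultimately show ?thesis
    using Re Im unfolding g_def[symmetric] by (simp add: complex_eq_iff)
qed

text \<open>A Gram matrix with 2/3 on the diagonal and -1/3 elsewhere is null on the all-ones vector
  of length 3.\<close>

lemma three_attached:
  assumes "x \<in> V - S" "y \<in> V - S" "z \<in> V - S" "distinct [x, y, z]"
    and "attached x" "attached y" "attached z"
  shows False
proof -
  have u: "phase w \<in> unit4" if "w \<in> V - S" for w using phase(1)[OF that] .
  have nz: "cnj (phase x) \<noteq> 0" using u[OF assms(1)] unit4_nonzero by auto
  have p: "cnj (cnj (phase a)) * G a b * cnj (phase b) = - 1 / 3"
    if "a \<in> V - S" "b \<in> V - S" "attached a" "attached b" "a \<noteq> b" for a b
    using G_attached_pair[OF that] by simp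
  have "distinct [x, y, z]" "x \<noteq> y" "x \<noteq> z" "y \<noteq> z" using assms(4) by auto
  from G_triple[OF assms(1-3) this(1) nz p[OF assms(1,2,5,6) this(2)] p[OF assms(1,3,5,7) this(3)]
      p[OF assms(2,3,6,7) this(4)]]
  show False
    using assms by (simp add: G_attached_self unit4_norm[OF u])
qed

text \<open>At coefficients 2, 1, 1 the form is \<open>2 * Re w\<close>, where \<open>w\<close> is
  the entry between \<open>y\<close> and \<open>z\<close>; this forces \<open>w = 1\<close>, and
  then 1, -1, 1 is a null vector.\<close>

lemma two_attached_neighbour:
  assumes "x \<in> V - S" "y \<in> V - S" "z \<in> V - S" "distinct [x, y, z]"
    and "attached x" "attached y" "\<not> attached z" "z \<in> nbrs x"
  shows False
proof -
  have u: "phase w \<in> unit4" if "w \<in> V - S" for w using phase(1)[OF that] .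
  have hx: "h x z * h z x = 1" "h x z \<in> unit4"
    using h_cnj_mult assms(8) h_unit by (auto simp: nbrs_def)
  have px: "phase x * cnj (phase x) = 1" using unit4_cnj_mult u assms(1) by auto
  define c where "c = cnj (phase x) * h z x"
  have c: "c \<in> unit4" unfolding c_def using u[OF assms(1)] hx(2) h_sym[of x z]
    by (metis unit4_mult unit4_cnj)
  have G1: "phase x * G x z * c = - 1"
  proof -
    have "phase x * G x z * c = - (phase x * cnj (phase x)) * (h x z * h z x)"
      using assms(4,7) by (simp add: G_not_attached c_def mult_ac)
    then show ?thesis by (simp add: px hx)
  qed
  have Gz: "G z z = 2" using assms(7) by (simp add: G_not_attached h_irrefl)
  define w where "w = phase y * G y z * c"
  have w: "w \<in> insert 0 unit4"
  proof -
    have "w = - (phase y * h y z * c)" using assms(4,7) by (auto simp: G_not_attached w_def)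
    moreover have "phase y * h y z * c \<in> insert 0 unit4"
      using h_values[of y z] by (auto intro!: unit4_mult u c assms(2))
    ultimately show ?thesis by (auto simp: unit4_minus)
  qed
  have Gxy: "phase x * G x y * cnj (phase y) = - 1 / 3" using assms by (intro G_attached_pair) auto
  have nz: "2 * cnj (phase x) \<noteq> 0" "cnj (phase x) \<noteq> 0" using u[OF assms(1)] unit4_nonzero by auto
  have norms: "norm (cnj (phase x)) = 1" "norm (2 * cnj (phase x)) = 2"
    "norm (cnj (phase y)) = 1" "norm (- cnj (phase y)) = 1" "norm c = 1"
    using unit4_norm[OF c] unit4_norm[OF u[OF assms(1)]] unit4_norm[OF u[OF assms(2)]]
    by (simp_all add: norm_mult)
  have Gs: "G x x = 2 / 3" "G y y = 2 / 3" 
    by (rule G_attached_self[OF assms(1,5)], rule G_attached_self[OF assms(2,6)])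
  have e: "cnj (2 * cnj (phase x)) * G x y * cnj (phase y) = - 2 / 3"
    "cnj (2 * cnj (phase x)) * G x z * c = - 2"
    "cnj (cnj (phase y)) * G y z * c = w"
    using Gxy G1 by (simp_all add: w_def mult.assoc)
  have "Re w > 0"
    using G_triple[OF assms(1-4) nz(1) e] unfolding norms Gs Gz by simp
  then have w1: "w = 1" using w by (auto simp: unit4_def)
  have e': "cnj (cnj (phase x)) * G x y * (- cnj (phase y)) = 1 / 3"
    "cnj (cnj (phase x)) * G x z * c = - 1"
    "cnj (- cnj (phase y)) * G y z * c = - 1"
    using Gxy G1 w1 by (simp_all add: w_def)
  show False
    using G_triple[OF assms(1-4) nz(2) e'] unfolding norms Gs Gz by simp
qed

text \<open>At coefficients 3, 1, 1 the form is \<open>2 * Re w - 2\<close>, which is not positive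
  because \<open>w\<close> is 0 or a unit.\<close>

lemma attached_two_neighbours:
  assumes "x \<in> V - S" "y \<in> V - S" "z \<in> V - S" "distinct [x, y, z]"
    and "attached x" "\<not> attached y" "\<not> attached z" "y \<in> nbrs x" "z \<in> nbrs x"
  shows False
proof -
  have u: "phase x \<in> unit4" using phase(1)[OF assms(1)] .
  have px: "phase x * cnj (phase x) = 1" using unit4_cnj_mult u by auto
  define c where "c = (\<lambda>w. cnj (phase x) * h w x)"
  have c: "c w \<in> unit4" "phase x * G x w * c w = - 1" "G w w = 2"
    if w: "w \<in> nbrs x" "\<not> attached w" "w \<noteq> x" for w
  proof -
    have hx: "h x w * h w x = 1" "h x w \<in> unit4"
      using h_cnj_mult w(1) h_unit by (auto simp: nbrs_def)
    show "c w \<in> unit4" unfolding c_def using u hx(2) h_sym[of x w]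
      by (metis unit4_mult unit4_cnj)
    have "phase x * G x w * c w = - (phase x * cnj (phase x)) * (h x w * h w x)"
      using w by (simp add: G_not_attached c_def mult_ac)
    then show "phase x * G x w * c w = - 1" by (simp add: px hx)
    show "G w w = 2" using w by (simp add: G_not_attached h_irrefl)
  qed
  have cy: "c y \<in> unit4" "phase x * G x y * c y = - 1" "G y y = 2" using c[of y] assms by auto
  have cz: "c z \<in> unit4" "phase x * G x z * c z = - 1" "G z z = 2" using c[of z] assms by auto
  define w where "w = cnj (c y) * G y z * c z"
  have w: "w \<in> insert 0 unit4"
  proof -
    have "w = - (cnj (c y) * h y z * c z)" using assms(4,7) by (auto simp: G_not_attached w_def)
    moreover have "cnj (c y) * h y z * c z \<in> insert 0 unit4"
      using h_values[of y z] by (auto intro!: unit4_mult unit4_cnj cy cz)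
    ultimately show ?thesis by (auto simp: unit4_minus)
  qed
  have nz: "3 * cnj (phase x) \<noteq> 0" using u unit4_nonzero by auto
  have norms: "norm (3 * cnj (phase x)) = 3" "norm (c y) = 1" "norm (c z) = 1"
    using unit4_norm[OF u] unit4_norm[OF cy(1)] unit4_norm[OF cz(1)] by (simp_all add: norm_mult)
  have e: "cnj (3 * cnj (phase x)) * G x y * c y = - 3" "cnj (3 * cnj (phase x)) * G x z * c z = - 3"
    using cy cz by (simp_all add: mult.assoc)
  have "Re w > 1"
    using G_triple[OF assms(1-4) nz e w_def[symmetric]] G_attached_self[OF assms(1,5)]
    unfolding norms cy cz by simp
  then show False using w by (auto simp: unit4_def)
qed

text \<open>The coefficients 3, 2, 1 give a null vector. They are the marks at the end of the long
  arm of the affine diagram of \<open>E_8\<close>.\<close>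

lemma attached_path:
  assumes "x \<in> V - S" "y \<in> V - S" "z \<in> V - S" "distinct [x, y, z]"
    and "attached x" "\<not> attached y" "\<not> attached z" "y \<in> nbrs x" "z \<in> nbrs y" "z \<notin> nbrs x"
  shows False
proof -
  have u: "phase x \<in> unit4" using phase(1)[OF assms(1)] .
  have px: "phase x * cnj (phase x) = 1" using unit4_cnj_mult u by auto
  have hx: "h x y * h y x = 1" "h y x \<in> unit4" and hy: "h y z * h z y = 1" "h z y \<in> unit4"
    using h_cnj_mult assms(8,9) h_unit h_zero_sym by (auto simp: nbrs_def)
  define c where "c = cnj (phase x) * h y x"
  define d where "d = h z y * c"
  have c: "c \<in> unit4" unfolding c_def using u hx by (intro unit4_mult unit4_cnj)
  have d: "d \<in> unit4" unfolding d_def using c hy by (intro unit4_mult)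
  have G: "G y y = 2" "G z z = 2" "G x z = 0"
    using assms by (simp_all add: G_not_attached h_irrefl nbrs_def)
  have Gxy: "phase x * G x y * c = - 1"
  proof -
    have "phase x * G x y * c = - (phase x * cnj (phase x)) * (h x y * h y x)"
      using assms by (simp add: G_not_attached c_def mult_ac)
    then show ?thesis by (simp add: px hx)
  qed
  have Gyz: "cnj c * G y z * d = - 1"
  proof -
    have "cnj c * G y z * d = - (cnj c * c) * (h y z * h z y)"
      using assms by (simp add: G_not_attached d_def mult_ac)
    then show ?thesis using unit4_cnj_mult[OF c] by (simp add: hy)
  qed
  have nz: "3 * cnj (phase x) \<noteq> 0" using u unit4_nonzero by auto
  have norms: "norm (3 * cnj (phase x)) = 3" "norm (2 * c) = 2" "norm d = 1"
    using unit4_norm[OF u] unit4_norm[OF c] unit4_norm[OF d] by (simp_all add: norm_mult)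
  have "cnj (3 * cnj (phase x)) * G x y * (2 * c) = 6 * (phase x * G x y * c)"
    "cnj (2 * c) * G y z * d = 2 * (cnj c * G y z * d)"
    by (simp_all add: mult_ac)
  then have e: "cnj (3 * cnj (phase x)) * G x y * (2 * c) = - 6"
    "cnj (3 * cnj (phase x)) * G x z * d = 0" "cnj (2 * c) * G y z * d = - 2"
    using G by (simp_all add: Gxy Gyz)
  show False
    using G_triple[OF assms(1-4) nz e] G_attached_self[OF assms(1,5)]
    unfolding norms G by simp
qed

text \<open>If no edge left \<open>S\<close>, a column of \<open>N\<close> would be mapped by
  \<open>2 - H\<close> to a multiple of 3 without being one itself: the discriminant of
  \<open>E_6\<close> would divide the determinant.\<close>

lemma not_adj_closed_S: "\<not> adj_closed S"
proof
  assume cl: "adj_closed S"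
  obtain i j where ij: "i < 6" "j < 6" "\<not> 3 dvd N i j" using N_not3 by blast
  define f where "f = comb (\<lambda>i. of_int (N i j))"
  define w where "w = comb (\<lambda>i. of_bool (i = j))"
  have comb_gauss: "comb c x \<in> gauss_ints" if "\<And>i. c i \<in> gauss_ints" for c x
    unfolding comb_def using that unit4_gauss_ints[OF sg_unit]
    by (intro gauss_ints_sum) auto
  have "2 * f x - H f x = 3 * w x" if x: "x \<in> V" for x
  proof (cases "x \<in> S")
    case True
    then obtain k where k: "k < 6" "x = s k" by (auto simp: S_def)
    have "cnj (sg k) * L f (s k) = 2 * of_int (N k j) - (\<Sum>l<6. of_int (A k l) * of_int (N l j))"
      unfolding f_def by (rule L_comb[OF k(1)])
    also have "\<dots> = of_int (2 * N k j - (\<Sum>l<6. A k l * N l j))" by simp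
    also have "\<dots> = 3 * of_bool (k = j)" by (simp only: inv[OF k(1) ij(2)]) simp
    finally have "sg k * (cnj (sg k) * L f (s k)) = sg k * (3 * of_bool (k = j))" by simp
    moreover have "sg k * (cnj (sg k) * L f (s k)) = (sg k * cnj (sg k)) * L f (s k)"
      by (rule mult.assoc[symmetric])
    ultimately have "L f (s k) = 3 * (of_bool (k = j) * sg k)"
      using unit4_cnj_mult(2)[OF sg_unit[OF k(1)]] by simp
    then show ?thesis using k by (simp add: L_def w_def comb_s)
  next
    case False
    have "H f x = 0"
      unfolding H_nbrs
    proof (rule sum.neutral, rule ballI)
      fix y assume "y \<in> nbrs x"
      then have "y \<notin> S" using False cl nbrs_sym[of y x] by (auto simp: adj_closed_def)
      then show "h x y * f y = 0" by (simp add: f_def comb_outside)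
    qed
    then show ?thesis using False by (simp add: f_def w_def comb_outside)
  qed
  then have "f (s i) / 3 \<in> gauss_ints"
    using s_V[OF ij(1)] by (intro no_det3[of f w]) (auto simp: f_def w_def intro!: comb_gauss)
  then have "cnj (sg i) * (f (s i) / 3) \<in> gauss_ints"
    using unit4_gauss_ints[OF sg_unit[OF ij(1)]] by (intro gauss_ints_mult gauss_ints_cnj)
  also have "cnj (sg i) * (f (s i) / 3) = (cnj (sg i) * sg i) * of_int (N i j) / 3"
    using ij by (simp add: f_def comb_s)
  also have "\<dots> = of_int (N i j) / 3" using unit4_cnj_mult sg_unit ij(1) by simp
  finally obtain k where "real_of_int (N i j) / 3 = of_int k"
    by (auto simp: gauss_ints_def elim!: Ints_cases)
  then have "real_of_int (N i j) = of_int (3 * k)" by simp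
  then have "N i j = 3 * k" by (simp only: of_int_eq_iff)
  then show False using ij(3) by simp
qed

text \<open>Some vertex is attached since \<open>S\<close> is not closed. If two are, they have no
  neighbours beyond; if only one is, it is continued by at most one further vertex. So one or two
  vertices are added to the six.\<close>

lemma component_card:
  assumes "component K" "S \<subseteq> K"
  shows "card K = 7 \<or> card K = 8"
proof -
  have cl: "adj_closed K" and min: "\<And>A. A \<subseteq> K \<Longrightarrow> A \<noteq> {} \<Longrightarrow> adj_closed A \<Longrightarrow> A = K"
    using assms(1) by (auto simp: component_def)
  have KV: "K \<subseteq> V" using cl by (simp add: adj_closed_def)
  have finS: "finite S" by (simp add: S_def)
  have Sne: "S \<noteq> {}" using card_S by auto
  have att: "attached y \<longleftrightarrow> nbrs y \<inter> S \<noteq> {}" for y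
    using h_zero_sym by (auto simp: attached_def nbrs_def S_def)
  have closedI: "adj_closed (S \<union> B)" if "B \<subseteq> K" "\<And>y. y \<in> K - S \<Longrightarrow> attached y \<Longrightarrow> y \<in> B"
    "\<And>x y. x \<in> B \<Longrightarrow> y \<in> nbrs x \<Longrightarrow> y \<in> K - S \<Longrightarrow> y \<in> B" for B
    unfolding adj_closed_def
  proof (intro conjI ballI subsetI)
    show "y \<in> V" if "y \<in> S \<union> B" for y using that \<open>B \<subseteq> K\<close> assms(2) KV by blast
    fix x y assume x: "x \<in> S \<union> B" and y: "y \<in> nbrs x"
    have yK: "y \<in> K" using x y \<open>B \<subseteq> K\<close> assms(2) cl by (auto simp: adj_closed_def)
    show "y \<in> S \<union> B"
    proof (cases "x \<in> S")
      case True
      then have "attached y" using y nbrs_sym att by blast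
      then show ?thesis using that(2) yK by blast
    next
      case False
      then show ?thesis using that(3)[of x y] x y yK by blast
    qed
  qed
  have "\<exists>x\<in>K - S. attached x"
  proof (rule ccontr)
    assume "\<not> ?thesis"
    then have "adj_closed (S \<union> {})" by (intro closedI) auto
    then show False using not_adj_closed_S by simp
  qed
  then obtain x where x: "x \<in> K - S" "attached x" by blast
  show ?thesis
  proof (cases "\<exists>y\<in>K - S. attached y \<and> y \<noteq> x")
    case True
    then obtain y where y: "y \<in> K - S" "attached y" "y \<noteq> x" by blast
    have only: "z \<in> {x, y}" if "z \<in> K - S" "attached z" for z
      using three_attached[of x y z] x y that KV by auto
    have "adj_closed (S \<union> {x, y})"
    proof (rule closedI)
      fix u z assume u: "u \<in> {x, y}" and z: "z \<in> nbrs u" "z \<in> K - S"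
      show "z \<in> {x, y}"
      proof (rule ccontr)
        assume nz: "z \<notin> {x, y}"
        then have "\<not> attached z" using only z by blast
        then show False
          using two_attached_neighbour[of x y z] two_attached_neighbour[of y x z] u z x y nz KV by auto
      qed
    qed (use x y only in auto)
    then have "K = S \<union> {x, y}" using min[of "S \<union> {x, y}"] x y assms(2) by auto
    then have "card K = card S + card {x, y}"
      using finS x y by (simp only:) (rule card_Un_disjoint, auto)
    then show ?thesis using card_S y(3) by simp
  next
    case False
    then have only: "z = x" if "z \<in> K - S" "attached z" for z using that by blast
    show ?thesis
    proof (cases "\<exists>y\<in>K - S. y \<in> nbrs x")
      case True
      then obtain y where y: "y \<in> K - S" "y \<in> nbrs x" by blast
      have xy: "y \<noteq> x" using y nbrs_irrefl by auto
      have na: "\<not> attached y" using only y xy by blast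
      have nbx: "z = y" if "z \<in> nbrs x" "z \<in> K - S" for z
      proof (rule ccontr)
        assume "z \<noteq> y"
        moreover have "z \<noteq> x" using that nbrs_irrefl by auto
        moreover have "\<not> attached z" using only that \<open>z \<noteq> x\<close> by blast
        ultimately show False
          using attached_two_neighbours[of x y z] x y that na xy KV by auto
      qed
      have "adj_closed (S \<union> {x, y})"
      proof (rule closedI)
        show "z \<in> {x, y}" if "z \<in> K - S" "attached z" for z using only[OF that] by simp
        fix u z assume u: "u \<in> {x, y}" and z: "z \<in> nbrs u" "z \<in> K - S"
        show "z \<in> {x, y}"
        proof (cases "u = x")
          case True then show ?thesis using nbx z by blast
        next
          case False
          then have zy: "z \<in> nbrs y" using u z by auto
          show ?thesis
          proof (rule ccontr)
            assume nz: "z \<notin> {x, y}"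
            then have "\<not> attached z" "z \<notin> nbrs x" using only nbx z by blast+
            then show False
              using attached_path[of x y z] x y z zy nz na xy KV by auto
          qed
        qed
      qed (use x y in auto)
      then have "K = S \<union> {x, y}" using min[of "S \<union> {x, y}"] x y assms(2) by auto
      then have "card K = card S + card {x, y}"
        using finS x y by (simp only:) (rule card_Un_disjoint, auto)
      then show ?thesis using card_S xy by simp
    next
      case False
      have "adj_closed (S \<union> {x})"
      proof (rule closedI)
        show "z \<in> {x}" if "z \<in> K - S" "attached z" for z using only[OF that] by simp
      qed (use x False in auto)
      then have "K = S \<union> {x}" using min[of "S \<union> {x}"] x assms(2) by auto
      then have "card K = card S + card {x}"
        using finS x by (simp only:) (rule card_Un_disjoint, auto)
      then show ?thesis using card_S by simp
    qed
  qed
qed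

end

section \<open>Connected components\<close>

lemma all_less_6: "(\<forall>i<(6::nat). P i) \<longleftrightarrow> P 0 \<and> P 1 \<and> P 2 \<and> P 3 \<and> P 4 \<and> P 5"
  by (auto simp: numeral_eq_Suc All_less_Suc)

lemma sum_less_6: "(\<Sum>i<(6::nat). f i) = f 0 + f 1 + f 2 + f 3 + f 4 + (f 5 :: 'a :: comm_monoid_add)"
  by (simp add: numeral_eq_Suc)

section \<open>Gains along paths and the three forms of \<open>E_6\<close>\<close>

lemma unit_path:
  fixes p r :: "'a :: comm_ring_1"
  assumes "p * p' = 1" "r * r' = 1"
  shows "p * r * (r' * p') = 1"
proof -
  have "p * r * (r' * p') = (p * p') * (r * r')" by (simp add: mult_ac)
  then show ?thesis by (simp add: assms)
qed

lemma neg_path: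
  fixes p q r s :: "'a :: comm_ring_1"
  assumes "p * q + r * s = 0" "r * r' = 1" "s * s' = 1"
  shows "(q * p) * s' * r' = - 1"
proof -
  have "(q * p) * s' * r' = (p * q + r * s) * s' * r' - (r * r') * (s * s')" by (simp add: algebra_simps)
  then show ?thesis by (simp add: assms)
qed

lemma neg_path':
  fixes p q r s :: "'a :: comm_ring_1"
  assumes "p * q + r * s = 0" "p * p' = 1" "q * q' = 1"
  shows "r * s * (q' * p') = - 1"
proof -
  have "r * s * (q' * p') = (p * q + r * s) * (q' * p') - (p * p') * (q * q')" by (simp add: algebra_simps)
  then show ?thesis by (simp add: assms)
qed

lemma neg_inverse:
  fixes p q r s :: "'a :: comm_ring_1"
  assumes "p * q + r * s = 0" "p * p' = 1" "q * q' = 1" "r * r' = 1"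
  shows "r' + s * (p' * q') = 0"
proof -
  have "r' + s * (p' * q') = (p * q + r * s) * (r' * p' * q') + r' * (1 - (p * p') * (q * q'))
      + s * p' * q' * (1 - r * r')" by (simp add: algebra_simps)
  then show ?thesis by (simp add: assms)
qed

text \<open>A finite certificate for the hypotheses of \<open>e6_graph\<close>. Its last clause is a
  witness that \<open>N\<close> is not divisible by 3.\<close>

definition e6_data :: "int list list \<Rightarrow> int list list \<Rightarrow> int list list \<Rightarrow> int list \<Rightarrow> bool" where
  "e6_data A N N' v \<longleftrightarrow>
     (\<forall>i<6. \<forall>j<6. A ! i ! j = A ! j ! i \<and> N ! i ! j = N ! j ! i \<and>
        2 * N ! i ! j - (\<Sum>k<6. A ! i ! k * N ! k ! j) = (if i = j then 3 else 0) \<and>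
        N ! i ! j = 4 * v ! i * v ! j + 3 * N' ! i ! j) \<and>
     (\<forall>i<6. A ! i ! i = 0 \<and> even (N' ! i ! i)) \<and> N ! 2 ! 3 mod 3 \<noteq> 0"

text \<open>The Dynkin diagram itself: branch vertex 0 with arms 1, 2-3 and 4-5.\<close>

definition e6_tree :: "int list list" where
  "e6_tree = [[0, 1, 1, 0, 1, 0], [1, 0, 0, 0, 0, 0], [1, 0, 0, 1, 0, 0],
              [0, 0, 1, 0, 0, 0], [1, 0, 0, 0, 0, 1], [0, 0, 0, 0, 1, 0]]"

text \<open>The 4-cycle 0-1-2-3 with its sign on the edge 2-3, and pendant vertices at the
  consecutive vertices 0 and 1.\<close>

definition e6_quad :: "int list list" where
  "e6_quad = [[0, 1, 0, 1, 1, 0], [1, 0, 1, 0, 0, 1], [0, 1, 0, -1, 0, 0],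
              [1, 0, -1, 0, 0, 0], [1, 0, 0, 0, 0, 0], [0, 1, 0, 0, 0, 0]]"

text \<open>The previous configuration with its pendant vertices joined: two negative 4-cycles
  sharing the edge 0-1.\<close>

definition e6_ladder :: "int list list" where
  "e6_ladder = [[0, 1, 0, 1, 1, 0], [1, 0, 1, 0, 0, 1], [0, 1, 0, -1, 0, 0],
                [1, 0, -1, 0, 0, 0], [1, 0, 0, 0, 0, -1], [0, 1, 0, 0, -1, 0]]"

text \<open>The first table is 3 times the inverse of \<open>2 I - A\<close>. Modulo 3 it has rank
  one, which the vector of signs records; the second table is the even remainder.\<close>

lemma e6_data_tree:
  "e6_data e6_tree
    [[18, 9, 12, 6, 12, 6], [9, 6, 6, 3, 6, 3], [12, 6, 10, 5, 8, 4],
     [6, 3, 5, 4, 4, 2], [12, 6, 8, 4, 10, 5], [6, 3, 4, 2, 5, 4]]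
    [[6, 3, 4, 2, 4, 2], [3, 2, 2, 1, 2, 1], [4, 2, 2, 3, 4, 0],
     [2, 1, 3, 0, 0, 2], [4, 2, 4, 0, 2, 3], [2, 1, 0, 2, 3, 0]]
    [0, 0, 1, -1, -1, 1]"
  unfolding e6_data_def e6_tree_def all_less_6 sum_less_6 by simp

lemma e6_data_quad:
  "e6_data e6_quad
    [[10, 8, 2, 4, 5, 4], [8, 10, 4, 2, 4, 5], [2, 4, 4, -1, 1, 2],
     [4, 2, -1, 4, 2, 1], [5, 4, 1, 2, 4, 2], [4, 5, 2, 1, 2, 4]]
    [[2, 4, 2, 0, 3, 0], [4, 2, 0, 2, 0, 3], [2, 0, 0, 1, -1, 2],
     [0, 2, 1, 0, 2, -1], [3, 0, -1, 2, 0, 2], [0, 3, 2, -1, 2, 0]]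
    [1, -1, -1, 1, -1, 1]"
  unfolding e6_data_def e6_quad_def all_less_6 sum_less_6 by simp

lemma e6_data_ladder:
  "e6_data e6_ladder
    [[6, 3, 0, 3, 3, 0], [3, 6, 3, 0, 0, 3], [0, 3, 4, -2, -1, 2],
     [3, 0, -2, 4, 2, -1], [3, 0, -1, 2, 4, -2], [0, 3, 2, -1, -2, 4]]
    [[2, 1, 0, 1, 1, 0], [1, 2, 1, 0, 0, 1], [0, 1, 0, -2, 1, 2],
     [1, 0, -2, 0, 2, 1], [1, 0, 1, 2, 0, -2], [0, 1, 2, 1, -2, 0]]
    [0, 0, 1, 1, -1, -1]"
  unfolding e6_data_def e6_ladder_def all_less_6 sum_less_6 by simp

context spectral_graph
begin

lemma component_card_e6:
  assumes "e6_data A N N' v" "component K" "set ss \<subseteq> K" "distinct ss"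
    "length ss = 6" "length sg = 6" "set sg \<subseteq> unit4"
    and gram: "\<forall>i<6. \<forall>j<6. i < j \<longrightarrow> cnj (sg ! i) * h (ss ! i) (ss ! j) * sg ! j = of_int (A ! i ! j)"
  shows "card K = 7 \<or> card K = 8"
proof -
  have KV: "K \<subseteq> V" using assms(2) by (simp add: component_def adj_closed_def)
  have sgu: "sg ! i \<in> unit4" if "i < 6" for i using assms(6,7) that nth_mem by fastforce
  interpret e6: e6_graph V h m phi "\<lambda>i. ss ! i" "\<lambda>i. sg ! i" "\<lambda>i j. A ! i ! j" "\<lambda>i j. N ! i ! j"
    "\<lambda>i j. N' ! i ! j" "\<lambda>i. v ! i"
  proof unfold_locales
    show "inj_on ((!) ss) {..<6}" using assms(4,5) by (simp add: inj_on_nth)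
    fix i :: nat assume i: "i < 6"
    show "ss ! i \<in> V" using assms(3,5) KV i nth_mem by fastforce
    show "sg ! i \<in> unit4" by (rule sgu[OF i])
    show "even (N' ! i ! i)" using assms(1) i by (simp add: e6_data_def)
    fix j :: nat assume j: "j < 6"
    show "cnj (sg ! i) * h (ss ! i) (ss ! j) * sg ! j = of_int (A ! i ! j)"
    proof (cases i j rule: linorder_cases)
      case less then show ?thesis using gram i j by blast
    next
      case equal then show ?thesis using assms(1) i by (simp add: e6_data_def h_irrefl)
    next
      case greater
      then have "cnj (cnj (sg ! j) * h (ss ! j) (ss ! i) * sg ! i) = cnj (of_int (A ! j ! i))"
        using gram i j by metis
      then show ?thesis using assms(1) i j by (simp add: e6_data_def h_sym mult_ac)
    qed
    show "2 * N ! i ! j - (\<Sum>k<6. A ! i ! k * N ! k ! j) = (if i = j then 3 else 0)"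
      "N ! i ! j = N ! j ! i" "N ! i ! j = 4 * v ! i * v ! j + 3 * N' ! i ! j"
      using assms(1) i j unfolding e6_data_def by blast+
  next
    have "N ! 2 ! 3 mod 3 \<noteq> 0" using assms(1) unfolding e6_data_def by (elim conjE)
    then have "\<not> 3 dvd N ! 2 ! 3" by (simp add: dvd_eq_mod_eq_0)
    then show "\<exists>i<6. \<exists>j<6. \<not> 3 dvd N ! i ! j" by (intro exI[of _ 2] exI[of _ 3] conjI) simp_all
  qed
  have "e6.S \<subseteq> K" using assms(3,5) nth_mem by (fastforce simp: e6.S_def)
  then show ?thesis by (rule e6.component_card[OF assms(2)])
qed

section \<open>Configurations excluded by the determinant\<close>

lemma ip_two_points:
  assumes "a \<in> V" "c \<in> V" "a \<noteq> c" "\<And>x. x \<noteq> a \<Longrightarrow> x \<noteq> c \<Longrightarrow> v x = 0"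
  shows "ip v w = cnj (v a) * w a + cnj (v c) * w c"
proof -
  have "ip v w = (\<Sum>x\<in>{a, c}. cnj (v x) * w x)"
    unfolding ip_def by (rule sum.mono_neutral_right) (use assms finV in auto)
  then show ?thesis using assms(3) by simp
qed

lemma H_two_points:
  assumes "a \<in> V" "c \<in> V" "a \<noteq> c" "\<And>x. x \<noteq> a \<Longrightarrow> x \<noteq> c \<Longrightarrow> v x = 0"
  shows "H v x = h x a * v a + h x c * v c"
proof -
  have "H v x = (\<Sum>y\<in>{a, c}. h x y * v y)"
    unfolding H_def by (rule sum.mono_neutral_right) (use assms finV in auto)
  then show ?thesis using assms(3) by simp
qed

text \<open>The switched difference of the two leaves is annihilated by \<open>H\<close>, so
  \<open>2 - H\<close> doubles it, and its norm is 2: exactly the situation that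
  \<open>no_det4\<close> forbids.\<close>

lemma no_twin_leaves:
  assumes "x \<noteq> z" "nbrs x = {y}" "nbrs z = {y}"
  shows False
proof -
  have V: "x \<in> V" "z \<in> V" using assms deg_in_V[of x] deg_in_V[of z] by (auto simp: deg_def)
  have n: "y \<in> nbrs x" "y \<in> nbrs z" "x \<in> nbrs y" using assms nbrs_sym by auto
  have u: "h x y * h y x = 1" "h z y * h y z = 1" "h y x \<in> unit4" "h z y \<in> unit4"
    using h_cnj_mult[OF n(1)] h_cnj_mult[OF n(2)] h_unit n by (simp_all add: nbrs_def)
  define k where "k = h y x * h z y"
  have k: "k \<in> unit4" unfolding k_def using u by (intro unit4_mult)
  define v where "v = (\<lambda>t. if t = x then 1 else if t = z then - k else 0)"
  have g: "v t \<in> gauss_ints" for t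
    using unit4_gauss_ints[OF k] by (auto simp: v_def)
  have Hv: "H v t = 0" for t
  proof -
    have "H v t = h t x * 1 + h t z * (- k)"
      using V assms(1) by (subst H_two_points[of x z]) (auto simp: v_def)
    also have "\<dots> = 0"
    proof (cases "t = y")
      case True
      have "h y z * k = h y x * (h z y * h y z)" by (simp add: k_def mult_ac)
      then show ?thesis using True by (simp add: u)
    next
      case False
      then have "t \<notin> nbrs x" "t \<notin> nbrs z" using assms by auto
      then show ?thesis using h_zero_sym by (simp add: nbrs_def)
    qed
    finally show ?thesis .
  qed
  have "ip v v = 1 + cnj k * k"
    using V assms(1) by (subst ip_two_points[of x z]) (auto simp: v_def)
  then have "ip v v / 2 \<in> gauss_ints" using unit4_cnj_mult[OF k] by simp
  then have "v x \<notin> unit4"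
    using V by (intro no_det4[of v v]) (auto simp: g Hv)
  then show False by (simp add: v_def unit4_def)
qed

text \<open>Otherwise \<open>a\<close> and \<open>c\<close> have only the neighbours
  \<open>b\<close> and \<open>d\<close>. With the right relative phase their contributions double at
  \<open>b\<close> and, the cycle being negative, cancel at \<open>d\<close>. So
  \<open>2 - H\<close> maps \<open>v\<close> to \<open>2 * w\<close> with \<open>ip v w = 2\<close>,
  against \<open>no_det4\<close>.\<close>

lemma neg_quad_deg3:
  assumes "neg_quad a b c d"
  shows "deg a = 3 \<or> deg c = 3"
proof (rule ccontr)
  assume *: "\<not> ?thesis"
  have q: "b \<in> nbrs a" "d \<in> nbrs a" "b \<in> nbrs c" "d \<in> nbrs c" "a \<noteq> c" "b \<noteq> d"
    and neg: "h a b * h b c + h a d * h d c = 0"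
    using assms by (auto simp: neg_quad_def)
  have V: "a \<in> V" "c \<in> V" using neg_quad_V[OF assms] by auto
  have dist: "distinct [a, b, c, d]" by (rule neg_quad_distinct[OF assms])
  have "card {b, d} \<le> deg a" "card {b, d} \<le> deg c"
    unfolding deg_def by (rule card_mono[OF fin_nbrs], use q in simp)+
  then have deg: "deg a = 2" "deg c = 2"
    using * deg_le_3[of a] deg_le_3[of c] q(6) by auto
  have n: "nbrs a = {b, d}" "nbrs c = {b, d}"
    using q deg by (auto intro!: nbrs_eqI)
  have u: "h a b * h b a = 1" "h b c * h c b = 1" "h a d * h d a = 1" "h d c * h c d = 1"
    "h b a \<in> unit4" "h c b \<in> unit4"
    using h_cnj_mult[of b a] h_cnj_mult[of d a] h_cnj_mult[of b c] h_cnj_mult[of d c] q h_unit h_zero_sym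
    by (auto simp: nbrs_def mult.commute)
  define k where "k = h b a * h c b"
  have k: "k \<in> unit4" unfolding k_def using u by (intro unit4_mult)
  define v where "v = (\<lambda>t. if t = a then 1 else if t = c then k else 0)"
  define w where "w = (\<lambda>t. v t - (if t = b then h b a else 0))"
  have g: "v t \<in> gauss_ints" for t
    using unit4_gauss_ints[OF k] by (auto simp: v_def)
  have gw: "w t \<in> gauss_ints" for t
    unfolding w_def using g h_gauss_ints by (intro gauss_ints_diff) auto
  have Hv: "H v t = (if t = b then 2 * h b a else 0)" for t
  proof -
    have Ht: "H v t = h t a + h t c * k"
      using V q(5) by (subst H_two_points[of a c]) (auto simp: v_def)
    consider "t = b" | "t = d" "t \<noteq> b" | "t \<noteq> b" "t \<noteq> d" by blast
    then show ?thesis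
    proof cases
      case 1
      have "h b c * k = h b a * (h b c * h c b)" by (simp add: k_def mult_ac)
      then show ?thesis unfolding Ht using 1 u by simp
    next
      case 2
      have "h d a + h d c * k = 0"
        unfolding k_def by (rule neg_inverse[OF neg u(1,2,3)])
      then show ?thesis unfolding Ht using 2 by simp
    next
      case 3
      then have "t \<notin> nbrs a" "t \<notin> nbrs c" using n by auto
      then have "h t a = 0" "h t c = 0" using nbrs_sym by (auto simp: nbrs_def)
      then show ?thesis using 3 by (simp add: Ht)
    qed
  qed
  have "ip v w = 1 + cnj k * k"
    using V q(5) dist by (subst ip_two_points[of a c]) (auto simp: v_def w_def)
  then have "ip v w / 2 \<in> gauss_ints" using unit4_cnj_mult[OF k] by simp
  moreover have "2 * v t - H v t = 2 * w t" for t
    by (simp add: Hv w_def right_diff_distrib)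
  ultimately have "v a \<notin> unit4"
    using V by (intro no_det4[of v w] g gw) auto
  then show False by (simp add: v_def unit4_def)
qed

text \<open>Each diagonal has an end of degree 3, so two consecutive vertices of the cycle have
  degree 3. Their neighbours off the cycle complete it to \<open>e6_quad\<close> or, if adjacent to
  each other, to \<open>e6_ladder\<close>.\<close>

lemma neg_quad_card:
  assumes "component K" "a \<in> K" "neg_quad a b c d"
  shows "card K = 7 \<or> card K = 8"
proof -
  have cl: "\<And>x y. x \<in> K \<Longrightarrow> y \<in> nbrs x \<Longrightarrow> y \<in> K"
    using assms(1) by (auto simp: component_def adj_closed_def)
  have main: "card K = 7 \<or> card K = 8"
    if "neg_quad a b c d" "a \<in> K" "deg a = 3" "deg b = 3" for a b c d
  proof -
    note Q = that(1)
    have q: "b \<in> nbrs a" "d \<in> nbrs a" "b \<in> nbrs c" "d \<in> nbrs c"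
      "a \<in> nbrs b" "a \<in> nbrs d" "c \<in> nbrs b" "c \<in> nbrs d"
      using Q nbrs_sym by (auto simp: neg_quad_def)
    have neg: "h a b * h b c + h a d * h d c = 0" using Q by (simp add: neg_quad_def)
    have dist: "distinct [a, b, c, d]" by (rule neg_quad_distinct[OF Q])
    have nc: "c \<notin> nbrs a" "d \<notin> nbrs b" "a \<notin> nbrs c"
      using neg_quad_no_chord[OF Q] neg_quad_no_chord[OF neg_quad_rotate[OF Q]] nbrs_sym by auto
    have "\<exists>e. e \<in> nbrs a \<and> e \<notin> {b, d}"
    proof (rule ccontr)
      assume "\<not> ?thesis"
      then have "nbrs a \<subseteq> {b, d}" by blast
      then have "deg a \<le> card {b, d}" unfolding deg_def by (intro card_mono) auto
      then show False using that(3) dist by simp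
    qed
    then obtain e where e: "e \<in> nbrs a" "e \<notin> {b, d}" by blast
    have "\<exists>f. f \<in> nbrs b \<and> f \<notin> {a, c}"
    proof (rule ccontr)
      assume "\<not> ?thesis"
      then have "nbrs b \<subseteq> {a, c}" by blast
      then have "deg b \<le> card {a, c}" unfolding deg_def by (intro card_mono) auto
      then show False using that(4) dist by simp
    qed
    then obtain f where f: "f \<in> nbrs b" "f \<notin> {a, c}" by blast
    have eo: "e \<notin> {a, b, c, d}" using e nc nbrs_irrefl[of a] by auto
    have fo: "f \<notin> {b, c, d, a}" using f nc nbrs_irrefl[of b] by auto
    have e': "e \<notin> nbrs b" "e \<notin> nbrs c" "e \<notin> nbrs d"
      using neg_quad_outside[OF Q eo e(1)] by auto
    have f': "f \<notin> nbrs a" "f \<notin> nbrs c" "f \<notin> nbrs d"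
      using neg_quad_outside[OF neg_quad_rotate[OF Q] fo f(1)] by auto
    have ef: "e \<noteq> f" using e f' by auto
    have z: "h a c = 0" "h b d = 0" "h b e = 0" "h c e = 0" "h d e = 0"
      "h a f = 0" "h c f = 0" "h d f = 0"
      using nc e' f' h_zero_sym by (auto simp: nbrs_def)
    have u: "h a b * h b a = 1" "h b c * h c b = 1" "h a d * h d a = 1" "h d c * h c d = 1"
      "h a e * h e a = 1" "h b f * h f b = 1"
      using h_cnj_mult[of b a] h_cnj_mult[of d a] h_cnj_mult[of b c] h_cnj_mult[of d c]
        h_cnj_mult[of e a] h_cnj_mult[of f b] q e f
      by (auto simp: mult.commute)
    have units: "h b a \<in> unit4" "h c b \<in> unit4" "h d a \<in> unit4" "h e a \<in> unit4" "h f b \<in> unit4"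
      using q e f h_unit h_zero_sym by (auto simp: nbrs_def)
    let ?ss = "[a, b, c, d, e, f]"
    \<comment> \<open>Each sign is the product of the gains along a path back to \<open>a\<close>.
      This turns a spanning tree into edges of gain 1, and the edge between \<open>c\<close> and
      \<open>d\<close> then carries the weight -1.\<close>
    let ?sg = "[1, h b a, h c b * h b a, h d a, h e a, h f b * h b a]"
    have K: "set ?ss \<subseteq> K" using that(2) cl q e f by auto
    have dss: "distinct ?ss" using dist eo fo ef by auto
    have su: "set ?sg \<subseteq> unit4" using units by (auto intro!: unit4_mult) (simp add: unit4_def)
    have common: "cnj 1 * h a b * h b a = 1"
      "cnj 1 * h a d * h d a = 1"
      "cnj 1 * h a e * h e a = 1"
      "cnj (h b a) * h b c * (h c b * h b a) = 1"
      "cnj (h c b * h b a) * h c d * h d a = - 1"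
      "cnj (h b a) * h b f * (h f b * h b a) = 1"
    proof -
      show "cnj 1 * h a b * h b a = 1" "cnj 1 * h a d * h d a = 1" "cnj 1 * h a e * h e a = 1"
        using u by simp_all
      show "cnj (h b a) * h b c * (h c b * h b a) = 1"
        unfolding h_sym by (rule unit_path[OF u(1,2)])
      show "cnj (h b a) * h b f * (h f b * h b a) = 1"
        unfolding h_sym by (rule unit_path[OF u(1,6)])
      show "cnj (h c b * h b a) * h c d * h d a = - 1"
        unfolding complex_cnj_mult h_sym by (rule neg_path[OF neg u(3,4)])
    qed
    show ?thesis
    proof (cases "f \<in> nbrs e")
      case False
      then have "h e f = 0" by (simp add: nbrs_def)
      then show ?thesis
        by (intro component_card_e6[OF e6_data_quad assms(1) K dss _ _ su])
          (use z common in \<open>simp_all add: all_less_6 e6_quad_def\<close>)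
    next
      case True
      have na: "nbrs a = {b, d, e}"
        using q e dist eo that(3) by (auto intro!: nbrs_eqI)
      have fb: "b \<in> nbrs f" "e \<in> nbrs f" using f True nbrs_sym by auto
      have "d \<notin> nbrs f" using f' nbrs_sym by blast
      then have com: "nbrs a \<inter> nbrs f = {b, e}" using na fb by auto
      have be: "b \<noteq> e" using eo by auto
      define p r where "p = h a b * h b f" and "r = h a e * h e f"
      have H2: "H2 a f = p + r" using H2_doubleton[OF com be] by (simp add: p_def r_def)
      have pr: "p \<in> unit4" "r \<in> unit4"
        unfolding p_def r_def using q e f True h_unit by (auto simp: nbrs_def intro!: unit4_mult)
      have "card {b, e} \<le> deg f"
        unfolding deg_def using fb by (intro card_mono fin_nbrs) auto
      \<comment> \<open>A sum of two units has squared norm 0, 2 or 4. The minor at \<open>a\<close>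
        and \<open>f\<close> leaves 0, so the second 4-cycle is negative too.\<close>
      then have "(norm (p + r))\<^sup>2 < 2"
        using H2_pair_less[of a f] deg_in_V[of a] deg_in_V[of f] that(3) be fo by (auto simp: H2)
      moreover have "(norm (p + r))\<^sup>2 = 4" if "p = r"
        using that unit4_norm[OF pr(1)] by (simp add: norm_mult power_mult_distrib flip: mult_2)
      ultimately have "p + r = 0" using unit4_sum2_cases[OF pr] by fastforce
      then have neg2: "h a b * h b f + h a e * h e f = 0" by (simp add: p_def r_def)
      have lad: "cnj (h e a) * h e f * (h f b * h b a) = - 1"
        unfolding h_sym by (rule neg_path'[OF neg2 u(1,6)])
      show ?thesis
        by (intro component_card_e6[OF e6_data_ladder assms(1) K dss _ _ su])
          (use z common lad in \<open>simp_all add: all_less_6 e6_ladder_def\<close>)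
    qed
  qed
  have q: "b \<in> nbrs a" "d \<in> nbrs a" "c \<in> nbrs b"
    using assms(3) nbrs_sym by (auto simp: neg_quad_def)
  have K: "b \<in> K" "c \<in> K" "d \<in> K" using cl assms(2) q by blast+
  have Q1: "neg_quad a b c d" "neg_quad a d c b" using assms(3) neg_quad_reflect by blast+
  then have Q2: "neg_quad c d a b" "neg_quad c b a d"
    using neg_quad_rotate neg_quad_reflect by blast+
  have "deg b = 3 \<or> deg d = 3" using neg_quad_deg3[OF neg_quad_rotate[OF assms(3)]] .
  moreover have "deg a = 3 \<or> deg c = 3" using neg_quad_deg3[OF assms(3)] .
  ultimately show ?thesis
    using main[OF Q1(1) assms(2)] main[OF Q1(2) assms(2)] main[OF Q2(1) K(2)] main[OF Q2(2) K(2)] by blast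
qed

section \<open>Edge counts and trees\<close>

definition edge_sum :: "nat set \<Rightarrow> nat" where
  "edge_sum A = (\<Sum>x\<in>A. card (nbrs x \<inter> A))"

text \<open>Every edge is counted twice in \<open>edge_sum\<close>. An edge leaves each proper
  nonempty subset of a component, and adjoining its far end adds one vertex and at least one edge,
  so edges minus vertices never decreases on the way to \<open>K\<close>.\<close>

lemma edge_sum_growth:
  assumes "component K" "A \<subseteq> K" "A \<noteq> {}"
  shows "edge_sum A + 2 * card K \<le> edge_sum K + 2 * card A"
  using assms(2,3)
proof (induction "card (K - A)" arbitrary: A rule: less_induct)
  case less
  have K: "K \<subseteq> V" "adj_closed K" and min: "\<And>A. A \<subseteq> K \<Longrightarrow> A \<noteq> {} \<Longrightarrow> adj_closed A \<Longrightarrow> A = K"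
    using assms(1) by (auto simp: component_def adj_closed_def)
  have finK: "finite K" using K(1) finV finite_subset by blast
  have finA: "finite A" using less.prems(1) finK finite_subset by blast
  show ?case
  proof (cases "A = K")
    case False
    then have "\<not> adj_closed A" using min less.prems by blast
    then obtain x y where xy: "x \<in> A" "y \<in> nbrs x" "y \<notin> A"
      using less.prems K by (auto simp: adj_closed_def)
    have yK: "y \<in> K" using xy K(2) less.prems(1) by (auto simp: adj_closed_def)
    have "edge_sum A + 1 \<le> (\<Sum>z\<in>A. card (nbrs z \<inter> insert y A))"
    proof -
      have "edge_sum A < (\<Sum>z\<in>A. card (nbrs z \<inter> insert y A))"
        unfolding edge_sum_def
      proof (rule sum_strict_mono_ex1[OF finA])
        show "\<forall>z\<in>A. card (nbrs z \<inter> A) \<le> card (nbrs z \<inter> insert y A)"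
          using fin_nbrs by (auto intro!: card_mono)
        have "nbrs x \<inter> A \<subset> nbrs x \<inter> insert y A" using xy by auto
        then show "\<exists>z\<in>A. card (nbrs z \<inter> A) < card (nbrs z \<inter> insert y A)"
          using xy(1) fin_nbrs by (auto intro!: bexI[of _ x] psubset_card_mono)
      qed
      then show ?thesis by simp
    qed
    moreover have "card {x} \<le> card (nbrs y \<inter> insert y A)"
      using xy nbrs_sym[of x y] fin_nbrs by (intro card_mono) auto
    ultimately have "edge_sum A + 2 \<le> edge_sum (insert y A)"
      using xy(3) finA by (simp add: edge_sum_def)
    moreover have "card (K - insert y A) < card (K - A)"
      using yK xy(3) finK by (intro psubset_card_mono) auto
    then have "edge_sum (insert y A) + 2 * card K \<le> edge_sum K + 2 * card (insert y A)"
      using less.prems yK by (intro less.hyps) auto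
    ultimately show ?thesis using xy(3) finA by simp
  qed simp
qed

lemma edge_sum_component:
  assumes "component K"
  shows "edge_sum K = (\<Sum>x\<in>K. deg x)"
  unfolding edge_sum_def deg_def
  using assms by (intro sum.cong) (auto simp: component_def adj_closed_def Int_absorb2)

text \<open>The bound on \<open>edge_sum K\<close> says that \<open>K\<close> is a tree. Minimum
  degree 2 inside \<open>A\<close> would mean at least as many edges as vertices, an excess that
  growth preserves up to \<open>K\<close>.\<close>

lemma no_cycle:
  assumes "component K" "edge_sum K + 2 \<le> 2 * card K" "A \<subseteq> K" "A \<noteq> {}"
    "\<And>x. x \<in> A \<Longrightarrow> \<exists>u w. u \<noteq> w \<and> {u, w} \<subseteq> nbrs x \<inter> A"
  shows False
proof -
  have "2 \<le> card (nbrs x \<inter> A)" if x: "x \<in> A" for x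
  proof -
    obtain u w where uw: "u \<noteq> w" "{u, w} \<subseteq> nbrs x \<inter> A" using assms(5)[OF x] by blast
    then have "card {u, w} \<le> card (nbrs x \<inter> A)" using fin_nbrs by (intro card_mono) auto
    then show ?thesis using uw(1) by simp
  qed
  then have "(\<Sum>x\<in>A. 2) \<le> edge_sum A" unfolding edge_sum_def by (intro sum_mono)
  then show False using edge_sum_growth[OF assms(1,3,4)] assms(2) by simp
qed

lemma no_triangle:
  assumes "component K" "edge_sum K + 2 \<le> 2 * card K" "{a, b, c} \<subseteq> K"
    "b \<in> nbrs a" "c \<in> nbrs b" "a \<in> nbrs c"
  shows False
proof (rule no_cycle[OF assms(1-3)])
  have sym: "a \<in> nbrs b" "b \<in> nbrs c" "c \<in> nbrs a" using assms(4-) nbrs_sym by auto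
  have neq: "a \<noteq> b" "b \<noteq> c" "c \<noteq> a" using assms(4-) nbrs_irrefl by auto
  fix x assume "x \<in> {a, b, c}"
  then consider "x = a" | "x = b" | "x = c" by blast
  then show "\<exists>u w. u \<noteq> w \<and> {u, w} \<subseteq> nbrs x \<inter> {a, b, c}"
  proof cases
    case 1 then show ?thesis using assms(4-) sym neq by (intro exI[of _ b] exI[of _ c]) auto
  next
    case 2 then show ?thesis using assms(4-) sym neq by (intro exI[of _ a] exI[of _ c]) auto
  next
    case 3 then show ?thesis using assms(4-) sym neq by (intro exI[of _ a] exI[of _ b]) auto
  qed
qed simp

lemma no_4_cycle:
  assumes "component K" "edge_sum K + 2 \<le> 2 * card K" "{a, b, c, d} \<subseteq> K"
    "b \<in> nbrs a" "c \<in> nbrs b" "d \<in> nbrs c" "a \<in> nbrs d" "a \<noteq> c" "b \<noteq> d"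
  shows False
proof (rule no_cycle[OF assms(1-3)])
  have sym: "a \<in> nbrs b" "b \<in> nbrs c" "c \<in> nbrs d" "d \<in> nbrs a" using assms(4-) nbrs_sym by auto
  fix x assume "x \<in> {a, b, c, d}"
  then consider "x = a \<or> x = c" | "x = b \<or> x = d" by blast
  then show "\<exists>u w. u \<noteq> w \<and> {u, w} \<subseteq> nbrs x \<inter> {a, b, c, d}"
  proof cases
    case 1 then show ?thesis using assms(4-) sym by (intro exI[of _ b] exI[of _ d]) auto
  next
    case 2 then show ?thesis using assms(4-) sym by (intro exI[of _ a] exI[of _ c]) auto
  qed
qed simp

lemma no_5_cycle:
  assumes "component K" "edge_sum K + 2 \<le> 2 * card K" "{a, b, c, d, e} \<subseteq> K"
    "b \<in> nbrs a" "c \<in> nbrs b" "d \<in> nbrs c" "e \<in> nbrs d" "a \<in> nbrs e" "distinct [a, b, c, d, e]"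
  shows False
proof (rule no_cycle[OF assms(1-3)])
  have sym: "a \<in> nbrs b" "b \<in> nbrs c" "c \<in> nbrs d" "d \<in> nbrs e" "e \<in> nbrs a"
    using assms(4-) nbrs_sym by auto
  fix x assume "x \<in> {a, b, c, d, e}"
  then consider "x = a" | "x = b" | "x = c" | "x = d" | "x = e" by blast
  then show "\<exists>u w. u \<noteq> w \<and> {u, w} \<subseteq> nbrs x \<inter> {a, b, c, d, e}"
  proof cases
    case 1 then show ?thesis using assms(4-) sym by (intro exI[of _ b] exI[of _ e]) auto
  next
    case 2 then show ?thesis using assms(4-) sym by (intro exI[of _ a] exI[of _ c]) auto
  next
    case 3 then show ?thesis using assms(4-) sym by (intro exI[of _ b] exI[of _ d]) auto
  next
    case 4 then show ?thesis using assms(4-) sym by (intro exI[of _ c] exI[of _ e]) auto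
  next
    case 5 then show ?thesis using assms(4-) sym by (intro exI[of _ d] exI[of _ a]) auto
  qed
qed simp

text \<open>Since twin leaves are excluded, at least two of the three arms continue beyond the
  neighbour of the branch vertex. With the first vertex of the third arm they make up the Dynkin
  diagram of \<open>E_6\<close>.\<close>

lemma spider_card:
  assumes "component K" "edge_sum K + 2 \<le> 2 * card K" "y \<in> K" "deg y = 3"
    and deg2: "\<And>x. x \<in> K \<Longrightarrow> x \<noteq> y \<Longrightarrow> deg x = 1 \<or> deg x = 2"
  shows "card K = 7 \<or> card K = 8"
proof -
  have cl: "\<And>x y. x \<in> K \<Longrightarrow> y \<in> nbrs x \<Longrightarrow> y \<in> K"
    using assms(1) by (auto simp: component_def adj_closed_def)
  note no3 = no_triangle[OF assms(1,2)] and no4 = no_4_cycle[OF assms(1,2)]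
    and no5 = no_5_cycle[OF assms(1,2)]
  have main: "card K = 7 \<or> card K = 8"
    if n: "nbrs y = {a, b, c}" "distinct [a, b, c]" and deg: "deg b = 2" "deg c = 2" for a b c
  proof -
    have yb: "y \<in> nbrs a" "y \<in> nbrs b" "y \<in> nbrs c" using n nbrs_sym by auto
    have ynot: "y \<notin> {a, b, c}" using n nbrs_irrefl[of y] by auto
    have "\<exists>e. nbrs x = {y, e} \<and> e \<noteq> y" if "deg x = 2" "y \<in> nbrs x" for x
    proof -
      obtain p r where "nbrs x = {p, r}" "p \<noteq> r" using \<open>deg x = 2\<close> by (auto simp: deg_def card_2_iff)
      then show ?thesis using that(2) by (cases "p = y") auto
    qed
    then obtain e f where e: "nbrs b = {y, e}" "e \<noteq> y" and f: "nbrs c = {y, f}" "f \<noteq> y"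
      using deg yb by metis
    have eb: "b \<in> nbrs e" and fc: "c \<in> nbrs f" using e f nbrs_sym by auto
    have irr: "e \<noteq> b" "f \<noteq> c" using eb fc nbrs_irrefl by auto
    have K: "{y, a, b, c, e, f} \<subseteq> K"
    proof -
      have abc: "a \<in> K" "b \<in> K" "c \<in> K" using cl[OF assms(3)] n by auto
      have "e \<in> K" "f \<in> K" using cl[OF abc(2)] cl[OF abc(3)] e f by auto
      then show ?thesis using abc assms(3) by auto
    qed
    \<comment> \<open>The six vertices are distinct and span only the five tree edges, because any
      coincidence or further edge would close a cycle of length 3, 4 or 5.\<close>
    have ea: "e \<noteq> a"
    proof
      assume "e = a"
      then show False
        using no3[of y a b] K n yb eb by auto
    qed
    have ec: "e \<noteq> c"
    proof
      assume "e = c"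
      then show False
        using no3[of y c b] K n yb eb by auto
    qed
    have fa: "f \<noteq> a"
    proof
      assume "f = a"
      then show False
        using no3[of y a c] K n yb fc by auto
    qed
    have fb: "f \<noteq> b" using ec f e yb fc ynot by auto
    have ef: "e \<noteq> f"
    proof
      assume "e = f"
      then show False
        using no4[of y b e c] K n e f yb fc by auto
    qed
    have ae: "e \<notin> nbrs a"
    proof
      assume "e \<in> nbrs a"
      then show False
        using no4[of y a e b] K n e eb yb by auto
    qed
    have af: "f \<notin> nbrs a"
    proof
      assume "f \<in> nbrs a"
      then show False
        using no4[of y a f c] K n f fc yb by auto
    qed
    have "f \<notin> nbrs e"
    proof
      assume "f \<in> nbrs e"
      then show False
        using no5[of y b e f c] K n ynot e f fc yb ec fb ef irr by auto
    qed
    then have z: "h a b = 0" "h a e = 0" "h a c = 0" "h a f = 0" "h b c = 0" "h b f = 0"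
      "h e c = 0" "h e f = 0" "h y e = 0" "h y f = 0"
    proof -
      show "h a e = 0" "h a f = 0" using ae af by (simp_all add: nbrs_def)
      show "h e f = 0" using \<open>f \<notin> nbrs e\<close> by (simp add: nbrs_def)
      have "a \<notin> nbrs b" "c \<notin> nbrs b" "f \<notin> nbrs b" using e ynot n ea ec ef f by auto
      then show "h a b = 0" "h b c = 0" "h b f = 0" using h_zero_sym by (auto simp: nbrs_def)
      have "a \<notin> nbrs c" "e \<notin> nbrs c" using f ynot n fa ef e by auto
      then show "h a c = 0" "h e c = 0" using h_zero_sym by (auto simp: nbrs_def)
      have "e \<notin> nbrs y" "f \<notin> nbrs y" using n ea ec irr fa fb by auto
      then show "h y e = 0" "h y f = 0" by (simp_all add: nbrs_def)
    qed
    have u: "h y a * h a y = 1" "h y b * h b y = 1" "h y c * h c y = 1" "h b e * h e b = 1" "h c f * h f c = 1"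
      using h_cnj_mult[of a y] h_cnj_mult[of b y] h_cnj_mult[of c y] h_cnj_mult[of e b] h_cnj_mult[of f c] n e f
      by auto
    have units: "h a y \<in> unit4" "h b y \<in> unit4" "h c y \<in> unit4" "h e b \<in> unit4" "h f c \<in> unit4"
      using yb eb fc h_unit by (auto simp: nbrs_def)
    let ?ss = "[y, a, b, e, c, f]"
    let ?sg = "[1, h a y, h b y, h e b * h b y, h c y, h f c * h c y]"
    have dss: "distinct ?ss" using n ynot e f irr ea ec fa fb ef by auto
    have su: "set ?sg \<subseteq> unit4" using units by (auto intro!: unit4_mult) (simp add: unit4_def)
    have gram: "cnj (h b y) * h b e * (h e b * h b y) = 1" "cnj (h c y) * h c f * (h f c * h c y) = 1"
      unfolding h_sym by (rule unit_path[OF u(2,4)], rule unit_path[OF u(3,5)])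
    show ?thesis
      by (rule component_card_e6[OF e6_data_tree assms(1) _ dss _ _ su])
        (use z gram K u in \<open>simp_all add: all_less_6 e6_tree_def\<close>)
  qed
  obtain a b c where n: "nbrs y = {a, b, c}" "a \<noteq> b" "b \<noteq> c" "a \<noteq> c"
    using assms(4) by (auto simp: deg_def card_3_iff)
  have abc: "x \<in> K" "x \<noteq> y" "y \<in> nbrs x" if "x \<in> {a, b, c}" for x
    using cl[OF assms(3)] n that nbrs_irrefl[of y] nbrs_sym by auto
  have leaf: "nbrs x = {y}" if "x \<in> {a, b, c}" "deg x = 1" for x
    using abc(3)[OF that(1)] that(2) by (auto simp: deg_def card_1_singleton_iff)
  have "deg x = 2 \<or> deg z = 2" if "x \<in> {a, b, c}" "z \<in> {a, b, c}" "x \<noteq> z" for x z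
    using deg2[OF abc(1,2)] that no_twin_leaves[of x z y] leaf by metis
  then consider "deg b = 2 \<and> deg c = 2" | "deg a = 2 \<and> deg c = 2" | "deg a = 2 \<and> deg b = 2"
    using n by blast
  then show ?thesis
  proof cases
    case 1 then show ?thesis using main[of a b c] n by auto
  next
    case 2
    have "nbrs y = {b, a, c}" using n by auto
    then show ?thesis using main[of b a c] 2 n by auto
  next
    case 3
    have "nbrs y = {c, a, b}" using n by auto
    then show ?thesis using main[of c a b] 3 n by auto
  qed
qed

text \<open>Without isolated vertices and negative 4-cycles, the degree identity says that there are
  three times as many leaves as vertices of degree 3. Connectivity then allows at most one vertex of
  degree 3, and with exactly one the component is a tree.\<close>

lemma component_cases:
  assumes "component K"
  shows "card K = 1 \<or> card K = 7 \<or> card K = 8 \<or> (\<forall>x\<in>K. deg x = 2)"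
proof (cases "\<exists>a\<in>K. \<exists>b c d. neg_quad a b c d")
  case True
  then show ?thesis using neg_quad_card[OF assms] by blast
next
  case False
  have K: "K \<subseteq> V" "adj_closed K" "K \<noteq> {}" and min: "\<And>A. A \<subseteq> K \<Longrightarrow> A \<noteq> {} \<Longrightarrow> adj_closed A \<Longrightarrow> A = K"
    using assms by (auto simp: component_def adj_closed_def)
  have finK: "finite K" using K(1) finV finite_subset by blast
  show ?thesis
  proof (cases "\<exists>x\<in>K. deg x = 0")
    case True
    then obtain x where x: "x \<in> K" "nbrs x = {}" using fin_nbrs by (auto simp: deg_def)
    then have "adj_closed {x}" using K(1) by (auto simp: adj_closed_def)
    then have "K = {x}" using min[of "{x}"] x by auto
    then show ?thesis by simp
  next
    case no0: False
    have deg: "deg x = 1 \<or> deg x = 2 \<or> deg x = 3" if "x \<in> K" for x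
      using no0 that deg_le_3[of x] by (cases "deg x = 0") auto
    define A1 A3 where "A1 = {x \<in> K. deg x = 1}" and "A3 = {x \<in> K. deg x = 3}"
    have fin: "finite A1" "finite A3" using finK by (auto simp: A1_def A3_def)
    have "A1 = K \<inter> {x. deg x = 1}" "A3 = K \<inter> {x. deg x = 3}" by (auto simp: A1_def A3_def)
    then have c1: "(\<Sum>x\<in>K. int (of_bool (deg x = 1))) = int (card A1)"
      and c3: "(\<Sum>x\<in>K. int (of_bool (deg x = 3))) = int (card A3)"
      using finK by simp_all
    have "(\<Sum>x\<in>K. (deg x)\<^sup>2) = 2 * (\<Sum>x\<in>K. deg x)"
      using False by (intro sum_deg_sq K(2)) blast
    then have "int (\<Sum>x\<in>K. (deg x)\<^sup>2) = int (2 * (\<Sum>x\<in>K. deg x))" by (rule arg_cong)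
    then have "0 = (\<Sum>x\<in>K. (int (deg x))\<^sup>2 - 2 * int (deg x))"
      by (simp add: sum_subtractf sum_distrib_left)
    also have "\<dots> = (\<Sum>x\<in>K. 3 * int (of_bool (deg x = 3)) - int (of_bool (deg x = 1)))"
    proof (rule sum.cong[OF refl])
      fix x assume "x \<in> K"
      from deg[OF this] show "(int (deg x))\<^sup>2 - 2 * int (deg x)
          = 3 * int (of_bool (deg x = 3)) - int (of_bool (deg x = 1))" by (elim disjE) simp_all
    qed
    also have "\<dots> = 3 * int (card A3) - int (card A1)"
      using c1 c3 by (simp add: sum_subtractf flip: sum_distrib_left)
    finally have 13: "int (card A1) = 3 * int (card A3)" by simp
    have "int (edge_sum K) = (\<Sum>x\<in>K. int (deg x))" by (simp add: edge_sum_component[OF assms])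
    also have "\<dots> = (\<Sum>x\<in>K. 2 + int (of_bool (deg x = 3)) - int (of_bool (deg x = 1)))"
    proof (rule sum.cong[OF refl])
      fix x assume "x \<in> K"
      from deg[OF this] show "int (deg x) = 2 + int (of_bool (deg x = 3)) - int (of_bool (deg x = 1))"
        by (elim disjE) simp_all
    qed
    also have "\<dots> = 2 * int (card K) + int (card A3) - int (card A1)"
      using c1 c3 by (simp add: sum_subtractf sum.distrib)
    finally have es: "int (edge_sum K) = 2 * int (card K) - 2 * int (card A3)" using 13 by simp
    obtain x0 where x0: "x0 \<in> K" using K(3) by blast
    have "edge_sum {x0} + 2 * card K \<le> edge_sum K + 2 * card {x0}"
      using edge_sum_growth[OF assms, of "{x0}"] x0 by simp
    then have "card A3 \<le> 1" using es by simp
    then consider "card A3 = 0" | "card A3 = 1" by linarith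
    then show ?thesis
    proof cases
      case 1
      then have "A1 = {}" "A3 = {}" using 13 fin by auto
      then show ?thesis using deg by (auto simp: A1_def A3_def)
    next
      case 2
      then obtain y where y: "A3 = {y}" by (auto simp: card_1_singleton_iff)
      have "card K = 7 \<or> card K = 8"
      proof (rule spider_card[OF assms])
        show "edge_sum K + 2 \<le> 2 * card K" using es 2 by simp
        show "y \<in> K" "deg y = 3" using y by (auto simp: A3_def)
        show "deg x = 1 \<or> deg x = 2" if "x \<in> K" "x \<noteq> y" for x
          using deg[OF that(1)] y that by (auto simp: A3_def)
      qed
      then show ?thesis by blast
    qed
  qed
qed

end

section \<open>Cycles and the arithmetic of the spectrum\<close>

text \<open>Above 24, the numbers 1, 2, 4, 8, 16 and the complements of the first four are nine
  distinct totatives of an odd \<open>d\<close>; the rest is a finite list.\<close>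

lemma totient_le_8:
  assumes "odd d" "d > 1" "totient d \<le> 8"
  shows "d \<in> {3, 5, 7, 9, 15}"
proof -
  have "d \<le> 24"
  proof (rule ccontr)
    assume d: "\<not> d \<le> 24"
    have cop: "coprime (2 ^ i) d" for i :: nat using assms(1) by simp
    have c: "coprime 1 d" "coprime 2 d" "coprime 4 d" "coprime 8 d" "coprime 16 d"
      using cop[of 1] cop[of 2] cop[of 3] cop[of 4] by simp_all
    have diff: "coprime (d - a) d" if "coprime a d" "a \<le> d" for a
    proof (rule coprimeI)
      fix e assume "e dvd d - a" "e dvd d"
      then have "e dvd a" using that(2) by (rule dvd_diffD1)
      then show "is_unit e" using \<open>e dvd d\<close> that(1) coprime_common_divisor by blast
    qed
    have c': "coprime (d - 1) d" "coprime (d - 2) d" "coprime (d - 4) d" "coprime (d - 8) d"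
      using d c by (auto intro!: diff)
    let ?A = "{1, 2, 4, 8, 16, d - 1, d - 2, d - 4, d - 8}"
    have "x \<in> totatives d" if "x \<in> ?A" for x
      using that c c' d unfolding totatives_def by (elim insertE emptyE) simp_all
    then have "?A \<subseteq> totatives d" by blast
    then have "card ?A \<le> totient d" unfolding totient_def by (intro card_mono) auto
    moreover have "card ?A = 9"
    proof -
      have "distinct [1, 2, 4, 8, 16, d - 1, d - 2, d - 4, d - 8]" using d by simp linarith
      from distinct_card[OF this] show ?thesis by simp
    qed
    ultimately show False using assms(3) by simp
  qed
  have "totient 21 = totient 3 * totient 7"
    using totient_mult_coprime[of 3 7] primes_coprime[of "3 :: nat" 7] by simp
  then have not: "d \<notin> {11, 13, 17, 19, 21, 23}"
    using assms(3) totient_prime[of 11] totient_prime[of 13] totient_prime[of 17] totient_prime[of 19]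
      totient_prime[of 23] totient_prime[of 3] totient_prime[of 7] by auto
  obtain k where k: "d = 2 * k + 1" using assms(1) by (elim oddE)
  have "k = 1 \<or> k = 2 \<or> k = 3 \<or> k = 4 \<or> k = 5 \<or> k = 6 \<or> k = 7 \<or> k = 8 \<or> k = 9 \<or> k = 10 \<or> k = 11"
    using assms(2) \<open>d \<le> 24\<close> k by presburger
  then show ?thesis using not unfolding k by (elim disjE) simp_all
qed

text \<open>\<open>T\<close> is a union of sets of all elements of order \<open>d\<close> in \<open>\<int>/m\<close>, of sizes
  \<open>totient d\<close>; of the orders \<open>d > 1\<close> with \<open>totient d \<le> 8\<close>, only those with \<open>3\<close> or
  \<open>15\<close> among them add up to \<open>8\<close>.\<close>

lemma galois_closed_card_8:
  fixes m :: nat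
  assumes "odd m" "T \<subseteq> {0<..<m}" "card T = 8"
    and closed: "\<And>t b d. t \<in> T \<Longrightarrow> m dvd d * t \<Longrightarrow> coprime b d \<Longrightarrow> odd d \<Longrightarrow> t * b mod m \<in> T"
  shows "3 dvd m \<and> m div 3 \<in> T \<or> 15 dvd m \<and> m div 15 \<in> T"
proof (rule ccontr)
  assume contra: "\<not> ?thesis"
  have finT: "finite T" by (rule finite_subset[OF assms(2)]) simp
  \<comment> \<open>\<open>ord t\<close> is the additive order of \<open>t\<close> modulo
    \<open>m\<close>, and for a divisor \<open>d\<close> of \<open>m\<close> the set
    \<open>orb d\<close> consists of the residues of order \<open>d\<close>.\<close>
  define ord where "ord t = m div gcd t m" for t
  define orb where "orb d = (\<lambda>r. (m div d) * r) ` totatives d" for d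
  have t_eq: "odd (ord t) \<and> ord t > 1 \<and> ord t dvd m \<and> t \<in> orb (ord t) \<and> orb (ord t) \<subseteq> T" if t: "t \<in> T" for t
  proof -
    define g r where "g = gcd t m" and "r = t div gcd t m"
    let ?d = "ord t"
    have tm: "0 < t" "t < m" using t assms(2) by auto
    have g: "g > 0" using tm by (simp add: g_def)
    have tr: "t = g * r" and md: "m = g * ?d" by (simp_all add: g_def r_def ord_def)
    have mg: "m div ?d = g" using md tm by (metis nonzero_mult_div_cancel_right mult_0_right not_less0)
    have d: "?d > 0" using md tm by (cases "?d = 0") auto
    have cop: "coprime r ?d"
      using tm div_gcd_coprime[of t m] by (simp add: r_def ord_def)
    have rd: "0 < r" "r < ?d"
    proof -
      show "0 < r" using tm tr by (cases "r = 0") auto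
      have "g * r < g * ?d" using tm tr md by simp
      then show "r < ?d" by simp
    qed
    have odd: "odd ?d" using assms(1) md by (metis even_mult_iff)
    have "orb ?d \<subseteq> T"
    proof
      fix x assume "x \<in> orb ?d"
      then obtain r' where r': "x = g * r'" "r' \<in> totatives ?d" by (auto simp: orb_def mg)
      have cop': "coprime r' ?d" "r' < ?d"
        using r' rd totatives_less[of r' ?d] by (auto simp: totatives_def)
      \<comment> \<open>Since \<open>s\<close> inverts \<open>r\<close>, the multiplier
        \<open>s * r'\<close> carries \<open>r\<close> to the arbitrary totative
        \<open>r'\<close>.\<close>
      obtain s where s: "[r * s = 1] (mod ?d)"
        using cop coprime_iff_invertible_nat[of r ?d] by auto
      have "[r * (s * r') = r'] (mod ?d)"
        using cong_mult[OF s cong_refl[of r']] by (simp add: mult.assoc)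
      moreover have "coprime (s * r') ?d"
      proof -
        have "coprime s ?d" using s
          by (metis cong_imp_coprime cong_sym coprime_1_left coprime_mult_left_iff)
        then show ?thesis using cop' by simp
      qed
      moreover have "m dvd ?d * t" using md tr by (metis dvd_triv_left mult.assoc mult.commute)
      ultimately have "t * (s * r') mod m \<in> T" using closed[OF t] odd by blast
      moreover have "t * (s * r') mod m = g * (r * (s * r') mod ?d)"
      proof -
        have "t * (s * r') = g * (r * (s * r'))" by (subst (1) tr) (simp only: mult.assoc)
        then have "t * (s * r') mod m = (g * (r * (s * r'))) mod (g * ?d)"
          by (simp only: md[symmetric])
        then show ?thesis by (simp only: mult_mod_right)
      qed
      moreover have "r * (s * r') mod ?d = r'"
        using \<open>[r * (s * r') = r'] (mod ?d)\<close> cop'(2) by (simp add: cong_def)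
      ultimately show "x \<in> T" using r'(1) by simp
    qed
    moreover have "t \<in> orb ?d"
      unfolding orb_def mg
      by (rule image_eqI[where x = r], rule tr) (use rd cop in \<open>simp add: totatives_def\<close>)
    moreover have "?d dvd m" using md by (metis dvd_triv_right)
    ultimately show ?thesis using odd rd by auto
  qed
  have cardO: "card (orb d) = totient d" if "d dvd m" for d
  proof -
    have "m div d > 0" using that assms(1)
      by (metis dvd_div_eq_0_iff even_zero gr0I)
    then show ?thesis
      unfolding orb_def totient_def by (intro card_image) (auto simp: inj_on_def)
  qed
  have ords: "ord t \<in> {5, 7, 9}" if t: "t \<in> T" for t
  proof -
    have "totient (ord t) \<le> 8"
      using t_eq[OF t] cardO[of "ord t"] card_mono[OF finT, of "orb (ord t)"] assms(3) by simp
    then have "ord t \<in> {3, 5, 7, 9, 15}" using totient_le_8 t_eq[OF t] by blast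
    moreover have False if "ord t \<in> {3, 15}"
    proof -
      have "1 \<in> totatives (ord t)" using that by (auto simp: totatives_def)
      then have "m div ord t \<in> orb (ord t)" by (force simp: orb_def)
      then show False using contra that t_eq[OF t] by auto
    qed
    ultimately show ?thesis by blast
  qed
  have T_d: "card {t \<in> T. ord t = d} = 0 \<or> card {t \<in> T. ord t = d} = totient d" for d
  proof (cases "{t \<in> T. ord t = d} = {}")
    case True
    then show ?thesis by (metis card.empty)
  next
    case False
    then obtain t where t: "t \<in> T" "ord t = d" by blast
    have "{t \<in> T. ord t = d} = orb d"
    proof
      show "{t \<in> T. ord t = d} \<subseteq> orb d" using t_eq by auto
      show "orb d \<subseteq> {t \<in> T. ord t = d}"
      proof
        fix x assume x: "x \<in> orb d"
        have xT: "x \<in> T" using x t_eq[OF t(1)] t(2) by auto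
        obtain r where r: "x = (m div d) * r" "r \<in> totatives d" using x by (auto simp: orb_def)
        have md: "m = (m div d) * d" using t_eq[OF t(1)] t(2) by simp
        have "gcd x m = (m div d) * gcd r d"
          by (subst md) (simp only: r(1) gcd_mult_distrib_nat)
        then have "gcd x m = m div d" using r(2) by (simp add: totatives_def)
        moreover have "m div d > 0" using md assms(1) by (metis even_zero gr0I mult_0)
        ultimately have "ord x = d" using md unfolding ord_def
          by (metis nonzero_mult_div_cancel_left not_less0)
        then show "x \<in> {t \<in> T. ord t = d}" using xT by simp
      qed
    qed
    then show ?thesis using cardO[of d] t_eq[OF t(1)] t(2) by simp
  qed
  have "T = {t \<in> T. ord t = 5} \<union> ({t \<in> T. ord t = 7} \<union> {t \<in> T. ord t = 9})"
    using ords by blast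
  moreover have "card ({t \<in> T. ord t = 5} \<union> ({t \<in> T. ord t = 7} \<union> {t \<in> T. ord t = 9}))
      = card {t \<in> T. ord t = 5} + (card {t \<in> T. ord t = 7} + card {t \<in> T. ord t = 9})"
    using finT by (subst card_Un_disjoint, auto)+
  moreover have "totient 5 = 4" "totient 7 = 6" using totient_prime[of 5] totient_prime[of 7] by simp_all
  moreover have "totient (3 ^ 2) = 3 ^ (2 - 1) * (3 - 1)" by (rule totient_prime_power) simp_all
  then have "totient 9 = 6" by simp
  \<comment> \<open>No selection from 4, 6, 6 has sum 8.\<close>
  ultimately have "card T \<noteq> 8" using T_d[of 5] T_d[of 7] T_d[of 9] by auto
  then show False using assms(3) by simp
qed

section \<open>Components and the enumeration of 2-regular ones\<close>

context gain_graph
begin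

lemma exists_component:
  assumes "x \<in> V"
  shows "\<exists>K. component K \<and> x \<in> K"
proof -
  define E where "E = {(u, w). w \<in> nbrs u}"
  have symE: "sym (E\<^sup>*)" by (rule sym_rtrancl) (auto simp: sym_def E_def nbrs_sym)
  define K where "K = {y. (x, y) \<in> E\<^sup>*}"
  have closed: "z \<in> A" if "adj_closed A" "y \<in> A" "(y, z) \<in> E\<^sup>*" for A y z
    using that(3,2) by (induction rule: rtrancl_induct) (use that(1) in \<open>auto simp: E_def adj_closed_def\<close>)
  have "adj_closed V" using nbrs_sub by (auto simp: adj_closed_def)
  then have "K \<subseteq> V" using closed assms by (auto simp: K_def)
  then have "adj_closed K"
    by (auto simp: adj_closed_def K_def E_def intro: rtrancl_into_rtrancl)
  moreover have "A = K" if A: "A \<subseteq> K" "A \<noteq> {}" "adj_closed A" for A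
  proof
    obtain y where y: "y \<in> A" using A by blast
    then have "(y, x) \<in> E\<^sup>*" using A(1) symE by (auto simp: K_def dest: symD)
    then have "x \<in> A" by (rule closed[OF A(3) y])
    then show "K \<subseteq> A" using closed[OF A(3)] by (auto simp: K_def)
  qed (rule A(1))
  moreover have "x \<in> K" by (simp add: K_def)
  ultimately show ?thesis by (auto simp: component_def)
qed

lemma component_disjoint:
  assumes "component K" "component K'" "K \<noteq> K'"
  shows "K \<inter> K' = {}"
proof (rule ccontr)
  assume ne: "K \<inter> K' \<noteq> {}"
  have "adj_closed (K \<inter> K')" using assms by (auto simp: component_def adj_closed_def)
  then have "K \<inter> K' = K" "K \<inter> K' = K'"
    using assms ne by (auto simp: component_def)
  then show False using assms(3) by simp
qed

text \<open>A walk that never turns back is determined by its first step. Its first repetition must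
  be the starting point, since every later vertex has both of its neighbours on the walk already.
  The value at \<open>k\<close> is kept equal to that at 0, so that edges need no index
  reduction.\<close>

lemma cycle_enumeration:
  assumes "component K" "\<And>x. x \<in> K \<Longrightarrow> deg x = 2"
  obtains c k where "k \<ge> 3" "c k = c 0" "inj_on c {..<k}" "c ` {..<k} = K"
    "\<And>i. Suc i < k \<Longrightarrow> nbrs (c (Suc i)) = {c i, c (Suc (Suc i))}" "nbrs (c 0) = {c 1, c (k - 1)}"
proof -
  have cl: "\<And>x y. x \<in> K \<Longrightarrow> y \<in> nbrs x \<Longrightarrow> y \<in> K" and KV: "K \<subseteq> V"
    and min: "\<And>A. A \<subseteq> K \<Longrightarrow> A \<noteq> {} \<Longrightarrow> adj_closed A \<Longrightarrow> A = K"
    using assms(1) by (auto simp: component_def adj_closed_def)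
  have finK: "finite K" using KV finV finite_subset by blast
  obtain x0 where x0: "x0 \<in> K" using assms(1) by (auto simp: component_def)
  have "nbrs x0 \<noteq> {}" using assms(2)[OF x0] by (auto simp: deg_def)
  then obtain p where p: "p \<in> nbrs x0" by blast
  have "\<exists>z. nbrs x = {y, z} \<and> z \<noteq> y" if "x \<in> K" "y \<in> nbrs x" for x y
  proof -
    have "card (nbrs x) = 2" using assms(2)[OF that(1)] by (simp add: deg_def)
    then obtain u w where "nbrs x = {u, w}" "u \<noteq> w" by (auto simp: card_2_iff)
    then show ?thesis using that(2) by (cases "y = u") auto
  qed
  then obtain other where other: "\<And>x y. x \<in> K \<Longrightarrow> y \<in> nbrs x \<Longrightarrow> nbrs x = {y, other x y} \<and> other x y \<noteq> y"
    by metis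
  \<comment> \<open>The state is the current vertex together with the next one.\<close>
  define f where "f = rec_nat (x0, p) (\<lambda>_ a. (snd a, other (snd a) (fst a)))"
  define c where "c n = fst (f n)" for n
  have f0: "f 0 = (x0, p)" and fS: "f (Suc n) = (snd (f n), other (snd (f n)) (fst (f n)))" for n
    by (simp_all add: f_def)
  have inv: "c n \<in> K \<and> c (Suc n) \<in> nbrs (c n)" for n
  proof (induction n)
    case 0 then show ?case using x0 p by (simp add: c_def f0 fS)
  next
    case (Suc n)
    have "c (Suc n) \<in> K" using cl Suc by blast
    moreover have "c n \<in> nbrs (c (Suc n))" using Suc nbrs_sym by blast
    then have "nbrs (c (Suc n)) = {c n, other (c (Suc n)) (c n)}"
      using other \<open>c (Suc n) \<in> K\<close> by blast
    moreover have "c (Suc (Suc n)) = other (c (Suc n)) (c n)" by (simp add: c_def fS)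
    ultimately show ?case by simp
  qed
  have nb: "nbrs (c (Suc n)) = {c n, c (Suc (Suc n))}" "c (Suc (Suc n)) \<noteq> c n" for n
  proof -
    have "c (Suc (Suc n)) = other (c (Suc n)) (c n)" by (simp add: c_def fS)
    moreover have "c n \<in> nbrs (c (Suc n))" using inv nbrs_sym by blast
    ultimately show "nbrs (c (Suc n)) = {c n, c (Suc (Suc n))}" "c (Suc (Suc n)) \<noteq> c n"
      using other inv by auto
  qed
  have "\<exists>n. c n \<in> c ` {..<n}"
  proof (rule ccontr)
    assume none: "\<nexists>n. c n \<in> c ` {..<n}"
    have "inj c"
    proof (rule injI)
      fix i j assume "c i = c j"
      then show "i = j" using none by (cases i j rule: linorder_cases) (metis image_eqI lessThan_iff)+
    qed
    moreover have "range c \<subseteq> K" using inv by auto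
    ultimately show False using finK finite_subset finite_imageD by blast
  qed
  define k where "k = (LEAST n. c n \<in> c ` {..<n})"
  have k: "c k \<in> c ` {..<k}" unfolding k_def by (rule LeastI_ex) fact
  have kmin: "c j \<notin> c ` {..<j}" if "j < k" for j using not_less_Least[of j] that by (simp add: k_def)
  have inj: "inj_on c {..<k}"
  proof (rule inj_onI)
    fix i j assume "i \<in> {..<k}" "j \<in> {..<k}" "c i = c j"
    then show "i = j" using kmin[of i] kmin[of j]
      by (cases i j rule: linorder_cases) (metis image_eqI lessThan_iff)+
  qed
  obtain j where j: "j < k" "c k = c j" using k by auto
  obtain k' where k': "k = Suc k'" using j by (cases k) auto
  have last: "c k' \<in> nbrs (c j)" using inv[of k'] nbrs_sym j k' by metis
  have "j = 0"
  proof (rule ccontr)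
    assume "j \<noteq> 0"
    then obtain i where i: "j = Suc i" by (cases j) auto
    then have "c k' = c i \<or> c k' = c (Suc (Suc i))" using last nb(1)[of i] by auto
    then show False
    proof
      assume "c k' = c i"
      then have "k' = i" using inj k' i j by (auto simp: inj_on_def)
      then show False using i j k' by simp
    next
      assume eq: "c k' = c (Suc (Suc i))"
      show False
      proof (cases "Suc (Suc i) < k")
        case True
        then have "k' = Suc (Suc i)" using inj k' eq by (auto simp: inj_on_def)
        then show False using nb(2)[of "Suc i"] j i k' by auto
      next
        case False
        then have "k' = Suc i" using i j k' by auto
        then show False using inv[of k'] j i k' nbrs_irrefl by auto
      qed
    qed
  qed
  then have ck: "c k = c 0" using j by simp
  have k3: "k \<ge> 3"
  proof (rule ccontr)
    assume "\<not> k \<ge> 3"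
    then have "k = 1 \<or> k = 2" using k' by auto
    then show False
      using ck inv[of 0] nbrs_irrefl nb(2)[of 0] by (auto simp: numeral_2_eq_2)
  qed
  have n0: "nbrs (c 0) = {c 1, c (k - 1)}"
  proof (rule nbrs_eqI)
    show "{c 1, c (k - 1)} \<subseteq> nbrs (c 0)" using inv[of 0] last \<open>j = 0\<close> k' by auto
    have "c 1 \<noteq> c (k - 1)" using inj_onD[OF inj, of 1 "k - 1"] k3 by auto
    then show "card {c 1, c (k - 1)} = deg (c 0)" using assms(2) inv by simp
  qed
  have "adj_closed (c ` {..<k})"
    unfolding adj_closed_def
  proof (intro conjI ballI)
    show "c ` {..<k} \<subseteq> V" using inv KV by auto
    fix x assume "x \<in> c ` {..<k}"
    then obtain i where i: "i < k" "x = c i" by auto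
    show "nbrs x \<subseteq> c ` {..<k}"
    proof (cases i)
      case 0 then show ?thesis using i n0 k3 by auto
    next
      case (Suc l)
      have "c (Suc (Suc l)) \<in> c ` {..<k}"
      proof (cases "Suc (Suc l) < k")
        case False
        then have "Suc (Suc l) = k" using i Suc by simp
        then show ?thesis using ck k3 by auto
      qed auto
      then show ?thesis using i Suc nb(1)[of l] by auto
    qed
  qed
  then have "c ` {..<k} = K" using min[of "c ` {..<k}"] inv k3 by (auto simp: lessThan_empty_iff)
  then show thesis using that[of k c] k3 ck inj nb n0 by blast
qed

end

section \<open>Weights of cycles and the orders of the components\<close>

context spectral_graph
begin

text \<open>Removing the accumulated gains turns the eigenvalue equation into that of an ordinary
  path, solved by the powers of \<open>w\<close>; the solution closes up because \<open>w^k\<close>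
  is the weight of the cycle.\<close>

lemma cycle_eigenfunction:
  assumes c: "k \<ge> 3" "c k = c 0" "inj_on c {..<k}" "c ` {..<k} = K" "component K"
    and nb: "\<And>i. Suc i < k \<Longrightarrow> nbrs (c (Suc i)) = {c i, c (Suc (Suc i))}" "nbrs (c 0) = {c 1, c (k - 1)}"
    and w: "w ^ k = (\<Prod>i<k. h (c i) (c (Suc i)))" "norm w = 1"
  obtains f where "\<And>x. x \<in> V \<Longrightarrow> H f x = (w + inverse w) * f x" "f (c 0) = 1"
    "f (c 1) = w * h (c 1) (c 0)"
proof -
  have cl: "adj_closed K" and KV: "K \<subseteq> V" using c(5) by (auto simp: component_def adj_closed_def)
  have w0: "w \<noteq> 0" using w(2) by auto
  define g where "g i = (\<Prod>j<i. h (c j) (c (Suc j)))" for i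
  define F where "F i = w ^ i * cnj (g i)" for i
  define ix where "ix = inv_into {..<k} c"
  have ix: "ix (c i) = i" if "i < k" for i
    unfolding ix_def by (rule inv_into_f_f[OF c(3)]) (use that in simp)
  define f where "f x = (if x \<in> K then F (ix x) else 0)" for x
  have fc: "f (c i) = F i" if "i < k" for i
    using that c(4) by (auto simp: f_def ix)
  have nx: "c (Suc i) \<in> nbrs (c i)" if "i < k" for i
  proof (cases i)
    case 0 then show ?thesis using nb(2) by simp
  next
    case (Suc j) then show ?thesis using nb(1)[of j] that by auto
  qed
  have hu: "h (c i) (c (Suc i)) * h (c (Suc i)) (c i) = 1" if "i < k" for i
    using h_cnj_mult[OF nx[OF that]] .
  have gS: "cnj (g (Suc i)) = cnj (g i) * h (c (Suc i)) (c i)" for i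
    by (simp add: g_def h_sym)
  have gu: "g i * cnj (g i) = 1" if "i \<le> k" for i
    using that
  proof (induction i)
    case (Suc i)
    then have "h (c i) (c (Suc i)) \<in> unit4" using nx[of i] h_unit by (simp add: nbrs_def)
    then have "g (Suc i) * cnj (g (Suc i)) = (g i * cnj (g i)) * (h (c i) (c (Suc i)) * cnj (h (c i) (c (Suc i))))"
      by (simp add: g_def mult_ac)
    then show ?case using Suc \<open>h (c i) (c (Suc i)) \<in> unit4\<close> unit4_cnj_mult by simp
  qed (simp add: g_def)
  have Fk: "F k = 1"
    using w(1) gu[of k] by (simp add: F_def g_def)
  have fck: "f (c i) = F i" if "i \<le> k" for i
  proof (cases "i = k")
    case True
    then show ?thesis using c(1,2) fc[of 0] Fk by (simp add: F_def g_def)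
  qed (use that fc in auto)
  have fwd: "h (c i) (c (Suc i)) * F (Suc i) = w * F i" if "i < k" for i
  proof -
    have "h (c i) (c (Suc i)) * F (Suc i) = (h (c i) (c (Suc i)) * h (c (Suc i)) (c i)) * (w * F i)"
      by (simp add: F_def gS mult_ac)
    then show ?thesis using hu[OF that] by simp
  qed
  have bwd: "h (c (Suc i)) (c i) * F i = inverse w * F (Suc i)" for i
    using w0 by (simp add: F_def gS field_simps)
  have "H f x = (w + inverse w) * f x" if x: "x \<in> V" for x
  proof (cases "x \<in> K")
    case False
    then have "f y = 0" if "y \<in> nbrs x" for y
      using that cl nbrs_sym[of y x] by (auto simp: f_def adj_closed_def)
    then have "H f x = 0" unfolding H_nbrs by (intro sum.neutral) auto
    then show ?thesis using False by (simp add: f_def)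
  next
    case True
    then obtain i where i: "i < k" "x = c i" using c(4) by auto
    obtain k' where k': "k = Suc k'" "k' \<ge> 2" using c(1) by (cases k) auto
    show ?thesis
    proof (cases i)
      case 0
      have "c 1 \<noteq> c k'" using inj_onD[OF c(3), of 1 k'] k' by auto
      moreover have "h (c 0) (c k') * F k' = inverse w * F 0"
      proof -
        have "F 0 = 1" by (simp add: F_def g_def)
        then show ?thesis using bwd[of k'] c(2) Fk unfolding k'(1) by simp
      qed
      ultimately show ?thesis
        using fwd[of 0] c(1) k' nb(2) i 0 fck[of 0] fck[of 1] fck[of k'] by (simp add: H_nbrs distrib_right)
    next
      case (Suc j)
      have ne: "c j \<noteq> c (Suc (Suc j))"
      proof
        assume eq: "c j = c (Suc (Suc j))"
        show False
        proof (cases "Suc (Suc j) < k")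
          case True
          then show False using inj_onD[OF c(3) eq] by simp
        next
          case False
          then have "Suc (Suc j) = k" using i Suc by simp
          then have "c j = c 0" using eq c(2) by simp
          then show False using inj_onD[OF c(3), of j 0] i Suc c(1) \<open>Suc (Suc j) = k\<close> by auto
        qed
      qed
      have "nbrs x = {c j, c (Suc (Suc j))}" using nb(1)[of j] i Suc by simp
      then have "H f x = h (c (Suc j)) (c j) * F j + h (c (Suc j)) (c (Suc (Suc j))) * F (Suc (Suc j))"
        using ne i Suc fck[of j] fck[of "Suc (Suc j)"] by (simp add: H_nbrs)
      then show ?thesis using fwd[of "Suc j"] bwd[of j] i Suc fc by (simp add: distrib_right)
    qed
  qed
  moreover have "f (c 0) = 1" "f (c 1) = w * h (c 1) (c 0)"
    using fc c(1) by (simp_all add: F_def g_def h_sym)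
  ultimately show thesis by (rule that)
qed

lemma omega_2m: "omega m t ^ (2 * m) = - 1"
proof -
  have "omega m t ^ (2 * m) = (omega m t ^ m)\<^sup>2" by (simp add: power_mult mult.commute)
  also have "\<dots> = ((- \<i>)\<^sup>2) ^ m" by (simp only: omega_power[OF m_pos] power_mult[symmetric] mult.commute)
  also have "\<dots> = - 1" using odd_m by simp
  finally show ?thesis .
qed

text \<open>Weight 1 would give the eigenvalue 2, and weight -1 a double eigenvalue. For the other
  two weights, \<open>2 cos (pi / (2 k))\<close> must be some \<open>lam m t\<close>, so its root of
  unity satisfies \<open>w^(2 m) = -1\<close> and \<open>m / k\<close> is an odd integer.\<close>

lemma cycle_component:
  assumes c: "k \<ge> 3" "c k = c 0" "inj_on c {..<k}" "c ` {..<k} = K" "component K"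
    and nb: "\<And>i. Suc i < k \<Longrightarrow> nbrs (c (Suc i)) = {c i, c (Suc (Suc i))}" "nbrs (c 0) = {c 1, c (k - 1)}"
  shows "k dvd m" and "(\<Prod>i<k. h (c i) (c (Suc i))) \<in> {\<i>, - \<i>}"
proof -
  define W where "W = (\<Prod>i<k. h (c i) (c (Suc i)))"
  have KV: "K \<subseteq> V" using c(5) by (auto simp: component_def adj_closed_def)
  have c0: "c 0 \<in> V" "c 1 \<in> V" using c(1,4) KV by auto
  have nx: "c (Suc i) \<in> nbrs (c i)" if "i < k" for i
  proof (cases i)
    case 0 then show ?thesis using nb(2) by simp
  next
    case (Suc j) then show ?thesis using nb(1)[of j] that by auto
  qed
  have "(\<Prod>i\<in>A. h (c i) (c (Suc i))) \<in> unit4" if "A \<subseteq> {..<k}" for A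
    using finite_subset[OF that finite_lessThan] that
  proof (induction A rule: finite_induct)
    case (insert x A)
    then show ?case using nx[of x] h_unit by (auto simp: nbrs_def intro!: unit4_mult)
  qed (simp add: unit4_def)
  then have W: "W \<in> unit4" by (simp add: W_def)
  have ev: "\<exists>f. \<exists>t<m. w + inverse w = of_real (lam m t) \<and> (\<forall>x\<in>V. f x = coef t f * phi t x) \<and>
      f (c 0) = 1 \<and> f (c 1) = w * h (c 1) (c 0)" if "w ^ k = W" "norm w = 1" for w
  proof -
    note wk = that[unfolded W_def]
    obtain f where f: "\<And>x. x \<in> V \<Longrightarrow> H f x = (w + inverse w) * f x" "f (c 0) = 1"
      "f (c 1) = w * h (c 1) (c 0)"
      by (rule cycle_eigenfunction[OF c _ nb(2) wk], erule nb(1), rule that)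
    then have "f (c 0) \<noteq> 0" by simp
    from eigenfunction[OF f(1) c0(1) this] f(2,3) show ?thesis by blast
  qed
  have "W \<noteq> 1"
  proof
    assume "W = 1"
    then obtain t where "complex_of_real (lam m t) = 2" using ev[of 1] by auto
    then have "lam m t = 2" by (metis of_real_eq_iff of_real_numeral)
    then show False using lam_bound[OF odd_m, of t] by simp
  qed
  moreover have "W \<noteq> - 1"
  proof
    assume W1: "W = - 1"
    define w where "w = cis (pi / real k)"
    have w1: "w ^ k = W" "norm w = 1" "w \<noteq> 0"
      using c(1) by (simp_all add: w_def Complex.DeMoivre W1)
    have wk: "w ^ k = W" "inverse w ^ k = W" "norm w = 1" "norm (inverse w) = 1" "w \<noteq> 0"
      using w1 by (simp_all add: W1 power_inverse norm_inverse)
    obtain f s where f: "s < m" "w + inverse w = of_real (lam m s)" "\<And>x. x \<in> V \<Longrightarrow> f x = coef s f * phi s x"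
      "f (c 0) = 1" "f (c 1) = w * h (c 1) (c 0)"
      using ev[OF wk(1,3)] by blast
    obtain f' s' where f': "s' < m" "inverse w + inverse (inverse w) = of_real (lam m s')"
      "\<And>x. x \<in> V \<Longrightarrow> f' x = coef s' f' * phi s' x" "f' (c 0) = 1" "f' (c 1) = inverse w * h (c 1) (c 0)"
      using ev[OF wk(2,4)] by blast
    have "complex_of_real (lam m s') = of_real (lam m s)" using f(2) f'(2) by (simp add: add.commute)
    then have "s' = s" using f(1) f'(1) by (simp add: lam_eq_iff[OF odd_m])
    then have "coef s f * phi s (c 0) = coef s f' * phi s (c 0)" "phi s (c 0) \<noteq> 0"
      using f(3,4) f'(3,4) c0(1) by (metis, metis mult_zero_right zero_neq_one)
    \<comment> \<open>Both functions belong to the same simple eigenvalue and agree at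
      \<open>c 0\<close>; at \<open>c 1\<close> they differ by the factor that separates
      \<open>w\<close> from its inverse.\<close>
    then have "f (c 1) = f' (c 1)" using f(3) f'(3) c0(2) \<open>s' = s\<close> by simp
    moreover have "h (c 1) (c 0) \<noteq> 0" using nx[of 0] c(1) h_zero_sym by (auto simp: nbrs_def)
    ultimately have "w = inverse w" using f(5) f'(5) by simp
    then have "sin (pi / real k) = 0" by (simp add: w_def complex_eq_iff)
    moreover have "sin (pi / real k) > 0" using c(1) by (intro sin_gt_zero) (auto simp: field_simps)
    ultimately show False by simp
  qed
  ultimately have Wi: "W \<in> {\<i>, - \<i>}" using W by (auto simp: unit4_def)
  then show "(\<Prod>i<k. h (c i) (c (Suc i))) \<in> {\<i>, - \<i>}" by (simp add: W_def)
  define e where "e = (if W = \<i> then 1 else - 1 :: real)"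
  define w where "w = cis (e * pi / (2 * real k))"
  have "w ^ k = cis (e * pi / 2)" using c(1) by (simp add: w_def Complex.DeMoivre)
  also have "\<dots> = W" using Wi by (auto simp: e_def cis.ctr complex_eq_iff)
  finally obtain t where t: "w + inverse w = of_real (lam m t)"
    using ev[of w] by (auto simp: w_def)
  have "w \<noteq> 0" by (simp add: w_def)
  then have "w = omega m t \<or> w = inverse (omega m t)"
    using t by (simp add: lam_omega sum_inverse_eq_iff)
  then have "w ^ (2 * m) = - 1" using omega_2m by (auto simp: power_inverse)
  moreover have "w ^ (2 * m) = cis (e * pi * real m / real k)"
    using c(1) by (simp add: w_def Complex.DeMoivre mult_ac)
  ultimately have "cos (e * pi * real m / real k) = - 1" by (simp add: complex_eq_iff)
  then have "cos (pi * real m / real k) = - 1" by (auto simp: e_def split: if_splits)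
  then have "cos (pi * real m / real k + pi) = 1" by simp
  then obtain j :: int where "pi * real m / real k + pi = of_int j * 2 * pi"
    unfolding cos_one_2pi_int by blast
  then have "pi * real m = pi * (real k * (2 * of_int j - 1))" using c(1) by (simp add: field_simps)
  then have "real m = real k * (2 * of_int j - 1)" by simp
  then have "real_of_int (int m) = of_int (int k * (2 * j - 1))" by simp
  then have "int m = int k * (2 * j - 1)" by (simp only: of_int_eq_iff)
  then have "int k dvd int m" by simp
  then show "k dvd m" by simp
qed

lemma component_spec_8:
  assumes "component K" "card K = 8"
  shows "3 dvd m \<and> m div 3 \<in> spec K \<or> 15 dvd m \<and> m div 15 \<in> spec K \<or> 0 \<in> spec K"
proof (cases "0 \<in> spec K")
  case False
  have cl: "adj_closed K" using assms(1) by (simp add: component_def)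
  have "spec K \<subseteq> {0<..<m}" using spec_sub[of K] False by (auto simp: subset_iff) (metis gr0I)
  then show ?thesis
    using galois_closed_card_8[OF odd_m, of "spec K"] spec_galois[OF cl] card_spec[OF cl] assms(2) by auto
qed simp

text \<open>The spectra of components are disjoint, so the indices \<open>m div 3\<close> and
  \<open>m div 15\<close> each belong to at most one component, and every component of order 8
  without the index 0 needs one of them. Two such components force \<open>15 dvd m\<close>, which
  rules out the totals 17 and 23.\<close>

lemma component_structure:
  assumes "m > 1"
  shows "m \<in> {7, 9, 15} \<or> component V \<and> (\<forall>x\<in>V. deg x = 2)"
proof -
  define C where "C = {K. component K}"
  have sub: "K \<subseteq> V" "adj_closed K" if "K \<in> C" for K
    using that by (auto simp: C_def component_def adj_closed_def)
  have finC: "finite C" using sub(1) finV by (intro finite_subset[of C "Pow V"]) auto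
  have finK: "finite K" if "K \<in> C" for K using sub(1)[OF that] finV finite_subset by blast
  have un: "\<Union>C = V" using sub(1) exists_component by (auto simp: C_def)
  have disj: "K \<inter> K' = {}" if "K \<in> C" "K' \<in> C" "K \<noteq> K'" for K K'
    using that component_disjoint by (auto simp: C_def)
  have sdisj: "K = K'" if "K \<in> C" "K' \<in> C" "t \<in> spec K" "t \<in> spec K'" for K K' t
    using spec_disjoint[OF sub(2)[OF that(1)] sub(2)[OF that(2)]] disj that by blast
  have "card V = (\<Sum>K\<in>C. card K)"
    unfolding un[symmetric] using finK disj by (intro card_Union_disjoint) (auto simp: pairwise_def disjnt_def)
  then have m: "m = (\<Sum>K\<in>C. card K)" by (simp add: card_V)
  have "\<exists>K0\<in>C. 0 \<in> spec K0"
  proof (rule ccontr)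
    assume "\<not> ?thesis"
    then have "even (card K)" if "K \<in> C" for K using even_card_of_zero_notin_spec sub(2) that by blast
    then have "even m" unfolding m by (rule dvd_sum)
    then show False using odd_m by simp
  qed
  then obtain K0 where K0: "K0 \<in> C" "0 \<in> spec K0" by blast
  have cyc: "card K dvd m \<and> card K \<ge> 3" if "K \<in> C" "\<forall>x\<in>K. deg x = 2" for K
  proof -
    have "component K" and deg2: "\<And>x. x \<in> K \<Longrightarrow> deg x = 2" using that by (simp_all add: C_def)
    then obtain c k where c: "k \<ge> 3" "c k = c 0" "inj_on c {..<k}" "c ` {..<k} = K"
      "\<And>i. Suc i < k \<Longrightarrow> nbrs (c (Suc i)) = {c i, c (Suc (Suc i))}" "nbrs (c 0) = {c 1, c (k - 1)}"
      using cycle_enumeration[OF _ deg2] by metis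
    have "k dvd m" by (rule cycle_component(1)[of k c K]) (fact | rule c)+
    moreover have "card K = k" using card_image[OF c(3)] c(4) by simp
    ultimately show ?thesis using c(1) by simp
  qed
  define B where "B = C - {K0}"
  have B8: "card K = 8" if K: "K \<in> B" for K
  proof -
    have "0 \<notin> spec K" using K K0 sdisj[of K K0 0] by (auto simp: B_def)
    then have ev: "even (card K)" using K sub(2) even_card_of_zero_notin_spec by (auto simp: B_def)
    have "\<not> (\<forall>x\<in>K. deg x = 2)"
      using cyc[of K] K ev odd_m dvd_trans by (auto simp: B_def)
    then show ?thesis
      using component_cases[of K] K ev by (auto simp: B_def C_def)
  qed
  have m8: "m = card K0 + 8 * card B"
  proof -
    have "(\<Sum>K\<in>C. card K) = card K0 + (\<Sum>K\<in>B. card K)"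
      unfolding B_def by (rule sum.remove[OF finC K0(1)])
    then show ?thesis using m B8 by simp
  qed
  define B3 B15 where "B3 = {K \<in> B. 3 dvd m \<and> m div 3 \<in> spec K}"
    and "B15 = {K \<in> B. 15 dvd m \<and> m div 15 \<in> spec K}"
  have finB: "finite B" using finC by (simp add: B_def)
  have "B = B3 \<union> B15"
  proof -
    have "K \<in> B3 \<union> B15" if K: "K \<in> B" for K
    proof -
      have "0 \<notin> spec K" using K K0 sdisj[of K K0 0] by (auto simp: B_def)
      then show ?thesis
        using component_spec_8[of K] B8[OF K] K by (auto simp: B_def C_def B3_def B15_def)
    qed
    then show ?thesis by (auto simp: B3_def B15_def)
  qed
  have "card B3 \<le> 1" "card B15 \<le> 1"
    using sdisj finB by (auto simp: card_le_Suc0_iff_eq B3_def B15_def B_def)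
  have card_B: "card B \<le> card B3 + card B15" by (subst \<open>B = B3 \<union> B15\<close>) (rule card_Un_le)
  have two: "15 dvd m" if "card B = 2"
  proof -
    have "card B15 \<noteq> 0" using that card_B \<open>card B3 \<le> 1\<close> by simp
    then have "B15 \<noteq> {}" by auto
    then show ?thesis unfolding B15_def by blast
  qed
  have le2: "card B \<le> 2" using card_B \<open>card B3 \<le> 1\<close> \<open>card B15 \<le> 1\<close> by simp
  have oddK0: "odd (card K0)" using m8 odd_m by (metis even_add even_mult_iff even_numeral)
  have "component K0" using K0 by (simp add: C_def)
  then consider "card K0 = 1" | "card K0 = 7" | "\<forall>x\<in>K0. deg x = 2"
    using component_cases[of K0] oddK0 by auto
  then show ?thesis
  proof cases
    case 1
    then have m1: "m = 1 + 8 * card B" using m8 by simp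
    have "card B \<noteq> 2"
    proof
      assume "card B = 2"
      then have "15 dvd (17 :: nat)" using two m1 by simp
      then show False by simp
    qed
    with m1 show ?thesis using le2 assms by (cases "card B = 0"; cases "card B = 1") auto
  next
    case 2
    then have m7: "m = 7 + 8 * card B" using m8 by simp
    have "card B \<noteq> 2"
    proof
      assume "card B = 2"
      then have "15 dvd (23 :: nat)" using two m7 by simp
      then show False by simp
    qed
    with m7 show ?thesis using le2 by (cases "card B = 0"; cases "card B = 1") auto
  next
    case 3
    have k: "card K0 dvd m" "card K0 \<ge> 3" using cyc[OF K0(1) 3] by auto
    \<comment> \<open>An odd divisor of \<open>8 * card B\<close> divides \<open>card B\<close>,
      which is at most 2, while a cycle has order at least 3; so there are no other
      components.\<close>
    then have "card K0 dvd 8 * card B" using m8 by (metis dvd_add_right_iff dvd_refl)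
    moreover have "coprime (card K0) 8"
    proof -
      have "coprime (card K0) (2 ^ 3)" unfolding coprime_power_right_iff using oddK0 by simp
      then show ?thesis by simp
    qed
    ultimately have "card K0 dvd card B" using coprime_dvd_mult_right_iff by blast
    then have "card B = 0" using k(2) le2 by (auto dest: dvd_imp_le)
    then have "B = {}" using finB by simp
    then have "C = {K0}" using K0 by (auto simp: B_def)
    then have "K0 = V" using un by simp
    then show ?thesis using 3 \<open>component K0\<close> by blast
  qed
qed

end

section \<open>From matrices to gain graphs\<close>

lemma herm_entry_values: "herm_entry X u w \<in> insert 0 unit4"
  by (auto simp: herm_entry_def unit4_def)

lemma gain_graph_herm_entry:
  fixes X :: "(nat, 'b) mixed_graph_scheme"
  assumes "mixed_graph X"
  shows "gain_graph (mverts X) (herm_entry X)"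
proof
  have arcs: "(x, y) \<in> marcs X \<Longrightarrow> (y, x) \<notin> marcs X" for x y
    using assms by (auto simp: mixed_graph_def)
  show "cnj (herm_entry X x y) = herm_entry X y x" for x y
    using arcs by (auto simp: herm_entry_def insert_commute)
  have "{x, x} \<notin> medges X" for x using assms by (force simp: mixed_graph_def)
  then show "herm_entry X x x = 0" for x using assms by (auto simp: herm_entry_def mixed_graph_def)
  show "x \<in> mverts X" if "herm_entry X x y \<noteq> 0" for x y
    using that assms by (auto simp: herm_entry_def mixed_graph_def split: if_splits)
  show "herm_entry X x y \<in> insert 0 unit4" for x y by (rule herm_entry_values)
qed (use assms in \<open>simp add: mixed_graph_def\<close>)

lemma herm_adj_carrier: "herm_adj X \<in> carrier_mat (card (mverts X)) (card (mverts X))"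
  by (simp add: herm_adj_def Let_def)

lemma herm_adj_entry:
  assumes "i < card (mverts X)" "j < card (mverts X)"
  shows "herm_adj X $$ (i, j)
    = herm_entry X (sorted_list_of_set (mverts X) ! i) (sorted_list_of_set (mverts X) ! j)"
  using assms by (simp add: herm_adj_def Let_def)

lemma sum_sorted_list_of_set:
  fixes V :: "'a :: linorder set"
  assumes "finite V"
  shows "(\<Sum>j<card V. F (sorted_list_of_set V ! j)) = (\<Sum>x\<in>V. F x)"
proof -
  have "bij_betw ((!) (sorted_list_of_set V)) {..<card V} V"
    using assms by (intro bij_betw_nth) auto
  then show ?thesis by (rule sum.reindex_bij_betw)
qed

lemma eigenvalue_herm_adj:
  fixes X :: "('a :: linorder, 'b) mixed_graph_scheme"
  assumes "finite (mverts X)" "x0 \<in> mverts X" "f x0 \<noteq> 0"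
    and "\<And>x. x \<in> mverts X \<Longrightarrow> (\<Sum>y\<in>mverts X. herm_entry X x y * f y) = mu * f x"
  shows "eigenvalue (herm_adj X) mu"
proof -
  let ?n = "card (mverts X)" and ?vs = "sorted_list_of_set (mverts X)"
  define u where "u = vec ?n (\<lambda>j. f (?vs ! j))"
  have vs: "?vs ! i \<in> mverts X" if "i < ?n" for i
    using assms(1) nth_mem[of i ?vs] that by simp
  have "herm_adj X *\<^sub>v u = mu \<cdot>\<^sub>v u"
  proof (rule eq_vecI)
    fix i assume "i < dim_vec (mu \<cdot>\<^sub>v u)"
    then have i: "i < ?n" by (simp add: u_def)
    have "(herm_adj X *\<^sub>v u) $ i = (\<Sum>j<?n. herm_entry X (?vs ! i) (?vs ! j) * f (?vs ! j))"
      using i herm_adj_carrier[of X]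
      by (auto simp: u_def scalar_prod_def herm_adj_entry lessThan_atLeast0 intro!: sum.cong)
    also have "\<dots> = mu * f (?vs ! i)"
      using sum_sorted_list_of_set[OF assms(1), of "\<lambda>y. herm_entry X (?vs ! i) y * f y"] assms(4)[OF vs[OF i]]
      by simp
    finally show "(herm_adj X *\<^sub>v u) $ i = (mu \<cdot>\<^sub>v u) $ i" using i by (simp add: u_def)
  qed (use herm_adj_carrier[of X] in \<open>simp add: u_def\<close>)
  moreover have "u \<noteq> 0\<^sub>v ?n"
  proof
    assume "u = 0\<^sub>v ?n"
    moreover obtain i where "i < ?n" "?vs ! i = x0"
      using assms(1,2) by (metis in_set_conv_nth length_sorted_list_of_set set_sorted_list_of_set)
    ultimately have "f x0 = 0" by (metis index_vec index_zero_vec(1) u_def)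
    then show False using assms(3) by simp
  qed
  ultimately show ?thesis
    using herm_adj_carrier[of X] by (auto simp: eigenvalue_def eigenvector_def u_def intro!: exI[of _ u])
qed

lemma mixed_cycle1_entry:
  assumes "m \<ge> 3" "i < m" "j < m"
  shows "herm_entry (mixed_cycle1 m) i j
    = (if j = Suc i \<or> i = Suc j then 1 else if i = m - 1 \<and> j = 0 then \<i>
       else if i = 0 \<and> j = m - 1 then - \<i> else 0)"
  using assms by (auto simp: herm_entry_def mixed_cycle1_def doubleton_eq_iff)

lemma mixed_cycle1_row_sum:
  assumes "m \<ge> 3" "i < m"
  shows "(\<Sum>j<m. herm_entry (mixed_cycle1 m) i j * f j)
    = (if i = m - 1 then \<i> * f 0 else f (Suc i)) + (if i = 0 then - \<i> * f (m - 1) else f (i - 1))"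
proof -
  let ?h = "herm_entry (mixed_cycle1 m) i"
  define p r where "p = (if i = m - 1 then 0 else Suc i)" and "r = (if i = 0 then m - 1 else i - 1)"
  have pr: "p < m" "r < m" "p \<noteq> r" using assms by (auto simp: p_def r_def)
  have "(\<Sum>j<m. ?h j * f j) = (\<Sum>j\<in>{p, r}. ?h j * f j)"
  proof (rule sum.mono_neutral_right)
    show "\<forall>j\<in>{..<m} - {p, r}. ?h j * f j = 0"
      using assms by (auto simp: mixed_cycle1_entry p_def r_def)
  qed (use pr in auto)
  also have "\<dots> = ?h p * f p + ?h r * f r" using pr by simp
  finally show ?thesis using assms pr by (auto simp: mixed_cycle1_entry p_def r_def)
qed

text \<open>The geometric sequence of \<open>w\<close> is an eigenvector when \<open>w^m\<close> is
  the gain \<open>\<i>\<close> of the closing arc. Depending on \<open>m\<close> modulo 4,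
  \<open>omega m t\<close> or its inverse has this property, and both have the same sum with their
  inverse.\<close>

lemma char_poly_mixed_cycle1:
  assumes "odd m" "m \<ge> 3"
  shows "char_poly (herm_adj (mixed_cycle1 m)) = dickson m"
proof (rule char_poly_dickson[OF assms(1)])
  show "herm_adj (mixed_cycle1 m) \<in> carrier_mat m m"
    using herm_adj_carrier[of "mixed_cycle1 m"] by (simp add: mixed_cycle1_def)
  fix t
  have m: "m > 0" using assms by simp
  have "(- \<i>) ^ m = \<i> \<or> (- \<i>) ^ m = - \<i>"
  proof -
    have "((- \<i>) ^ m)\<^sup>2 = - 1"
      using assms(1) by (simp add: power_mult[symmetric] mult.commute[of m] power_mult)
    then have "((- \<i>) ^ m - \<i>) * ((- \<i>) ^ m + \<i>) = 0" by (simp add: power2_eq_square algebra_simps)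
    then show ?thesis by (auto simp: eq_neg_iff_add_eq_0)
  qed
  then have "\<exists>w. w \<noteq> 0 \<and> w ^ m = \<i> \<and> w + inverse w = of_real (lam m t)"
  proof
    assume "(- \<i>) ^ m = \<i>"
    then show ?thesis by (intro exI[of _ "omega m t"]) (simp add: lam_omega omega_power[OF m])
  next
    assume "(- \<i>) ^ m = - \<i>"
    then have "inverse (omega m t) ^ m = \<i>"
      by (simp add: power_inverse omega_power[OF m] del: omega_nonzero)
    then show ?thesis by (intro exI[of _ "inverse (omega m t)"]) (simp add: lam_omega add.commute)
  qed
  then obtain w where w: "w \<noteq> 0" "w ^ m = \<i>" "w + inverse w = of_real (lam m t)" by blast
  have V: "mverts (mixed_cycle1 m) = {..<m}" by (auto simp: mixed_cycle1_def)
  show "eigenvalue (herm_adj (mixed_cycle1 m)) (of_real (lam m t))"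
    unfolding w(3)[symmetric]
  proof (rule eigenvalue_herm_adj)
    fix i assume "i \<in> mverts (mixed_cycle1 m)"
    then have i: "i < m" by (simp add: V)
    obtain k where k: "m = Suc k" using m by (cases m) auto
    have wk: "\<i> = w ^ k * w" "w ^ k = \<i> * inverse w" using w(1,2) by (simp_all add: k field_simps)
    have "(if i = m - 1 then \<i> * w ^ 0 else w ^ Suc i) = w * w ^ i"
      using wk(1) by (auto simp: k mult.commute)
    moreover have "(if i = 0 then - \<i> * w ^ (m - 1) else w ^ (i - 1)) = inverse w * w ^ i"
      using wk(2) w(1) by (cases i) (auto simp: k)
    ultimately show "(\<Sum>y\<in>mverts (mixed_cycle1 m). herm_entry (mixed_cycle1 m) i y * w ^ y)
        = (w + inverse w) * w ^ i"
      unfolding V mixed_cycle1_row_sum[OF assms(2) i] by (simp add: distrib_right)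
  qed (use m in \<open>auto simp: V\<close>)
qed

text \<open>A monic complex polynomial is recovered from its multiset of roots, whose size is the
  order of the graph.\<close>

lemma herm_spec_mixed_cycle1_iff:
  assumes "odd m" "m \<ge> 3"
  shows "herm_spec X = herm_spec (mixed_cycle1 m)
    \<longleftrightarrow> card (mverts X) = m \<and> char_poly (herm_adj X) = dickson m"
proof
  assume eq: "herm_spec X = herm_spec (mixed_cycle1 m)"
  let ?p = "char_poly (herm_adj X)"
  have "size (herm_spec X) = size (herm_spec (mixed_cycle1 m))" using eq by simp
  then have "card (mverts X) = degree (dickson m)"
    using degree_monic_char_poly[OF herm_adj_carrier[of X]]
    by (simp add: herm_spec_def size_proots_complex char_poly_mixed_cycle1[OF assms])
  moreover have "degree (dickson m) = m" "lead_coeff (dickson m) = 1"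
    using degree_dickson[of "m - 1"] assms(2) by auto
  moreover have "?p = dickson m"
  proof -
    have "lead_coeff ?p = 1" using degree_monic_char_poly[OF herm_adj_carrier[of X]] by simp
    then have "?p = (\<Prod>x\<in>#proots ?p. [:- x, 1:])"
      using complex_poly_decompose_multiset[of ?p] by simp
    also have "proots ?p = proots (dickson m)"
      using eq by (simp add: herm_spec_def char_poly_mixed_cycle1[OF assms])
    also have "(\<Prod>x\<in>#proots (dickson m). [:- x, 1:]) = dickson m"
      using complex_poly_decompose_multiset[of "dickson m"] \<open>lead_coeff (dickson m) = 1\<close> by simp
    finally show ?thesis .
  qed
  ultimately show "card (mverts X) = m \<and> ?p = dickson m" by simp
qed (simp add: herm_spec_def char_poly_mixed_cycle1[OF assms])

section \<open>Determinants and Cramer's rule over the Gaussian integers\<close>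

lemma det_gauss_ints:
  assumes "A \<in> carrier_mat n n" "\<And>i j. i < n \<Longrightarrow> j < n \<Longrightarrow> A $$ (i, j) \<in> gauss_ints"
  shows "det A \<in> gauss_ints"
  unfolding det_def'[OF assms(1)]
proof (rule gauss_ints_sum)
  fix p assume "p \<in> {p. p permutes {0..<n}}"
  then have "p i < n" if "i < n" for i using that permutes_in_image[of p "{0..<n}" i] by simp
  then have "(\<Prod>i = 0..<n. A $$ (i, p i)) \<in> gauss_ints" using assms(2) by (intro gauss_ints_prod) auto
  then show "signof p * (\<Prod>i = 0..<n. A $$ (i, p i)) \<in> gauss_ints"
    by (cases p rule: sign_cases) auto
qed

lemma replace_col_carrier: "A \<in> carrier_mat n n \<Longrightarrow> replace_col A b k \<in> carrier_mat n n"
  by (simp add: replace_col_def)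

lemma det_replace_col_smult:
  assumes "A \<in> carrier_mat n n" "b \<in> carrier_vec n" "k < n"
  shows "det (replace_col A (c \<cdot>\<^sub>v b) k) = c * det (replace_col A b k)"
proof -
  let ?T = "transpose_mat (replace_col A b k)"
  have T: "?T \<in> carrier_mat n n" using replace_col_carrier[OF assms(1)] by simp
  have "transpose_mat (replace_col A (c \<cdot>\<^sub>v b) k) = multrow k c ?T"
    using assms by (intro eq_matI) (auto simp: replace_col_def)
  then have "det (transpose_mat (replace_col A (c \<cdot>\<^sub>v b) k)) = c * det ?T"
    using det_multrow[OF assms(3) T] by simp
  then show ?thesis
    using det_transpose[OF replace_col_carrier[OF assms(1)]] by simp
qed

text \<open>Cramer's rule with the common factor taken out of the replaced column.\<close>

lemma det_dvd_of_column:
  assumes "A \<in> carrier_mat n n" "x \<in> carrier_vec n" "b \<in> carrier_vec n" "A *\<^sub>v x = c \<cdot>\<^sub>v b" "k < n"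
  shows "x $ k * det A = c * det (replace_col A b k)"
  using cramer_lemma_mat[OF assms(1,2,5)] det_replace_col_smult[OF assms(1,3,5), of c] assms(4) by simp

lemma det_replace_col_gauss_ints:
  assumes "A \<in> carrier_mat n n" "b \<in> carrier_vec n" "k < n"
    and "\<And>i j. i < n \<Longrightarrow> j < n \<Longrightarrow> A $$ (i, j) \<in> gauss_ints" "\<And>i. i < n \<Longrightarrow> b $ i \<in> gauss_ints"
  shows "det (replace_col A b k) \<in> gauss_ints"
  by (rule det_gauss_ints[OF replace_col_carrier[OF assms(1)]]) (use assms in \<open>auto simp: replace_col_def\<close>)

text \<open>Distinct eigenvalues make the normalised eigenvectors orthonormal, and completeness
  follows because a one-sided inverse of a square matrix is two-sided. The two arithmetic
  assumptions are Cramer's rule for a matrix of determinant 2.\<close>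

lemma spectral_graph_of_char_poly:
  fixes X :: "(nat, 'b) mixed_graph_scheme"
  assumes X: "mixed_graph X" and odd: "odd m" and card: "card (mverts X) = m"
    and cp: "char_poly (herm_adj X) = dickson m"
  obtains phi where "spectral_graph (mverts X) (herm_entry X) m phi"
proof -
  let ?V = "mverts X" and ?h = "herm_entry X" and ?A = "herm_adj X" and ?vs = "sorted_list_of_set (mverts X)"
  interpret gain_graph ?V ?h by (rule gain_graph_herm_entry[OF X])
  have A: "?A \<in> carrier_mat m m" using herm_adj_carrier[of X] card by simp
  have Aij: "?A $$ (i, j) = ?h (?vs ! i) (?vs ! j)" if "i < m" "j < m" for i j
    using that herm_adj_entry[of i X j] card by simp
  have m0: "m > 0" using odd by (cases m) auto
  have vsV: "?vs ! i \<in> ?V" if "i < m" for i using finV nth_mem[of i ?vs] that card by simp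
  have vs_ex: "\<exists>i<m. x = ?vs ! i" if "x \<in> ?V" for x
    using finV that card by (metis in_set_conv_nth length_sorted_list_of_set set_sorted_list_of_set)
  have vs_eq: "?vs ! i = ?vs ! j \<longleftrightarrow> i = j" if "i < m" "j < m" for i j
    using that finV card by (simp add: nth_eq_iff_index_eq)
  have sumV: "(\<Sum>j<m. F (?vs ! j)) = (\<Sum>x\<in>?V. F x)" for F :: "nat \<Rightarrow> complex"
    using sum_sorted_list_of_set[OF finV, of F] card by simp
  define ix where "ix x = (THE i. i < m \<and> x = ?vs ! i)" for x
  have ix: "ix (?vs ! i) = i" if "i < m" for i
    unfolding ix_def using that vs_eq by (intro the_equality) auto
  have "\<exists>f. (\<exists>x\<in>?V. f x \<noteq> 0) \<and> (\<forall>x\<in>?V. H f x = of_real (lam m t) * f x)" if "t < m" for t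
  proof -
    have "poly (char_poly ?A) (of_real (lam m t)) = 0" by (simp add: cp dickson_lam[OF odd])
    then have "eigenvalue ?A (of_real (lam m t))" using eigenvalue_root_char_poly[OF A] by blast
    then obtain u where u: "u \<in> carrier_vec m" "u \<noteq> 0\<^sub>v m" "?A *\<^sub>v u = of_real (lam m t) \<cdot>\<^sub>v u"
      using A by (auto simp: eigenvalue_def eigenvector_def)
    define f where "f x = u $ ix x" for x
    have fv: "f (?vs ! j) = u $ j" if "j < m" for j using that by (simp add: f_def ix)
    have "\<exists>i<m. u $ i \<noteq> 0"
    proof (rule ccontr)
      assume "\<not> ?thesis"
      then have "u = 0\<^sub>v m" using u(1) by (intro eq_vecI) auto
      then show False using u(2) by simp
    qed
    then have "\<exists>x\<in>?V. f x \<noteq> 0" using fv vsV by metis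
    moreover have "H f x = of_real (lam m t) * f x" if "x \<in> ?V" for x
    proof -
      obtain i where i: "i < m" "x = ?vs ! i" using vs_ex \<open>x \<in> ?V\<close> by blast
      have "H f x = (\<Sum>j<m. ?h x (?vs ! j) * f (?vs ! j))" unfolding H_def by (rule sumV[symmetric])
      also have "\<dots> = (?A *\<^sub>v u) $ i"
        using i A u(1) by (auto simp: scalar_prod_def Aij fv lessThan_atLeast0 intro!: sum.cong)
      also have "\<dots> = of_real (lam m t) * f x" using i u(1) by (simp add: u(3) fv)
      finally show ?thesis .
    qed
    ultimately show ?thesis by blast
  qed
  then obtain psi where psi: "\<And>t. t < m \<Longrightarrow> \<exists>x\<in>?V. psi t x \<noteq> 0"
    "\<And>t x. t < m \<Longrightarrow> x \<in> ?V \<Longrightarrow> H (psi t) x = of_real (lam m t) * psi t x" by metis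
  define r where "r t = sqrt (\<Sum>x\<in>?V. (norm (psi t x))\<^sup>2)" for t
  have r: "r t > 0" if t: "t < m" for t
  proof -
    obtain x where "x \<in> ?V" "psi t x \<noteq> 0" using psi(1)[OF t] by blast
    then have "(\<Sum>x\<in>?V. (norm (psi t x))\<^sup>2) > 0" using finV by (intro sum_pos2[of _ x]) auto
    then show ?thesis by (simp add: r_def)
  qed
  define phi where "phi t x = psi t x / of_real (r t)" for t x
  have eig: "H (phi t) x = of_real (lam m t) * phi t x" if "t < m" "x \<in> ?V" for t x
    using psi(2)[OF that] by (simp add: phi_def H_def flip: sum_divide_distrib)
  have orth: "ip (phi s) (phi t) = of_bool (s = t)" if st: "s < m" "t < m" for s t
  proof (cases "s = t")
    case True
    have "ip (phi t) (phi t) = (\<Sum>x\<in>?V. of_real ((norm (psi t x))\<^sup>2)) / of_real ((r t)\<^sup>2)"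
      by (simp add: ip_def phi_def sum_divide_distrib cnj_mult_norm power2_eq_square[of "complex_of_real (r t)"])
    also have "\<dots> = of_real ((\<Sum>x\<in>?V. (norm (psi t x))\<^sup>2) / (r t)\<^sup>2)" by simp
    also have "(r t)\<^sup>2 = (\<Sum>x\<in>?V. (norm (psi t x))\<^sup>2)" unfolding r_def by (rule real_sqrt_pow2) (simp add: sum_nonneg)
    finally show ?thesis using True r[OF st(2)] by (auto simp: r_def)
  next
    case False
    have "of_real (lam m s) * ip (phi s) (phi t) = ip (H (phi s)) (phi t)"
      using eig st by (simp add: ip_def sum_distrib_left mult_ac)
    also have "\<dots> = ip (phi s) (H (phi t))" by (simp add: H_adjoint)
    also have "\<dots> = of_real (lam m t) * ip (phi s) (phi t)"
      using eig st by (simp add: ip_def sum_distrib_left mult_ac)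
    finally show ?thesis using False lam_eq_iff[OF odd st] by auto
  qed
  have compl: "(\<Sum>t<m. phi t x * cnj (phi t y)) = of_bool (x = y)" if xy: "x \<in> ?V" "y \<in> ?V" for x y
  proof -
    define P Q where "P = mat m m (\<lambda>(j, t). phi t (?vs ! j))" and "Q = mat m m (\<lambda>(t, j). cnj (phi t (?vs ! j)))"
    have carr: "P \<in> carrier_mat m m" "Q \<in> carrier_mat m m" by (simp_all add: P_def Q_def)
    have "Q * P = 1\<^sub>m m"
    proof (rule eq_matI)
      fix s t assume "s < dim_row (1\<^sub>m m :: complex mat)" "t < dim_col (1\<^sub>m m :: complex mat)"
      then have st: "s < m" "t < m" by auto
      have "(Q * P) $$ (s, t) = (\<Sum>j<m. cnj (phi s (?vs ! j)) * phi t (?vs ! j))"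
        using st by (simp add: P_def Q_def scalar_prod_def lessThan_atLeast0)
      also have "\<dots> = ip (phi s) (phi t)" unfolding ip_def by (rule sumV)
      finally show "(Q * P) $$ (s, t) = 1\<^sub>m m $$ (s, t)" using st by (simp add: orth)
    qed (simp_all add: P_def Q_def)
    then have PQ: "P * Q = 1\<^sub>m m" by (rule mat_mult_left_right_inverse[OF carr(2,1)])
    obtain i j where ij: "i < m" "x = ?vs ! i" "j < m" "y = ?vs ! j" using vs_ex xy by metis
    have "(\<Sum>t<m. phi t x * cnj (phi t y)) = (P * Q) $$ (i, j)"
      using ij by (simp add: P_def Q_def scalar_prod_def lessThan_atLeast0)
    then show ?thesis using ij vs_eq by (simp add: PQ)
  qed
  define M where "M = mat m m (\<lambda>(i, j). 2 * of_bool (i = j) - ?h (?vs ! i) (?vs ! j))"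
  have M: "M \<in> carrier_mat m m" by (simp add: M_def)
  have Mg: "M $$ (i, j) \<in> gauss_ints" if "i < m" "j < m" for i j
    using that h_gauss_ints by (auto simp: M_def)
  have detM: "det M = 2"
  proof -
    have "M = - char_matrix ?A 2"
      using A by (intro eq_matI) (auto simp: M_def char_matrix_def Aij)
    then show ?thesis using char_poly_matrix[OF A, of 2] by (simp add: cp poly_dickson_2)
  qed
  define vc where "vc f = vec m (\<lambda>i. f (?vs ! i))" for f :: "nat \<Rightarrow> complex"
  have vc: "vc f \<in> carrier_vec m" for f by (simp add: vc_def)
  have Mv: "M *\<^sub>v vc f = c \<cdot>\<^sub>v vc g" if "\<And>x. x \<in> ?V \<Longrightarrow> 2 * f x - H f x = c * g x" for f g c
  proof (rule eq_vecI)
    fix i assume "i < dim_vec (c \<cdot>\<^sub>v vc g)"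
    then have i: "i < m" by (simp add: vc_def)
    have "(M *\<^sub>v vc f) $ i = (\<Sum>j<m. (2 * of_bool (i = j) - ?h (?vs ! i) (?vs ! j)) * f (?vs ! j))"
      using i by (simp add: M_def vc_def scalar_prod_def lessThan_atLeast0)
    also have "\<dots> = (\<Sum>j<m. if j = i then 2 * f (?vs ! j) else 0) - (\<Sum>j<m. ?h (?vs ! i) (?vs ! j) * f (?vs ! j))"
      unfolding sum_subtractf[symmetric] by (intro sum.cong) (auto simp: algebra_simps)
    also have "\<dots> = 2 * f (?vs ! i) - H f (?vs ! i)"
      using i sumV[of "\<lambda>y. ?h (?vs ! i) y * f y"] by (simp add: H_def)
    also have "\<dots> = c * g (?vs ! i)" by (rule that[OF vsV[OF i]])
    finally show "(M *\<^sub>v vc f) $ i = (c \<cdot>\<^sub>v vc g) $ i" using i by (simp add: vc_def)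
  qed (simp add: M_def vc_def)
  have "spectral_graph ?V ?h m phi"
  proof unfold_locales
    fix v w :: "nat \<Rightarrow> complex" and x
    assume g: "\<And>x. v x \<in> gauss_ints" "\<And>x. w x \<in> gauss_ints"
      and eq: "\<And>x. x \<in> ?V \<Longrightarrow> 2 * v x - H v x = 3 * w x" and x: "x \<in> ?V"
    obtain k where k: "k < m" "x = ?vs ! k" using vs_ex[OF x] by blast
    define e where "e = det (replace_col M (vc w) k)"
    have e: "e \<in> gauss_ints"
      unfolding e_def using g by (intro det_replace_col_gauss_ints[OF M vc k(1)] Mg) (auto simp: vc_def)
    have "vc v $ k * det M = 3 * e"
      unfolding e_def by (rule det_dvd_of_column[OF M vc vc Mv[OF eq] k(1)])
    then have "v x * 2 = 3 * e" using k by (simp add: vc_def detM)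
    \<comment> \<open>From \<open>2 v = 3 e\<close>, a third of \<open>v\<close> appears as a
      difference of Gaussian integers.\<close>
    then have third: "v x - e = v x / 3" by (simp add: field_simps)
    show "v x / 3 \<in> gauss_ints" using gauss_ints_diff[OF g(1)[of x] e] by (simp only: third)
  next
    fix v w :: "nat \<Rightarrow> complex" and x
    assume g: "\<And>x. v x \<in> gauss_ints" "\<And>x. w x \<in> gauss_ints"
      and eq: "\<And>x. x \<in> ?V \<Longrightarrow> 2 * v x - H v x = 2 * w x" and half: "ip v w / 2 \<in> gauss_ints" and x: "x \<in> ?V"
    obtain k where k: "k < m" "x = ?vs ! k" using vs_ex[OF x] by blast
    \<comment> \<open>Cramer's rule is used twice. Replacing column \<open>k\<close> of
      \<open>M\<close> gives \<open>det B = v x\<close>. The transpose of \<open>B\<close> then maps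
      the conjugate of \<open>v\<close> to \<open>2 * u\<close>, where coordinate \<open>k\<close>
      of \<open>u\<close> is \<open>ip v w / 2\<close>; hence the squared norm of \<open>v x\<close>
      is twice a Gaussian integer.\<close>
    define B where "B = replace_col M (vc w) k"
    define u where "u = vec m (\<lambda>j. if j = k then ip v w / 2 else cnj (w (?vs ! j)))"
    have B: "B \<in> carrier_mat m m" unfolding B_def by (rule replace_col_carrier[OF M])
    have Bg: "B $$ (i, j) \<in> gauss_ints" if "i < m" "j < m" for i j
      using that Mg g M by (auto simp: B_def replace_col_def vc_def)
    have u: "u \<in> carrier_vec m" "\<And>j. j < m \<Longrightarrow> u $ j \<in> gauss_ints"
      using half g by (auto simp: u_def)
    have "vc v $ k * det M = 2 * det B"
      unfolding B_def by (rule det_dvd_of_column[OF M vc vc Mv[OF eq] k(1)])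
    then have detB: "det B = v x" using k by (simp add: vc_def detM)
    have "transpose_mat B *\<^sub>v vc (\<lambda>x. cnj (v x)) = 2 \<cdot>\<^sub>v u"
    proof (rule eq_vecI)
      fix j assume "j < dim_vec (2 \<cdot>\<^sub>v u)"
      then have j: "j < m" by (simp add: u_def)
      have "(transpose_mat B *\<^sub>v vc (\<lambda>x. cnj (v x))) $ j = (\<Sum>i<m. B $$ (i, j) * cnj (v (?vs ! i)))"
        using j B by (auto simp: scalar_prod_def vc_def lessThan_atLeast0 intro!: sum.cong)
      also have "\<dots> = 2 * u $ j"
      proof (cases "j = k")
        case True
        then have "(\<Sum>i<m. B $$ (i, j) * cnj (v (?vs ! i))) = (\<Sum>i<m. cnj (v (?vs ! i)) * w (?vs ! i))"
          using M k by (intro sum.cong) (auto simp: B_def replace_col_def vc_def)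
        also have "\<dots> = ip v w" unfolding ip_def by (rule sumV)
        finally show ?thesis using True k by (simp add: u_def)
      next
        case False
        have Mc: "cnj (M $$ (j, i)) = M $$ (i, j)" if "i < m" for i
          using that j by (auto simp: M_def h_sym)
        have "(M *\<^sub>v vc v) $ j = (\<Sum>i<m. M $$ (j, i) * v (?vs ! i))"
          using M j by (auto simp: scalar_prod_def vc_def lessThan_atLeast0 intro!: sum.cong)
        then have "cnj ((M *\<^sub>v vc v) $ j) = (\<Sum>i<m. M $$ (i, j) * cnj (v (?vs ! i)))"
          by (simp add: Mc)
        also have "\<dots> = (\<Sum>i<m. B $$ (i, j) * cnj (v (?vs ! i)))"
          using M j False by (intro sum.cong) (auto simp: B_def replace_col_def)
        finally have "(\<Sum>i<m. B $$ (i, j) * cnj (v (?vs ! i))) = cnj ((M *\<^sub>v vc v) $ j)" ..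
        then show ?thesis using False j Mv[OF eq] by (simp add: u_def vc_def)
      qed
      finally show "(transpose_mat B *\<^sub>v vc (\<lambda>x. cnj (v x))) $ j = (2 \<cdot>\<^sub>v u) $ j" using j by (simp add: u_def)
    qed (use B in \<open>simp add: u_def\<close>)
    then have "vc (\<lambda>x. cnj (v x)) $ k * det (transpose_mat B) = 2 * det (replace_col (transpose_mat B) u k)"
      using B u k by (intro det_dvd_of_column) (auto simp: vc)
    then have two: "cnj (v x) * v x = 2 * det (replace_col (transpose_mat B) u k)"
      using k B by (simp add: vc_def det_transpose detB)
    have "det (replace_col (transpose_mat B) u k) \<in> gauss_ints"
      using B Bg u k by (intro det_replace_col_gauss_ints[of _ m]) auto
    then obtain a where a: "Re (det (replace_col (transpose_mat B) u k)) = of_int a"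
      by (auto simp: gauss_ints_def elim: Ints_cases)
    show "v x \<notin> unit4"
    proof
      assume "v x \<in> unit4"
      then have "Re (2 * det (replace_col (transpose_mat B) u k)) = 1"
        using two unit4_cnj_mult(1) by (metis one_complex.sel(1))
      then have "2 * real_of_int a = 1" using a by simp
      then have "real_of_int (2 * a) = of_int 1" by simp
      then have "2 * a = 1" by (simp only: of_int_eq_iff)
      then show False by presburger
    qed
  qed (use odd card eig orth compl in auto)
  then show thesis by (rule that)
qed

section \<open>Switching\<close>

definition map_mixed_graph :: "('a \<Rightarrow> 'b) \<Rightarrow> 'a mixed_graph \<Rightarrow> 'b mixed_graph" where
  "map_mixed_graph f X = \<lparr>mverts = f ` mverts X, medges = (`) f ` medges X,
     marcs = map_prod f f ` marcs X\<rparr>"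

lemma map_mixed_graph_edge_iff:
  assumes "mixed_graph X" "inj_on f (mverts X)" "u \<in> mverts X" "v \<in> mverts X"
  shows "{f u, f v} \<in> medges (map_mixed_graph f X) \<longleftrightarrow> {u, v} \<in> medges X"
    and "(f u, f v) \<in> marcs (map_mixed_graph f X) \<longleftrightarrow> (u, v) \<in> marcs X"
proof -
  have "e = {u, v}" if "e \<in> medges X" "f ` e = {f u, f v}" for e
  proof -
    have "f ` e = f ` {u, v}" using that by simp
    then show ?thesis
      using that assms by (subst (asm) inj_on_image_eq_iff[OF assms(2)]) (auto simp: mixed_graph_def)
  qed
  then have "{u, v} \<in> medges X" if "{f u, f v} \<in> medges (map_mixed_graph f X)"
    using that by (auto simp: map_mixed_graph_def)
  moreover have "{f u, f v} \<in> medges (map_mixed_graph f X)" if "{u, v} \<in> medges X"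
    using imageI[OF that, of "(`) f"] by (simp add: map_mixed_graph_def)
  ultimately show "{f u, f v} \<in> medges (map_mixed_graph f X) \<longleftrightarrow> {u, v} \<in> medges X" by blast
  have "a = u \<and> b = v" if "(a, b) \<in> marcs X" "f a = f u" "f b = f v" for a b
    using that assms by (auto simp: mixed_graph_def inj_on_def)
  then show "(f u, f v) \<in> marcs (map_mixed_graph f X) \<longleftrightarrow> (u, v) \<in> marcs X"
    by (force simp: map_mixed_graph_def)
qed

lemma mixed_graph_map:
  assumes "mixed_graph X" "inj_on f (mverts X)"
  shows "mixed_graph (map_mixed_graph f X)"
proof -
  note iff = map_mixed_graph_edge_iff[OF assms]
  have arcs: "\<exists>u\<in>mverts X. \<exists>v\<in>mverts X. a = f u \<and> b = f v \<and> (u, v) \<in> marcs X"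
    if "(a, b) \<in> marcs (map_mixed_graph f X)" for a b
    using that assms(1) by (fastforce simp: map_mixed_graph_def mixed_graph_def)
  have "a \<noteq> b \<and> (b, a) \<notin> marcs (map_mixed_graph f X) \<and> {a, b} \<notin> medges (map_mixed_graph f X)"
    if ab: "(a, b) \<in> marcs (map_mixed_graph f X)" for a b
  proof -
    obtain u v where uv: "u \<in> mverts X" "v \<in> mverts X" "a = f u" "b = f v" "(u, v) \<in> marcs X"
      using arcs[OF ab] by blast
    then have "u \<noteq> v" "(v, u) \<notin> marcs X" "{u, v} \<notin> medges X"
      using assms(1) by (auto simp: mixed_graph_def)
    then show ?thesis using uv iff[of u v] iff[of v u] assms(2) by (auto simp: inj_on_def)
  qed
  moreover have "e \<subseteq> f ` mverts X \<and> card e = 2" if "e \<in> medges (map_mixed_graph f X)" for e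
  proof -
    have "e \<in> (`) f ` medges X" using that by (simp add: map_mixed_graph_def)
    then obtain e' where e': "e = f ` e'" "e' \<in> medges X" by blast
    then have "e' \<subseteq> mverts X" "card e' = 2" using assms(1) by (auto simp: mixed_graph_def)
    then show ?thesis using e' card_image[of f e'] inj_on_subset[OF assms(2)] by auto
  qed
  moreover have "marcs (map_mixed_graph f X) \<subseteq> f ` mverts X \<times> f ` mverts X"
    by (auto dest!: arcs)
  moreover have "mverts (map_mixed_graph f X) = f ` mverts X" by (simp add: map_mixed_graph_def)
  moreover have "finite (f ` mverts X)" using assms(1) by (simp add: mixed_graph_def)
  ultimately show ?thesis unfolding mixed_graph_def by (simp only:) blast
qed

lemma herm_entry_map:
  assumes "mixed_graph X" "inj_on f (mverts X)" "u \<in> mverts X" "v \<in> mverts X"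
  shows "herm_entry (map_mixed_graph f X) (f u) (f v) = herm_entry X u v"
  using map_mixed_graph_edge_iff[OF assms] map_mixed_graph_edge_iff[OF assms(1,2,4,3)]
  by (simp add: herm_entry_def)

lemma mixed_graph_iso_map:
  assumes "mixed_graph X" "inj_on f (mverts X)"
  shows "mixed_graph_iso (map_mixed_graph f X) X"
proof -
  let ?g = "inv_into (mverts X) f" and ?Z = "map_mixed_graph f X"
  have V: "mverts ?Z = f ` mverts X" by (simp add: map_mixed_graph_def)
  have "bij_betw ?g (mverts ?Z) (mverts X)"
    unfolding V by (rule bij_betw_inv_into) (use assms(2) in \<open>simp add: bij_betw_def\<close>)
  moreover have "({a, b} \<in> medges ?Z \<longleftrightarrow> {?g a, ?g b} \<in> medges X) \<and>
      ((a, b) \<in> marcs ?Z \<longleftrightarrow> (?g a, ?g b) \<in> marcs X)" if "a \<in> mverts ?Z" "b \<in> mverts ?Z" for a b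
  proof -
    have "a \<in> f ` mverts X" "b \<in> f ` mverts X" using that by (simp_all add: V)
    then obtain u v where uv: "u \<in> mverts X" "v \<in> mverts X" "a = f u" "b = f v" by blast
    then show ?thesis using map_mixed_graph_edge_iff[OF assms uv(1,2)] assms(2) by simp
  qed
  ultimately show ?thesis unfolding mixed_graph_iso_def by blast
qed

lemma switching_equivalentI:
  fixes X Y :: "(nat, 'b) mixed_graph_scheme"
  assumes "mverts X = mverts Y" "finite (mverts X)" "\<And>x. x \<in> mverts X \<Longrightarrow> d x \<in> unit4"
    and "\<And>x y. x \<in> mverts X \<Longrightarrow> y \<in> mverts X \<Longrightarrow> herm_entry X x y = cnj (d x) * herm_entry Y x y * d y"
  shows "switching_equivalent X Y"
proof -
  let ?n = "card (mverts X)" and ?vs = "sorted_list_of_set (mverts X)"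
  have vs: "?vs ! i \<in> mverts X" if "i < ?n" for i using assms(2) nth_mem[of i ?vs] that by simp
  define D E where "D = mat ?n ?n (\<lambda>(i, j). if i = j then d (?vs ! i) else 0)"
    and "E = mat ?n ?n (\<lambda>(i, j). if i = j then cnj (d (?vs ! i)) else 0)"
  have D: "D \<in> carrier_mat ?n ?n" and E: "E \<in> carrier_mat ?n ?n" by (simp_all add: D_def E_def)
  have mulD: "(A * D) $$ (i, j) = A $$ (i, j) * d (?vs ! j)"
    if "A \<in> carrier_mat ?n ?n" "i < ?n" "j < ?n" for A i j
  proof -
    have "(A * D) $$ (i, j) = (\<Sum>k<?n. A $$ (i, k) * (if k = j then d (?vs ! k) else 0))"
      using that by (simp add: D_def scalar_prod_def lessThan_atLeast0)
    also have "\<dots> = (\<Sum>k<?n. if k = j then A $$ (i, k) * d (?vs ! k) else 0)"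
      by (rule sum.cong) auto
    finally have "(A * D) $$ (i, j) = (\<Sum>k<?n. if k = j then A $$ (i, k) * d (?vs ! k) else 0)" .
    then show ?thesis using that by simp
  qed
  have mulE: "(E * A) $$ (i, j) = cnj (d (?vs ! i)) * A $$ (i, j)"
    if "A \<in> carrier_mat ?n ?n" "i < ?n" "j < ?n" for A i j
  proof -
    have "(E * A) $$ (i, j) = (\<Sum>k<?n. (if i = k then cnj (d (?vs ! i)) else 0) * A $$ (k, j))"
      using that by (simp add: E_def scalar_prod_def lessThan_atLeast0)
    also have "\<dots> = (\<Sum>k<?n. if k = i then cnj (d (?vs ! k)) * A $$ (k, j) else 0)"
      by (rule sum.cong) auto
    finally have "(E * A) $$ (i, j) = (\<Sum>k<?n. if k = i then cnj (d (?vs ! k)) * A $$ (k, j) else 0)" .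
    then show ?thesis using that by simp
  qed
  have uc: "cnj (d (?vs ! i)) * d (?vs ! i) = 1" "d (?vs ! i) * cnj (d (?vs ! i)) = 1" if "i < ?n" for i
    using unit4_cnj_mult[OF assms(3)[OF vs[OF that]]] by auto
  have "E * D = 1\<^sub>m ?n"
  proof (rule eq_matI)
    fix i j assume "i < dim_row (1\<^sub>m ?n :: complex mat)" "j < dim_col (1\<^sub>m ?n :: complex mat)"
    then have ij: "i < ?n" "j < ?n" by simp_all
    have "(E * D) $$ (i, j) = E $$ (i, j) * d (?vs ! j)" by (rule mulD[OF E ij])
    also have "\<dots> = 1\<^sub>m ?n $$ (i, j)" using ij uc by (simp add: E_def)
    finally show "(E * D) $$ (i, j) = 1\<^sub>m ?n $$ (i, j)" .
  qed (use D E in auto)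
  moreover from this have "D * E = 1\<^sub>m ?n" by (rule mat_mult_left_right_inverse[OF E D])
  moreover have "herm_adj X = E * herm_adj Y * D"
  proof (rule eq_matI)
    have Y: "herm_adj Y \<in> carrier_mat ?n ?n" using herm_adj_carrier[of Y] assms(1) by simp
    then have EY: "E * herm_adj Y \<in> carrier_mat ?n ?n" using E by simp
    fix i j assume "i < dim_row (E * herm_adj Y * D)" "j < dim_col (E * herm_adj Y * D)"
    then have ij: "i < ?n" "j < ?n" using E D by auto
    then show "herm_adj X $$ (i, j) = (E * herm_adj Y * D) $$ (i, j)"
      using assms(4)[OF vs vs, of i j] assms(1)
      by (simp add: mulD[OF EY] mulE[OF Y] herm_adj_entry[of i X j] herm_adj_entry[of i Y j])
  qed (use E D herm_adj_carrier[of X] in auto)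
  moreover have "D $$ (i, i) \<in> {1, - 1, \<i>, - \<i>}" if "i < ?n" for i
    using assms(3)[OF vs[OF that]] that by (simp add: D_def unit4_def)
  moreover have "diagonal_mat D" by (simp add: D_def diagonal_mat_def)
  ultimately show ?thesis
    unfolding switching_equivalent_def inverts_mat_def
    using assms(1) D E by (intro conjI exI[of _ D] exI[of _ E]) simp_all
qed

lemma switching_equivalent_entry:
  fixes X Y :: "(nat, 'b) mixed_graph_scheme"
  assumes "switching_equivalent X Y" "finite (mverts X)" "x \<in> mverts X" "y \<in> mverts X" "herm_entry X x y \<noteq> 0"
  shows "herm_entry Y x y \<noteq> 0"
proof -
  let ?n = "card (mverts X)" and ?vs = "sorted_list_of_set (mverts X)"
  have V: "mverts Y = mverts X" using assms(1) by (simp add: switching_equivalent_def)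
  obtain D E where D: "D \<in> carrier_mat ?n ?n" and E: "E \<in> carrier_mat ?n ?n" and diag: "diagonal_mat D"
    and u: "\<And>j. j < ?n \<Longrightarrow> D $$ (j, j) \<in> {1, - 1, \<i>, - \<i>}" and ED: "E * D = 1\<^sub>m ?n"
    and eq: "herm_adj X = E * herm_adj Y * D"
    using assms(1) unfolding switching_equivalent_def inverts_mat_def by (metis carrier_matD(1))
  have D0: "D $$ (i, j) = 0" if "i < ?n" "j < ?n" "i \<noteq> j" for i j
    using diag D that by (auto simp: diagonal_mat_def)
  have mulD: "(A * D) $$ (i, j) = A $$ (i, j) * D $$ (j, j)"
    if "A \<in> carrier_mat ?n ?n" "i < ?n" "j < ?n" for A i j
  proof -
    have "(A * D) $$ (i, j) = (\<Sum>k<?n. A $$ (i, k) * D $$ (k, j))"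
      using that D by (simp add: scalar_prod_def lessThan_atLeast0)
    also have "\<dots> = (\<Sum>k<?n. if k = j then A $$ (i, k) * D $$ (k, j) else 0)"
      using that(3) by (intro sum.cong) (auto simp: D0)
    finally have "(A * D) $$ (i, j) = (\<Sum>k<?n. if k = j then A $$ (i, k) * D $$ (k, j) else 0)" .
    then show ?thesis using that by simp
  qed
  have Dne: "D $$ (j, j) \<noteq> 0" if "j < ?n" for j using u[OF that] by auto
  \<comment> \<open>The inverse of an invertible diagonal matrix is diagonal, read off from the
    entries of \<open>E * D\<close>.\<close>
  have E0: "E $$ (i, j) = 0" if "i < ?n" "j < ?n" "i \<noteq> j" for i j
  proof -
    have "E $$ (i, j) * D $$ (j, j) = 1\<^sub>m ?n $$ (i, j)"
      using mulD[OF E that(1,2)] by (simp add: ED)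
    then show ?thesis using that Dne by simp
  qed
  have Y: "herm_adj Y \<in> carrier_mat ?n ?n" using herm_adj_carrier[of Y] V by simp
  have mulE: "(E * herm_adj Y) $$ (i, j) = E $$ (i, i) * herm_adj Y $$ (i, j)"
    if "i < ?n" "j < ?n" for i j
  proof -
    have "(E * herm_adj Y) $$ (i, j) = (\<Sum>k<?n. E $$ (i, k) * herm_adj Y $$ (k, j))"
      using that E Y by (simp add: scalar_prod_def lessThan_atLeast0)
    also have "\<dots> = (\<Sum>k<?n. if k = i then E $$ (i, k) * herm_adj Y $$ (k, j) else 0)"
      using that(1) by (intro sum.cong) (auto simp: E0)
    finally have "(E * herm_adj Y) $$ (i, j) = (\<Sum>k<?n. if k = i then E $$ (i, k) * herm_adj Y $$ (k, j) else 0)" .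
    then show ?thesis using that by simp
  qed
  obtain i j where ij: "i < ?n" "x = ?vs ! i" "j < ?n" "y = ?vs ! j"
    using assms(2-4) by (metis in_set_conv_nth length_sorted_list_of_set set_sorted_list_of_set)
  have EY: "E * herm_adj Y \<in> carrier_mat ?n ?n" using E Y by simp
  have "herm_adj X $$ (i, j) = (E * herm_adj Y * D) $$ (i, j)" by (rule arg_cong[OF eq])
  also have "\<dots> = E $$ (i, i) * herm_adj Y $$ (i, j) * D $$ (j, j)"
    unfolding mulD[OF EY ij(1,3)] mulE[OF ij(1,3)] ..
  finally have "herm_entry X x y = E $$ (i, i) * herm_entry Y x y * D $$ (j, j)"
    using ij V by (simp add: herm_adj_entry[of i X j] herm_adj_entry[of i Y j])
  then show ?thesis using assms(5) by auto
qed

text \<open>Switching preserves the underlying graph, and the underlying graph of \<open>C\<^sup>1\<^sub>m\<close> is 2-regular.\<close>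

lemma switching_cycle_nbrs:
  fixes Y Z :: "nat mixed_graph"
  assumes "mixed_graph Y" "switching_equivalent Y Z" "mixed_graph Z" "mixed_graph_iso Z (mixed_cycle1 m)"
    and "m \<ge> 3" "x \<in> mverts Y" "A \<subseteq> mverts Y" "\<And>y. y \<in> A \<Longrightarrow> herm_entry Y x y \<noteq> 0"
  shows "card A \<le> 2"
proof -
  have V: "mverts Z = mverts Y" using assms(2) by (simp add: switching_equivalent_def)
  have finY: "finite (mverts Y)" using assms(1) by (simp add: mixed_graph_def)
  obtain f where f: "bij_betw f (mverts Z) {0..<m}"
    and iff: "\<And>u v. u \<in> mverts Z \<Longrightarrow> v \<in> mverts Z \<Longrightarrow>
      ({u, v} \<in> medges Z \<longleftrightarrow> {f u, f v} \<in> medges (mixed_cycle1 m)) \<and>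
      ((u, v) \<in> marcs Z \<longleftrightarrow> (f u, f v) \<in> marcs (mixed_cycle1 m))"
    using assms(4) unfolding mixed_graph_iso_def by (auto simp: mixed_cycle1_def)
  have lt: "f u < m" if "u \<in> mverts Y" for u using bij_betwE[OF f] that V by auto
  have h: "herm_entry (mixed_cycle1 m) (f u) (f v) = herm_entry Z u v" if "u \<in> mverts Y" "v \<in> mverts Y" for u v
    using iff[of u v] iff[of v u] that V by (simp add: herm_entry_def)
  have "f ` A \<subseteq> {if f x = m - 1 then 0 else Suc (f x), if f x = 0 then m - 1 else f x - 1}"
  proof
    fix j assume "j \<in> f ` A"
    then obtain y where y: "y \<in> A" "j = f y" by blast
    then have "herm_entry (mixed_cycle1 m) (f x) j \<noteq> 0"
      using switching_equivalent_entry[OF assms(2) finY assms(6), of y] assms(7,8) h assms(6) by auto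
    then show "j \<in> {if f x = m - 1 then 0 else Suc (f x), if f x = 0 then m - 1 else f x - 1}"
    proof -
      have "f x < m" "j < m" using lt assms(6,7) y by auto
      then show ?thesis
        using mixed_cycle1_entry[OF assms(5), of "f x" j] \<open>herm_entry (mixed_cycle1 m) (f x) j \<noteq> 0\<close>
        by (auto split: if_splits)
    qed
  qed
  then have "card (f ` A) \<le> card {if f x = m - 1 then 0 else Suc (f x), if f x = 0 then m - 1 else f x - 1}"
    by (intro card_mono) auto
  also have "\<dots> \<le> 2" by (simp add: card_insert_if)
  also have "card (f ` A) = card A"
    using f assms(7) V by (intro card_image) (auto simp: bij_betw_def intro: inj_on_subset)
  finally show ?thesis .
qed

lemma not_DHS_of_degree:
  fixes Y :: "nat mixed_graph"
  assumes "mixed_graph Y" "herm_spec Y = herm_spec (mixed_cycle1 m)" "m \<ge> 3"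
    and "x \<in> mverts Y" "A \<subseteq> mverts Y" "\<And>y. y \<in> A \<Longrightarrow> herm_entry Y x y \<noteq> 0" "card A = 3"
  shows "\<not> DHS (mixed_cycle1 m)"
proof
  assume "DHS (mixed_cycle1 m)"
  then obtain Z :: "nat mixed_graph" where "mixed_graph Z" "switching_equivalent Y Z" "mixed_graph_iso Z (mixed_cycle1 m)"
    using assms(1,2) unfolding DHS_def by blast
  then have "card A \<le> 2" using switching_cycle_nbrs[OF assms(1) _ _ _ assms(3,4,5)] assms(6) by blast
  then show False using assms(7) by simp
qed

text \<open>Traversing the cycle in the opposite direction conjugates its weight, so
  \<open>- \<i>\<close> can always be turned into \<open>\<i>\<close>.\<close>

lemma (in spectral_graph) cycle_enumeration_ii:
  assumes "component V" "\<And>x. x \<in> V \<Longrightarrow> deg x = 2"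
  obtains c where "m \<ge> 3" "c m = c 0" "inj_on c {..<m}" "c ` {..<m} = V"
    "\<And>i. Suc i < m \<Longrightarrow> nbrs (c (Suc i)) = {c i, c (Suc (Suc i))}" "nbrs (c 0) = {c 1, c (m - 1)}"
    "(\<Prod>i<m. h (c i) (c (Suc i))) = \<i>"
proof -
  obtain c k where c: "k \<ge> 3" "c k = c 0" "inj_on c {..<k}" "c ` {..<k} = V"
    "\<And>i. Suc i < k \<Longrightarrow> nbrs (c (Suc i)) = {c i, c (Suc (Suc i))}" "nbrs (c 0) = {c 1, c (k - 1)}"
    using cycle_enumeration[OF assms] by metis
  have "k = m" using card_image[OF c(3)] c(4) card_V by simp
  note c = c[unfolded this]
  have "(\<Prod>i<m. h (c i) (c (Suc i))) \<in> {\<i>, - \<i>}"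
    by (rule cycle_component(2)[of m c V]) (fact | rule c)+
  then show thesis
  proof (elim insertE emptyE)
    assume "(\<Prod>i<m. h (c i) (c (Suc i))) = \<i>"
    then show thesis using that[of c] c by blast
  next
    assume W: "(\<Prod>i<m. h (c i) (c (Suc i))) = - \<i>"
    \<comment> \<open>Since \<open>c m = c 0\<close>, the reversed walk also starts and ends at
      \<open>c 0\<close>.\<close>
    define e where "e i = c (m - i)" for i
    have shift: "c (m - i) = c ((m - i) mod m)" if "i < m" for i
      using that c(1,2) by (cases i) auto
    have "inj_on e {..<m}"
    proof (rule inj_onI)
      fix i j assume "i \<in> {..<m}" "j \<in> {..<m}" "e i = e j"
      then have "c ((m - i) mod m) = c ((m - j) mod m)" "i < m" "j < m" using shift by (auto simp: e_def)
      then have "(m - i) mod m = (m - j) mod m" using inj_onD[OF c(3)] m_pos by auto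
      then show "i = j" using \<open>i < m\<close> \<open>j < m\<close> by (cases i; cases j) auto
    qed
    moreover have "e ` {..<m} \<subseteq> V"
      using shift c(4) m_pos by (auto simp: e_def)
    ultimately have "e ` {..<m} = V"
      using finV card_V by (intro card_subset_eq) (simp_all add: card_image)
    moreover have "nbrs (e (Suc i)) = {e i, e (Suc (Suc i))}" if "Suc i < m" for i
    proof -
      have "\<exists>j. m = Suc (Suc (i + j))" using that less_iff_Suc_add[of "Suc i" m] by auto
      then obtain j where j: "m = Suc (Suc (i + j))" by blast
      show ?thesis
        using c(5)[of j] j by (simp add: e_def insert_commute)
    qed
    moreover have "nbrs (e 0) = {e 1, e (m - 1)}"
      using c(1,2,6) by (auto simp: e_def)
    moreover have "(\<Prod>i<m. h (e i) (e (Suc i))) = \<i>"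
    proof -
      have "(\<Prod>i<m. h (e i) (e (Suc i))) = (\<Prod>i<m. h (c (Suc i)) (c i))"
        by (rule prod.reindex_bij_witness[of _ "\<lambda>i. m - Suc i" "\<lambda>i. m - Suc i"])
          (auto simp: e_def Suc_diff_Suc)
      also have "\<dots> = cnj (\<Prod>i<m. h (c i) (c (Suc i)))" by (simp add: h_sym)
      finally show ?thesis by (simp add: W)
    qed
    ultimately show thesis
      using that[of e] c(1,2) \<open>inj_on e {..<m}\<close> by (auto simp: e_def)
  qed
qed

text \<open>Switching by the partial products of the gains makes the edges of the path undirected
  and collects the whole weight \<open>\<i>\<close> on the closing edge. \<open>Z\<close> is the
  mixed cycle carried to the vertices of \<open>Y\<close> along the enumeration.\<close>

lemma cycle_switching:
  fixes Y :: "nat mixed_graph"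
  assumes "mixed_graph Y" "spectral_graph (mverts Y) (herm_entry Y) m phi"
    and "gain_graph.component (mverts Y) (herm_entry Y) (mverts Y)"
    and "\<And>x. x \<in> mverts Y \<Longrightarrow> gain_graph.deg (herm_entry Y) x = 2"
  shows "\<exists>Z :: nat mixed_graph. mixed_graph Z \<and> switching_equivalent Y Z \<and> mixed_graph_iso Z (mixed_cycle1 m)"
proof -
  let ?V = "mverts Y" and ?h = "herm_entry Y" and ?C = "mixed_cycle1 m"
  interpret spectral_graph ?V ?h m phi by (rule assms(2))
  obtain c where c: "m \<ge> 3" "c m = c 0" "inj_on c {..<m}" "c ` {..<m} = ?V"
    "\<And>i. Suc i < m \<Longrightarrow> nbrs (c (Suc i)) = {c i, c (Suc (Suc i))}" "nbrs (c 0) = {c 1, c (m - 1)}"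
    "(\<Prod>i<m. ?h (c i) (c (Suc i))) = \<i>"
    by (rule cycle_enumeration_ii[OF assms(3)], erule assms(4), rule that)
  have C: "mixed_graph ?C" by (rule mixed_graph_mixed_cycle1[OF c(1)])
  have VC: "mverts ?C = {..<m}" by (auto simp: mixed_cycle1_def)
  have inj: "inj_on c (mverts ?C)" using c(3) by (simp add: VC)
  define Z where "Z = map_mixed_graph c ?C"
  have VZ: "mverts Z = ?V" using c(4) by (simp add: Z_def map_mixed_graph_def VC)
  have hZ: "herm_entry Z (c i) (c j) = herm_entry ?C i j" if "i < m" "j < m" for i j
    unfolding Z_def by (rule herm_entry_map[OF C inj]) (use that in \<open>simp_all add: VC\<close>)
  define g where "g i = (\<Prod>j<i. ?h (c j) (c (Suc j)))" for i
  define d where "d x = g (inv_into {..<m} c x)" for x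
  have dc: "d (c i) = g i" if "i < m" for i using c(3) that by (simp add: d_def)
  have adj: "c (Suc i) \<in> nbrs (c i)" if "i < m" for i
  proof (cases i)
    case 0 then show ?thesis using c(6) by simp
  next
    case (Suc j) then show ?thesis using c(5)[of j] that by auto
  qed
  have gu: "g i \<in> unit4" if "i \<le> m" for i
    using that
  proof (induction i)
    case (Suc i)
    then show ?case using adj[of i] h_unit by (auto simp: g_def nbrs_def intro!: unit4_mult)
  qed (simp add: g_def unit4_def)
  have fwd: "?h (c i) (c j) = cnj (g i) * herm_entry ?C i j * g j"
    if ij: "i < m" "j < m" "j = (if i = m - 1 then 0 else Suc i)" for i j
  proof (cases "i = m - 1")
    case True
    then have j0: "j = 0" "Suc i = m" using ij by auto
    have "g i * ?h (c i) (c (Suc i)) = \<i>"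
      using c(7) unfolding g_def j0(2)[symmetric] by simp
    then have "cnj (g i) * (g i * ?h (c i) (c 0)) = cnj (g i) * \<i>" using j0 c(2) by simp
    then have "?h (c i) (c 0) = cnj (g i) * \<i>"
      using unit4_cnj_mult(1)[OF gu[of i]] ij by (simp add: mult.assoc[symmetric])
    moreover have "herm_entry ?C i 0 = \<i>" using mixed_cycle1_entry[OF c(1), of i 0] True c(1) by simp
    ultimately show ?thesis using j0 by (simp add: g_def)
  next
    case False
    then have j: "j = Suc i" using ij by simp
    have "cnj (g i) * g (Suc i) = ?h (c i) (c (Suc i))"
      using unit4_cnj_mult(1)[OF gu[of i]] ij by (simp add: g_def mult.assoc[symmetric])
    moreover have "herm_entry ?C i (Suc i) = 1" using mixed_cycle1_entry[OF c(1), of i "Suc i"] ij j by simp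
    ultimately show ?thesis using j by simp
  qed
  have main: "?h (c i) (c j) = cnj (g i) * herm_entry ?C i j * g j" if ij: "i < m" "j < m" for i j
  proof -
    interpret C: gain_graph "mverts ?C" "herm_entry ?C" by (rule gain_graph_herm_entry[OF C])
    consider "j = (if i = m - 1 then 0 else Suc i)" | "i = (if j = m - 1 then 0 else Suc j)"
      | "j \<noteq> (if i = m - 1 then 0 else Suc i)" "i \<noteq> (if j = m - 1 then 0 else Suc j)" by blast
    then show ?thesis
    proof cases
      case 1 then show ?thesis using fwd ij by blast
    next
      case 2
      then have "?h (c j) (c i) = cnj (g j) * herm_entry ?C j i * g i" using fwd ij by blast
      then have "cnj (?h (c j) (c i)) = cnj (cnj (g j) * herm_entry ?C j i * g i)" by simp
      then show ?thesis by (simp add: h_sym C.h_sym mult_ac)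
    next
      case 3
      have "herm_entry ?C i j = 0"
        using mixed_cycle1_entry[OF c(1) ij] 3 ij by (auto split: if_splits)
      moreover have "c j \<notin> nbrs (c i)"
      proof
        assume cj: "c j \<in> nbrs (c i)"
        show False
        proof (cases i)
          case 0
          then have "c j = c 1 \<or> c j = c (m - 1)" using cj c(6) by auto
          then have "j = 1 \<or> j = m - 1" using inj_onD[OF c(3), of j] ij c(1) by auto
          then show False using 3 0 c(1) by (auto split: if_splits)
        next
          case (Suc l)
          then have "c j = c l \<or> c j = c (Suc i)" using cj c(5)[of l] ij by auto
          then show False
          proof
            assume "c j = c l"
            then have "j = l" using inj_onD[OF c(3), of j l] ij Suc by auto
            then show False using 3 Suc ij by (auto split: if_splits)
          next
            assume eq: "c j = c (Suc i)"
            show False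
            proof (cases "Suc i = m")
              case True
              then have "j = 0" using eq c(2) inj_onD[OF c(3), of j 0] ij by auto
              then show False using 3 True by auto
            next
              case False
              then have "j = Suc i" using eq inj_onD[OF c(3), of j "Suc i"] ij by auto
              moreover have "i \<noteq> m - 1" using False c(1) by auto
              ultimately show False using 3(1) by simp
            qed
          qed
        qed
      qed
      ultimately show ?thesis by (simp add: nbrs_def)
    qed
  qed
  have "switching_equivalent Y Z"
  proof (rule switching_equivalentI)
    fix x assume "x \<in> ?V"
    then obtain i where "i < m" "x = c i" using c(4) by auto
    then show "d x \<in> unit4" using dc gu by simp
  next
    fix x y assume "x \<in> ?V" "y \<in> ?V"
    then obtain i j where "i < m" "x = c i" "j < m" "y = c j" using c(4) by (metis imageE lessThan_iff)
    then show "?h x y = cnj (d x) * herm_entry Z x y * d y" using dc hZ main by simp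
  qed (simp_all add: VZ finV)
  moreover have "mixed_graph Z" unfolding Z_def by (rule mixed_graph_map[OF C inj])
  moreover have "mixed_graph_iso Z ?C" unfolding Z_def by (rule mixed_graph_iso_map[OF C inj])
  ultimately show ?thesis by blast
qed

lemma DHS_mixed_cycle1:
  assumes "odd m" "m \<ge> 3" "m \<notin> {7, 9, 15}"
  shows "DHS (mixed_cycle1 m)"
  unfolding DHS_def
proof (intro allI impI)
  fix Y :: "nat mixed_graph"
  assume Y: "mixed_graph Y \<and> herm_spec Y = herm_spec (mixed_cycle1 m)"
  then have cp: "card (mverts Y) = m" "char_poly (herm_adj Y) = dickson m"
    using herm_spec_mixed_cycle1_iff[OF assms(1,2)] by auto
  obtain phi where sg: "spectral_graph (mverts Y) (herm_entry Y) m phi"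
    using spectral_graph_of_char_poly[OF _ assms(1) cp] Y by blast
  interpret spectral_graph "mverts Y" "herm_entry Y" m phi by (rule sg)
  have "component (mverts Y) \<and> (\<forall>x\<in>mverts Y. deg x = 2)"
    using component_structure assms(2,3) by auto
  then show "\<exists>Z :: nat mixed_graph. mixed_graph Z \<and> switching_equivalent Y Z \<and> mixed_graph_iso Z (mixed_cycle1 m)"
    using cycle_switching[OF _ sg] Y by blast
qed

section \<open>The cospectral mates\<close>

text \<open>The first factor belongs to the indices of order 1, 3 and 5, the second to the eight
  units modulo 15. Each is the spectrum of one component of the mate.\<close>

lemma dickson_root_cases:
  assumes "poly (dickson 15) x = 0"
  shows "x ^ 7 - 8 * x ^ 5 + 20 * x ^ 3 - 15 * x = 0 \<or> x ^ 8 - 7 * x ^ 6 + 14 * x ^ 4 - 8 * x\<^sup>2 + 1 = 0"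
proof -
  have "poly (dickson 15) x = (x ^ 7 - 8 * x ^ 5 + 20 * x ^ 3 - 15 * x) * (x ^ 8 - 7 * x ^ 6 + 14 * x ^ 4 - 8 * x\<^sup>2 + 1)"
    by (simp add: eval_nat_numeral algebra_simps)
  then show ?thesis using assms by simp
qed

lemma poly_dickson_7: "poly (dickson 7) x = x ^ 7 - 7 * x ^ 5 + 14 * x ^ 3 - 7 * x"
  by (simp add: eval_nat_numeral algebra_simps)

lemma poly_dickson_9: "poly (dickson 9) x = x * (x ^ 8 - 9 * x ^ 6 + 27 * x ^ 4 - 30 * x\<^sup>2 + 9)"
  by (simp add: eval_nat_numeral algebra_simps)

text \<open>The two consecutive arcs give the 4-cycle 0-1-2-3 weight -1. With 4 and 5 it is an
  \<open>e6_quad\<close>, and 6 is one attached vertex.\<close>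

definition mate7 :: "nat mixed_graph" where
  "mate7 = \<lparr>mverts = {0..<7}, medges = {{2, 3}, {3, 0}, {0, 4}, {1, 5}, {5, 6}},
     marcs = {(0, 1), (1, 2)}\<rparr>"

lemma mixed_graph_mate7: "mixed_graph mate7"
  by (auto simp: mixed_graph_def mate7_def doubleton_eq_iff)

lemma not_DHS_7: "\<not> DHS (mixed_cycle1 7)"
proof (rule not_DHS_of_degree[OF mixed_graph_mate7, where x = 0 and A = "{1, 3, 4}"])
  have card: "card (mverts mate7) = 7" by (simp add: mate7_def)
  have "char_poly (herm_adj mate7) = dickson 7"
  proof (rule char_poly_dickson)
    show "herm_adj mate7 \<in> carrier_mat 7 7" using herm_adj_carrier[of mate7] card by simp
    fix t
    define x where "x = complex_of_real (lam 7 t)"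
    have "poly (dickson 7) x = 0" unfolding x_def by (rule dickson_lam) simp
    then have x: "x ^ 7 - 7 * x ^ 5 + 14 * x ^ 3 - 7 * x = 0" by (simp only: poly_dickson_7)
    \<comment> \<open>The coordinates solve the equations vertex by vertex up to a common factor;
      the constant \<open>\<i>\<close> at vertex 3 keeps the vector nonzero for every root.\<close>
    define f where "f = (\<lambda>k. [\<i> * x ^ 3 - 2 * \<i> * x, x ^ 4 - 3 * x\<^sup>2 + 1, - \<i> * x ^ 3 + 3 * \<i> * x, \<i>,
      \<i> * x\<^sup>2 - 2 * \<i>, x ^ 5 - 5 * x ^ 3 + 6 * x, x ^ 6 - 6 * x ^ 4 + 9 * x\<^sup>2 - 1] ! k)"
    show "eigenvalue (herm_adj mate7) (of_real (lam 7 t))"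
      unfolding x_def[symmetric]
    proof (rule eigenvalue_herm_adj[where f = f and ?x0.0 = 3])
      fix k assume "k \<in> mverts mate7"
      then have "k \<in> {0, 1, 2, 3, 4, 5, 6}" by (auto simp: mate7_def)
      then show "(\<Sum>y\<in>mverts mate7. herm_entry mate7 k y * f y) = x * f k"
        using x
        by (elim insertE emptyE)
          (simp_all add: mate7_def herm_entry_def f_def doubleton_eq_iff eval_nat_numeral algebra_simps)
    qed (simp_all add: mate7_def f_def)
  qed simp
  then show "herm_spec mate7 = herm_spec (mixed_cycle1 7)"
    by (subst herm_spec_mixed_cycle1_iff) (simp_all add: card)
  show "herm_entry mate7 0 y \<noteq> 0" if "y \<in> {1, 3, 4}" for y
    using that by (elim insertE emptyE) (simp_all add: mate7_def herm_entry_def doubleton_eq_iff)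
qed (simp_all add: mate7_def)

text \<open>The isolated vertex 8 supplies the eigenvalue 0. The other eight vertices are an
  \<open>e6_ladder\<close> with the path 6-7 joined to vertex 2.\<close>

definition mate9 :: "nat mixed_graph" where
  "mate9 = \<lparr>mverts = {0..<9}, medges = {{0, 1}, {3, 0}, {1, 5}, {2, 6}, {6, 7}},
     marcs = {(1, 2), (2, 3), (0, 4), (4, 5)}\<rparr>"

lemma mixed_graph_mate9: "mixed_graph mate9"
  by (auto simp: mixed_graph_def mate9_def doubleton_eq_iff)

lemma not_DHS_9: "\<not> DHS (mixed_cycle1 9)"
proof (rule not_DHS_of_degree[OF mixed_graph_mate9, where x = 0 and A = "{1, 3, 4}"])
  have card: "card (mverts mate9) = 9" by (simp add: mate9_def)
  have V: "k \<in> {0, 1, 2, 3, 4, 5, 6, 7, 8}" if "k \<in> mverts mate9" for k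
    using that by (auto simp: mate9_def)
  have "char_poly (herm_adj mate9) = dickson 9"
  proof (rule char_poly_dickson)
    show "herm_adj mate9 \<in> carrier_mat 9 9" using herm_adj_carrier[of mate9] card by simp
    fix t
    define x where "x = complex_of_real (lam 9 t)"
    have "poly (dickson 9) x = 0" unfolding x_def by (rule dickson_lam) simp
    then have x: "x = 0 \<or> x ^ 8 - 9 * x ^ 6 + 27 * x ^ 4 - 30 * x\<^sup>2 + 9 = 0" by (simp add: poly_dickson_9)
    show "eigenvalue (herm_adj mate9) (of_real (lam 9 t))"
      unfolding x_def[symmetric]
    proof (cases "x = 0")
      case True
      show "eigenvalue (herm_adj mate9) x"
      proof (rule eigenvalue_herm_adj[where f = "\<lambda>k. of_bool (k = 8)" and ?x0.0 = 8])
        fix k assume "k \<in> mverts mate9"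
        from V[OF this] show "(\<Sum>y\<in>mverts mate9. herm_entry mate9 k y * of_bool (y = 8)) = x * of_bool (k = 8)"
          by (elim insertE emptyE)
            (simp_all add: mate9_def herm_entry_def doubleton_eq_iff eval_nat_numeral True)
      qed (simp_all add: mate9_def)
    next
      case False
      then have x': "x ^ 8 - 9 * x ^ 6 + 27 * x ^ 4 - 30 * x\<^sup>2 + 9 = 0" using x by simp
      \<comment> \<open>The vector is known to be nonzero from its entry \<open>\<i> * x\<close> at
        vertex 4, which is why the root 0 is treated apart.\<close>
      define f where "f = (\<lambda>k. [x ^ 6 - 6 * x ^ 4 + 9 * x\<^sup>2 - 3, x ^ 7 - 6 * x ^ 5 + 10 * x ^ 3 - 4 * x,
        - \<i> * x ^ 6 + 5 * \<i> * x ^ 4 - 7 * \<i> * x\<^sup>2 + 3 * \<i>, 2 * x - x ^ 3, \<i> * x,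
        x ^ 6 - 6 * x ^ 4 + 10 * x\<^sup>2 - 3, - \<i> * x ^ 5 + 4 * \<i> * x ^ 3 - 3 * \<i> * x,
        - \<i> * x ^ 4 + 4 * \<i> * x\<^sup>2 - 3 * \<i>, 0] ! k)"
      show "eigenvalue (herm_adj mate9) x"
      proof (rule eigenvalue_herm_adj[where f = f and ?x0.0 = 4])
        fix k assume "k \<in> mverts mate9"
        from V[OF this] show "(\<Sum>y\<in>mverts mate9. herm_entry mate9 k y * f y) = x * f k"
          using x'
          by (elim insertE emptyE)
            (simp_all add: mate9_def herm_entry_def f_def doubleton_eq_iff eval_nat_numeral algebra_simps)
      qed (use False in \<open>simp_all add: mate9_def f_def\<close>)
    qed
  qed simp
  then show "herm_spec mate9 = herm_spec (mixed_cycle1 9)"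
    by (subst herm_spec_mixed_cycle1_iff) (simp_all add: card)
  show "herm_entry mate9 0 y \<noteq> 0" if "y \<in> {1, 3, 4}" for y
    using that by (elim insertE emptyE) (simp_all add: mate9_def herm_entry_def doubleton_eq_iff)
qed (simp_all add: mate9_def)

text \<open>Vertices 0 to 6 are an \<open>e6_ladder\<close> with one pendant vertex. The remaining
  eight form the Dynkin diagram of \<open>E_8\<close>, whose eigenvalues
  \<open>2 cos (pi j / 30)\<close> with \<open>j\<close> coprime to 30 are the
  \<open>lam 15 t\<close> with \<open>t\<close> coprime to 15.\<close>

definition mate15 :: "nat mixed_graph" where
  "mate15 = \<lparr>mverts = {0..<15},
     medges = {{0, 1}, {3, 0}, {1, 5}, {2, 6},
       {7, 8}, {8, 9}, {9, 10}, {10, 11}, {11, 12}, {12, 13}, {9, 14}},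
     marcs = {(1, 2), (2, 3), (0, 4), (4, 5)}\<rparr>"

lemma mixed_graph_mate15: "mixed_graph mate15"
  by (auto simp: mixed_graph_def mate15_def doubleton_eq_iff)

lemma not_DHS_15: "\<not> DHS (mixed_cycle1 15)"
proof (rule not_DHS_of_degree[OF mixed_graph_mate15, where x = 0 and A = "{1, 3, 4}"])
  have card: "card (mverts mate15) = 15" by (simp add: mate15_def)
  have V: "k \<in> {0, 1, 2, 3, 4, 5, 6, 7, 8, 9, 10, 11, 12, 13, 14}" if "k \<in> mverts mate15" for k
    using that by (simp add: mate15_def) presburger
  have "char_poly (herm_adj mate15) = dickson 15"
  proof (rule char_poly_dickson)
    show "herm_adj mate15 \<in> carrier_mat 15 15" using herm_adj_carrier[of mate15] card by simp
    fix t
    define x where "x = complex_of_real (lam 15 t)"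
    have "poly (dickson 15) x = 0" unfolding x_def by (rule dickson_lam) simp
    from dickson_root_cases[OF this] show "eigenvalue (herm_adj mate15) (of_real (lam 15 t))"
      unfolding x_def[symmetric]
    proof
      assume x: "x ^ 7 - 8 * x ^ 5 + 20 * x ^ 3 - 15 * x = 0"
      define f where "f = (\<lambda>k. [\<i> * x ^ 5 - 5 * \<i> * x ^ 3 + 5 * \<i> * x, - \<i>, 3 * x - x ^ 3,
        \<i> * x ^ 4 - 4 * \<i> * x\<^sup>2 + 2 * \<i>, x ^ 6 - 6 * x ^ 4 + 9 * x\<^sup>2 - 1,
        - \<i> * x ^ 5 + 6 * \<i> * x ^ 3 - 9 * \<i> * x, - x\<^sup>2 + 3, 0, 0, 0, 0, 0, 0, 0, 0] ! k)"
      show "eigenvalue (herm_adj mate15) x"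
      proof (rule eigenvalue_herm_adj[where f = f and ?x0.0 = 1])
        fix k assume "k \<in> mverts mate15"
        from V[OF this] show "(\<Sum>y\<in>mverts mate15. herm_entry mate15 k y * f y) = x * f k"
          using x
          by (elim insertE emptyE)
            (simp_all add: mate15_def herm_entry_def f_def doubleton_eq_iff eval_nat_numeral algebra_simps)
      qed (simp_all add: mate15_def f_def)
    next
      assume x: "x ^ 8 - 7 * x ^ 6 + 14 * x ^ 4 - 8 * x\<^sup>2 + 1 = 0"
      then have x0: "x \<noteq> 0" by auto
      define f where "f = (\<lambda>k. [0, 0, 0, 0, 0, 0, 0, x ^ 7 - 6 * x ^ 5 + 9 * x ^ 3 - 2 * x,
        x ^ 6 - 5 * x ^ 4 + 6 * x\<^sup>2 - 1, x ^ 5 - 3 * x ^ 3 + x, x ^ 4 - 2 * x\<^sup>2, x ^ 3 - x, x\<^sup>2, x,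
        x ^ 4 - 3 * x\<^sup>2 + 1] ! k)"
      show "eigenvalue (herm_adj mate15) x"
      proof (rule eigenvalue_herm_adj[where f = f and ?x0.0 = 13])
        fix k assume "k \<in> mverts mate15"
        from V[OF this] show "(\<Sum>y\<in>mverts mate15. herm_entry mate15 k y * f y) = x * f k"
          using x
          by (elim insertE emptyE)
            (simp_all add: mate15_def herm_entry_def f_def doubleton_eq_iff eval_nat_numeral algebra_simps)
      qed (use x0 in \<open>simp_all add: mate15_def f_def\<close>)
    qed
  qed simp
  then show "herm_spec mate15 = herm_spec (mixed_cycle1 15)"
    by (subst herm_spec_mixed_cycle1_iff) (simp_all add: card)
  show "herm_entry mate15 0 y \<noteq> 0" if "y \<in> {1, 3, 4}" for y
    using that by (elim insertE emptyE) (simp_all add: mate15_def herm_entry_def doubleton_eq_iff)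
qed (simp_all add: mate15_def)

theorem theorem4p9:
  fixes n :: nat
  assumes "n > 0"
  shows "DHS (mixed_cycle1 (2 * n + 1)) \<longleftrightarrow> n \<notin> {3, 4, 7}"
proof
  assume "DHS (mixed_cycle1 (2 * n + 1))"
  then show "n \<notin> {3, 4, 7}" using not_DHS_7 not_DHS_9 not_DHS_15 by auto
next
  assume "n \<notin> {3, 4, 7}"
  then show "DHS (mixed_cycle1 (2 * n + 1))"
    using assms by (intro DHS_mixed_cycle1) auto
qed

end
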